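(* Assume that the CFL condition $1-\tfrac12\beta C_{\mathrm{inv}}^2C_{I_H}^2H^{-2}\Delta t^2\ge\delta$ holds for some $\delta>0$. Let $u$ be the weak solution of the wave equation, $z_H$ the semi-discrete solution and $(\tilde u_n)_{n=0,\dots,N}$ the solution of the idealized method. If $\ddot u\in L^1(0,T;L^2(\Omega))$ and $\ddot z_H\in C(0,T;L^2(\Omega))$, then, with $t_n=n\Delta t$, for all $n\ge1$ with $t_{n+1}\le T$, $$\begin{aligned} &\Big\|\frac{(\tilde u_{n+1}-u(t_{n+1}))-(\tilde u_n-u(t_n))}{\Delta t}\Big\|+\|\nabla(\tilde u_{n+1}-u(t_{n+1}))\|\\ &\le C_s\Big(\|\dot E^{1/2}\|+\|\nabla E^1\|+\|\dot z_H(0)-\Pi_{\tilde V_H}\dot u(0)\|+\|\nabla(z_H(0)-\Pi_{\tilde V_H}u(0))\|\\ &\qquad+\Big\|\frac{\rho(t_{n+1})-\rho(t_n)}{\Delta t}\Big\|+\|\nabla\rho(t_{n+1})\|+\int_0^{t_{n+1}}\|\ddot\rho(s)\|\,ds\\ &\qquad+\sum_{k=1}^n\Delta t\,\Big\|\frac{z_H(t_{k+1})-2z_H(t_k)+z_H(t_{k-1})}{(\Delta t)^2}-\ddot z_H(t_k)\Big\|\Big), \end{aligned}$$ where $C_s$ is a constant depending only on $\alpha,\beta,\delta$, namely the constant of the stability estimate of the idealized method (recalled in the context), $E^n:=\tilde u_n-z_H(n\Delta t)$, $\dot E^{1/2}:=(E^1-E^0)/\Delta t$ and $\rho(t):=u(t)-\Pi_{\tilde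 V_H}u(t)$.
   Context: $\Omega\subset\mathbb{R}^d$, $d\in\{2,3\}$, is a bounded convex polygonal (polyhedral) Lipschitz domain and $\Gamma\subseteq\partial\Omega$ has non-zero measure. $V:=H^1_\Gamma(\Omega)$ is the space of $H^1(\Omega)$ functions with zero trace on $\Gamma$. $\|\cdot\|$ and $(\cdot,\cdot)$ denote the $L^2(\Omega)$ norm and scalar product. $A\in L^\infty(\Omega;\mathbb{R}^{d\times d}_{\mathrm{sym}})$ satisfies $\alpha|\xi|^2\le A(x)\xi\cdot\xi$ and $|A(x)\xi|\le\beta|\xi|$ for all $\xi\in\mathbb{R}^d$ and a.e. $x\in\Omega$, with $0<\alpha\le\beta<\infty$, and $a(u,v):=\int_\Omega A\nabla u\cdot\nabla v\,dx$. Wave equation: $T>0$, $u_0\in V$, $v_0\in L^2(\Omega)$, $f\in L^2(0,T;L^2(\Omega))$ (with point values in time where needed). $u\in L^2(0,T;V)$ with $\dot u\in L^2(0,T;L^2(\Omega))$ and $\ddot u\in L^2(0,T;V')$ is the weak solution: $\langle\ddot u,v\rangle+a(u,v)=(f,v)$ for all $v\in V$, $u(0)=u_0$, $\dot u(0)=v_0$. $\mathcal{T}_H$ is a quasi-uniform shape regular mesh of $\Omega$ with mesh size $H$, and $V_H\subset V$ is the corresponding standard $P_1$/$Q_1$ finite element space. $C_{\mathrm{inv}}$ is the constant of the standard inverse inequality $\|\nabla v_H\|\le C_{\mathrm{inv}}H^{-1}\|v_H\|$ for all $v_H\in V_H$. $I_H:V\to V_H$ is a linear projection (quasi-interpolation)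 satisfying, for all $v\in V$, $\|H^{-1}(v-I_Hv)\|+\|\nabla I_Hv\|\le C_{I_H}\|\nabla v\|$ and $\|I_Hv\|\le C_{I_H}\|v\|$, with $C_{I_H}$ independent of $H$; by $L^2$-stability, $I_H$ is extended continuously to $L^2(\Omega)$. $W:=\operatorname{Ker} I_H\subset V$. For $v\in V$ the corrector $\mathcal{C}v\in W$ is the unique solution of $a(\mathcal{C}v,w)=a(v,w)$ for all $w\in W$. $\tilde V_H:=(1-\mathcal{C})V_H$. $\Pi_{\tilde V_H}:V\to\tilde V_H$ is the $a$-orthogonal projection; it equals $(1-\mathcal{C})I_H$ on $V$ and is extended to $L^2(\Omega)$ by this formula. Idealized method: time step $\Delta t>0$, $N=\lceil T/\Delta t\rceil$. Given $\tilde u_0=(1-\mathcal{C})I_Hu_0$ and some $\tilde u_1\in\tilde V_H$, the sequence $(\tilde u_n)_{n=0,\dots,N}$ in $\tilde V_H$ satisfies, for $1\le n\le N-1$ and all $\tilde v_H\in\tilde V_H$, $\Delta t^{-2}(\tilde u_{n+1}-2\tilde u_n+\tilde u_{n-1},\tilde v_H)+a(\tilde u_n,\tilde v_H)=(f(n\Delta t),\tilde v_H)$. Stability estimate: under the CFL condition, there is $C_s$ depending only on $\alpha,\beta,\delta$ such that solutions of the idealized method (for arbitrary right-hand side and starting values) satisfy $\|\Delta t^{-1}(\tilde u_{n+1}-\tilde u_n)\|+\|\nabla\tilde u_{n+1}\|\le C_s(\Delta t\sum_{k=1}^n\|f(k\Delta t)\|+\|\Delta t^{-1}(\tilde u_1-\tilde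 u_0)\|+\|\nabla\tilde u_0\|+\|\nabla\tilde u_1\|)$. Here $C_s$ is the generic constant of this estimate (it may be taken as $\max\{\sqrt{2/\delta},2/\sqrt\alpha\}\max\{\sqrt{2/\delta},\sqrt\beta\}$ up to a fixed numerical factor). Semi-discrete solution: $z_H\in L^2(0,T;\tilde V_H)$ with $\dot z_H,\ddot z_H\in L^2(0,T;\tilde V_H)$ solves $(\ddot z_H(t),\tilde v_H)+a(z_H(t),\tilde v_H)=(f(t),\tilde v_H)$ for all $\tilde v_H\in\tilde V_H$, $t\in[0,T]$, with $z_H(0)=(1-\mathcal{C})I_Hu_0$ and $\dot z_H(0)=(1-\mathcal{C})I_Hv_0$. *)

theory Defs
  imports "HOL-Analysis.Analysis"
begin

text \<open>Elements of function spaces are represented by ordinary functions on the whole space; only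
their values on the domain, up to null sets, matter. Subtraction of functions is pointwise.\<close>

section \<open>Lebesgue and Sobolev spaces\<close>

definition ae_eq :: "'a::euclidean_space set \<Rightarrow> ('a \<Rightarrow> 'b) \<Rightarrow> ('a \<Rightarrow> 'b) \<Rightarrow> bool" where
  "ae_eq \<Omega> f g \<longleftrightarrow> (AE x in lebesgue_on \<Omega>. f x = g x)"

definition L2 :: "'a::euclidean_space set \<Rightarrow> ('a \<Rightarrow> 'b::real_normed_vector) set" where
  "L2 \<Omega> = {f. f \<in> borel_measurable (lebesgue_on \<Omega>) \<and>
               integrable (lebesgue_on \<Omega>) (\<lambda>x. (norm (f x))\<^sup>2)}"

definition L2norm :: "'a::euclidean_space set \<Rightarrow> ('a \<Rightarrow> 'b::real_normed_vector) \<Rightarrow> real" where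
  "L2norm \<Omega> f = sqrt (integral\<^sup>L (lebesgue_on \<Omega>) (\<lambda>x. (norm (f x))\<^sup>2))"

definition L2inner :: "'a::euclidean_space set \<Rightarrow> ('a \<Rightarrow> real) \<Rightarrow> ('a \<Rightarrow> real) \<Rightarrow> real" where
  "L2inner \<Omega> f g = integral\<^sup>L (lebesgue_on \<Omega>) (\<lambda>x. f x * g x)"

text \<open>\<open>Ck k f\<close>: all partial derivatives of \<open>f\<close> up to order \<open>k\<close> exist and are continuous.\<close>

primrec Ck :: "nat \<Rightarrow> ('a::euclidean_space \<Rightarrow> real) \<Rightarrow> bool" where
  "Ck 0 f \<longleftrightarrow> continuous_on UNIV f"
| "Ck (Suc k) f \<longleftrightarrow> (\<forall>x. f differentiable (at x)) \<and>
     (\<forall>b\<in>Basis. Ck k (\<lambda>x. frechet_derivative f (at x) b))"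

definition smooth :: "('a::euclidean_space \<Rightarrow> real) \<Rightarrow> bool" where
  "smooth f \<longleftrightarrow> (\<forall>k. Ck k f)"

definition test_functions :: "'a::euclidean_space set \<Rightarrow> ('a \<Rightarrow> real) set" where
  "test_functions \<Omega> = {\<phi>. smooth \<phi> \<and> (\<exists>K. compact K \<and> K \<subseteq> \<Omega> \<and> (\<forall>x. x \<notin> K \<longrightarrow> \<phi> x = 0))}"

definition has_weak_gradient :: "(real^'d) set \<Rightarrow> (real^'d \<Rightarrow> real) \<Rightarrow> (real^'d \<Rightarrow> real^'d) \<Rightarrow> bool" where
  "has_weak_gradient \<Omega> v g \<longleftrightarrow> v \<in> L2 \<Omega> \<and> g \<in> L2 \<Omega> \<and>
     (\<forall>\<phi>\<in>test_functions \<Omega>. \<forall>i.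
        integral\<^sup>L (lebesgue_on \<Omega>) (\<lambda>x. v x * frechet_derivative \<phi> (at x) (axis i 1))
        = - integral\<^sup>L (lebesgue_on \<Omega>) (\<lambda>x. g x $ i * \<phi> x))"

definition H1 :: "(real^'d) set \<Rightarrow> (real^'d \<Rightarrow> real) set" where
  "H1 \<Omega> = {v. \<exists>g. has_weak_gradient \<Omega> v g}"

definition grad :: "(real^'d) set \<Rightarrow> (real^'d \<Rightarrow> real) \<Rightarrow> (real^'d \<Rightarrow> real^'d)" where
  "grad \<Omega> v = (SOME g. has_weak_gradient \<Omega> v g)"

definition H1norm :: "(real^'d) set \<Rightarrow> (real^'d \<Rightarrow> real) \<Rightarrow> real" where
  "H1norm \<Omega> v = sqrt ((L2norm \<Omega> v)\<^sup>2 + (L2norm \<Omega> (grad \<Omega> v))\<^sup>2)"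

section \<open>Boundary measure and traces\<close>

text \<open>The \<open>s\<close>-dimensional Hausdorff (outer) measure, for \<open>s \<ge> 1\<close>, normalised so that it is the
usual surface measure for \<open>s = d - 1\<close>.\<close>

definition hausdorff_outer :: "nat \<Rightarrow> 'a::euclidean_space set \<Rightarrow> ennreal" where
  "hausdorff_outer s E = (SUP \<epsilon>\<in>{0<..}.
     INF U\<in>{U :: nat \<Rightarrow> 'a set. E \<subseteq> (\<Union>i. U i) \<and> (\<forall>i. bounded (U i) \<and> diameter (U i) \<le> \<epsilon>)}.
       (\<Sum>i. ennreal (unit_ball_vol (real s) * (diameter (U i) / 2) ^ s)))"

definition hausdorff_measure :: "nat \<Rightarrow> 'a::euclidean_space measure" where
  "hausdorff_measure s = measure_of UNIV (sets borel) (hausdorff_outer s)"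

text \<open>The trace operator is the continuous extension of the restriction to the boundary from
functions smooth up to the boundary to \<open>H\<^sup>1\<close>.\<close>

definition has_trace :: "(real^'d) set \<Rightarrow> (real^'d \<Rightarrow> real) \<Rightarrow> (real^'d \<Rightarrow> real) \<Rightarrow> bool" where
  "has_trace \<Omega> v g \<longleftrightarrow> v \<in> H1 \<Omega> \<and> g \<in> borel_measurable borel \<and>
     (\<exists>\<phi>. (\<forall>k. smooth (\<phi> k)) \<and> (\<lambda>k. H1norm \<Omega> (\<phi> k - v)) \<longlonglongrightarrow> 0 \<and>
       (\<lambda>k. \<integral>\<^sup>+x. ennreal ((\<phi> k x - g x)\<^sup>2) * indicator (frontier \<Omega>) x
              \<partial>hausdorff_measure (CARD('d) - 1)) \<longlonglongrightarrow> 0)"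

definition H1_Gamma :: "(real^'d) set \<Rightarrow> (real^'d) set \<Rightarrow> (real^'d \<Rightarrow> real) set" where
  "H1_Gamma \<Omega> \<Gamma> = {v \<in> H1 \<Omega>. \<exists>g. has_trace \<Omega> v g \<and>
     (AE x in hausdorff_measure (CARD('d) - 1). x \<in> \<Gamma> \<longrightarrow> g x = 0)}"

text \<open>Boundedness and the Lipschitz property of the boundary are automatic for such domains.\<close>

definition convex_polytopal_domain :: "(real^'d) set \<Rightarrow> bool" where
  "convex_polytopal_domain \<Omega> \<longleftrightarrow> \<Omega> \<noteq> {} \<and> open \<Omega> \<and> convex \<Omega> \<and> polytope (closure \<Omega>)"

section \<open>The coefficient and the bilinear form\<close>

definition admissible_coefficient ::
  "(real^'d) set \<Rightarrow> real \<Rightarrow> real \<Rightarrow> (real^'d \<Rightarrow> real^'d^'d) \<Rightarrow> bool" where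
  "admissible_coefficient \<Omega> \<alpha> \<beta> A \<longleftrightarrow> A \<in> borel_measurable (lebesgue_on \<Omega>) \<and>
     (AE x in lebesgue_on \<Omega>. transpose (A x) = A x \<and>
        (\<forall>\<xi>. \<alpha> * (norm \<xi>)\<^sup>2 \<le> (A x *v \<xi>) \<bullet> \<xi> \<and> norm (A x *v \<xi>) \<le> \<beta> * norm \<xi>))"

definition bilin ::
  "(real^'d) set \<Rightarrow> (real^'d \<Rightarrow> real^'d^'d) \<Rightarrow> (real^'d \<Rightarrow> real) \<Rightarrow> (real^'d \<Rightarrow> real) \<Rightarrow> real" where
  "bilin \<Omega> A u v = integral\<^sup>L (lebesgue_on \<Omega>) (\<lambda>x. (A x *v grad \<Omega> u x) \<bullet> grad \<Omega> v x)"

section \<open>Vector-valued functions of time\<close>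

text \<open>The values lie in a function space \<open>X\<close> with (semi)norm \<open>N\<close>, or in the dual of one; both are
sets of real-valued functions.\<close>

definition bochner_measurable ::
  "real \<Rightarrow> ('b \<Rightarrow> real) set \<Rightarrow> (('b \<Rightarrow> real) \<Rightarrow> real) \<Rightarrow> (real \<Rightarrow> 'b \<Rightarrow> real) \<Rightarrow> bool" where
  "bochner_measurable T X N g \<longleftrightarrow> (\<exists>s :: nat \<Rightarrow> real \<Rightarrow> 'b \<Rightarrow> real.
     (\<forall>k. finite (s k ` {0<..<T}) \<and> s k ` {0<..<T} \<subseteq> X \<and>
          (\<forall>y. {t \<in> {0<..<T}. s k t = y} \<in> sets lebesgue)) \<and>
     (AE t in lebesgue_on {0<..<T}. (\<lambda>k. N (s k t - g t)) \<longlonglongrightarrow> 0))"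

definition bochner_Lp ::
  "nat \<Rightarrow> real \<Rightarrow> ('b \<Rightarrow> real) set \<Rightarrow> (('b \<Rightarrow> real) \<Rightarrow> real) \<Rightarrow> (real \<Rightarrow> 'b \<Rightarrow> real) \<Rightarrow> bool" where
  "bochner_Lp p T X N g \<longleftrightarrow> bochner_measurable T X N g \<and>
     (AE t in lebesgue_on {0<..<T}. g t \<in> X) \<and>
     integrable (lebesgue_on {0<..<T}) (\<lambda>t. N (g t) ^ p)"

definition continuous_in ::
  "(('b \<Rightarrow> real) \<Rightarrow> real) \<Rightarrow> real set \<Rightarrow> (real \<Rightarrow> 'b \<Rightarrow> real) \<Rightarrow> bool" where
  "continuous_in N S g \<longleftrightarrow> (\<forall>t\<in>S. ((\<lambda>s. N (g s - g t)) \<longlongrightarrow> 0) (at t within S))"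

text \<open>\<open>q\<close> is the \<open>k\<close>-th weak derivative of \<open>p\<close> on \<open>(0,T)\<close>. For Bochner integrable functions the
vector-valued identity is equivalent to the scalar identities obtained by testing with the
functionals on the range space, and it is used below in that form.\<close>

definition weak_time_deriv :: "nat \<Rightarrow> real \<Rightarrow> (real \<Rightarrow> real) \<Rightarrow> (real \<Rightarrow> real) \<Rightarrow> bool" where
  "weak_time_deriv k T p q \<longleftrightarrow> (\<forall>\<phi>\<in>test_functions {0<..<T}.
     integral\<^sup>L (lebesgue_on {0<..<T}) (\<lambda>t. p t * (deriv ^^ k) \<phi> t)
     = (-1) ^ k * integral\<^sup>L (lebesgue_on {0<..<T}) (\<lambda>t. q t * \<phi> t))"

definition L2_time_deriv ::
  "nat \<Rightarrow> real \<Rightarrow> (real^'d) set \<Rightarrow> (real \<Rightarrow> real^'d \<Rightarrow> real) \<Rightarrow> (real \<Rightarrow> real^'d \<Rightarrow> real) \<Rightarrow> bool" where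
  "L2_time_deriv k T \<Omega> g g' \<longleftrightarrow>
     (\<forall>w\<in>L2 \<Omega>. weak_time_deriv k T (\<lambda>t. L2inner \<Omega> (g t) w) (\<lambda>t. L2inner \<Omega> (g' t) w))"

definition dual_space ::
  "('a \<Rightarrow> real) set \<Rightarrow> (('a \<Rightarrow> real) \<Rightarrow> real) \<Rightarrow> (('a \<Rightarrow> real) \<Rightarrow> real) set" where
  "dual_space V N = {l. (\<forall>v\<in>V. \<forall>w\<in>V. \<forall>a b. l (\<lambda>x. a * v x + b * w x) = a * l v + b * l w) \<and>
     (\<exists>C. \<forall>v\<in>V. \<bar>l v\<bar> \<le> C * N v)}"

definition dual_norm ::
  "('a \<Rightarrow> real) set \<Rightarrow> (('a \<Rightarrow> real) \<Rightarrow> real) \<Rightarrow> (('a \<Rightarrow> real) \<Rightarrow> real) \<Rightarrow> real" where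
  "dual_norm V N l = (SUP v\<in>{v \<in> V. N v \<le> 1}. \<bar>l v\<bar>)"

section \<open>The weak solution of the wave equation\<close>

text \<open>\<open>u'\<close> is the time derivative of \<open>u\<close>, and \<open>u''\<close> the \<open>V'\<close>-valued second time derivative. As
usual, \<open>u\<close> and \<open>u'\<close> are the representatives that are continuous in time; these give a meaning to
point values and to the initial conditions.\<close>

definition weak_wave_solution ::
  "(real^'d) set \<Rightarrow> (real^'d) set \<Rightarrow> (real^'d \<Rightarrow> real^'d^'d) \<Rightarrow> real
   \<Rightarrow> (real \<Rightarrow> real^'d \<Rightarrow> real) \<Rightarrow> (real^'d \<Rightarrow> real) \<Rightarrow> (real^'d \<Rightarrow> real)
   \<Rightarrow> (real \<Rightarrow> real^'d \<Rightarrow> real) \<Rightarrow> (real \<Rightarrow> real^'d \<Rightarrow> real)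
   \<Rightarrow> (real \<Rightarrow> (real^'d \<Rightarrow> real) \<Rightarrow> real) \<Rightarrow> bool" where
  "weak_wave_solution \<Omega> \<Gamma> A T f u0 v0 u u' u'' \<longleftrightarrow>
     (\<forall>t\<in>{0..T}. u t \<in> H1_Gamma \<Omega> \<Gamma> \<and> u' t \<in> L2 \<Omega>) \<and>
     continuous_in (L2norm \<Omega>) {0..T} u \<and> continuous_in (L2norm \<Omega>) {0..T} u' \<and>
     bochner_Lp 2 T (H1_Gamma \<Omega> \<Gamma>) (H1norm \<Omega>) u \<and>
     bochner_Lp 2 T (L2 \<Omega>) (L2norm \<Omega>) u' \<and>
     bochner_Lp 2 T (dual_space (H1_Gamma \<Omega> \<Gamma>) (H1norm \<Omega>))
       (dual_norm (H1_Gamma \<Omega> \<Gamma>) (H1norm \<Omega>)) u'' \<and>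
     L2_time_deriv 1 T \<Omega> u u' \<and>
     (\<forall>v\<in>H1_Gamma \<Omega> \<Gamma>. weak_time_deriv 1 T (\<lambda>t. L2inner \<Omega> (u' t) v) (\<lambda>t. u'' t v)) \<and>
     (AE t in lebesgue_on {0<..<T}. \<forall>v\<in>H1_Gamma \<Omega> \<Gamma>.
        u'' t v + bilin \<Omega> A (u t) v = L2inner \<Omega> (f t) v) \<and>
     ae_eq \<Omega> (u 0) u0 \<and> ae_eq \<Omega> (u' 0) v0"

section \<open>Meshes and finite element spaces\<close>

definition P1 :: "(real^'d \<Rightarrow> real) set" where
  "P1 = {q. \<exists>b c. q = (\<lambda>x. b \<bullet> x + c)}"

text \<open>Polynomials of degree at most one in each variable.\<close>

definition Q1 :: "(real^'d \<Rightarrow> real) set" where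
  "Q1 = {q. \<exists>c :: 'd set \<Rightarrow> real. q = (\<lambda>x. \<Sum>S\<in>UNIV. c S * (\<Prod>i\<in>S. x $ i))}"

definition reference_simplex :: "(real^'d) set" where
  "reference_simplex = convex hull (insert 0 Basis)"

definition reference_cube :: "(real^'d) set" where
  "reference_cube = cbox 0 One"

text \<open>A mesh is given by its finite set \<open>\<F>\<close> of reference maps \<open>F\<close>, with elements \<open>F ` R\<close>, where
\<open>(R, P)\<close> is the reference element with its polynomial space: affine maps of the reference simplex
or multilinear maps of the reference cube. The mesh is conforming: distinct elements meet in a common
proper face (possibly empty). \<open>\<kappa>\<close> is the parameter of shape regularity (the scaled reference maps
are uniformly bi-Lipschitz) and of quasi-uniformity.\<close>

definition fe_mesh ::
  "(real^'d) set \<Rightarrow> (real^'d \<Rightarrow> real) set \<Rightarrow> (real^'d) set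
   \<Rightarrow> (real^'d \<Rightarrow> real^'d) set \<Rightarrow> real \<Rightarrow> real \<Rightarrow> bool" where
  "fe_mesh R P \<Omega> \<F> H \<kappa> \<longleftrightarrow>
     finite \<F> \<and> (\<Union>F\<in>\<F>. F ` R) = closure \<Omega> \<and>
     (\<forall>F\<in>\<F>. \<forall>i. (\<lambda>x. F x $ i) \<in> P) \<and>
     (\<forall>F\<in>\<F>. \<forall>G\<in>\<F>. F \<noteq> G \<longrightarrow> (\<exists>f g. f face_of R \<and> f \<noteq> R \<and> g face_of R \<and> g \<noteq> R \<and>
        F ` R \<inter> G ` R = F ` f \<and> F ` R \<inter> G ` R = G ` g)) \<and>
     H = Max ((\<lambda>F. diameter (F ` R)) ` \<F>) \<and>
     0 < \<kappa> \<and>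
     (\<forall>F\<in>\<F>. 0 < diameter (F ` R) \<and> (\<forall>x\<in>R. \<forall>y\<in>R.
        diameter (F ` R) / \<kappa> * norm (x - y) \<le> norm (F x - F y) \<and>
        norm (F x - F y) \<le> \<kappa> * diameter (F ` R) * norm (x - y))) \<and>
     (\<forall>F\<in>\<F>. H \<le> \<kappa> * diameter (F ` R))"

definition fe_space ::
  "(real^'d) set \<Rightarrow> (real^'d \<Rightarrow> real) set \<Rightarrow> (real^'d) set \<Rightarrow> (real^'d) set
   \<Rightarrow> (real^'d \<Rightarrow> real^'d) set \<Rightarrow> (real^'d \<Rightarrow> real) set" where
  "fe_space R P \<Omega> \<Gamma> \<F> = {v \<in> H1_Gamma \<Omega> \<Gamma>. continuous_on (closure \<Omega>) v \<and>
     (\<forall>F\<in>\<F>. \<exists>q\<in>P. \<forall>x\<in>R. v (F x) = q x)}"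

definition inverse_inequality :: "(real^'d) set \<Rightarrow> (real^'d \<Rightarrow> real) set \<Rightarrow> real \<Rightarrow> real \<Rightarrow> bool" where
  "inverse_inequality \<Omega> VH H Cinv \<longleftrightarrow>
     (\<forall>v\<in>VH. L2norm \<Omega> (grad \<Omega> v) \<le> Cinv * inverse H * L2norm \<Omega> v)"

section \<open>Quasi-interpolation, corrector and multiscale space\<close>

text \<open>\<open>I\<close> denotes the operator already extended from \<open>V\<close> to \<open>L\<^sup>2\<close>; the \<open>L\<^sup>2\<close>-bound carries over to
this continuous extension with the same constant.\<close>

definition quasi_interpolation ::
  "(real^'d) set \<Rightarrow> (real^'d \<Rightarrow> real) set \<Rightarrow> (real^'d \<Rightarrow> real) set \<Rightarrow> real \<Rightarrow> real
   \<Rightarrow> ((real^'d \<Rightarrow> real) \<Rightarrow> (real^'d \<Rightarrow> real)) \<Rightarrow> bool" where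
  "quasi_interpolation \<Omega> V VH H CI I \<longleftrightarrow>
     (\<forall>v\<in>L2 \<Omega>. I v \<in> VH) \<and>
     (\<forall>v\<in>L2 \<Omega>. \<forall>w\<in>L2 \<Omega>. \<forall>a b.
        ae_eq \<Omega> (I (\<lambda>x. a * v x + b * w x)) (\<lambda>x. a * I v x + b * I w x)) \<and>
     (\<forall>v\<in>VH. ae_eq \<Omega> (I v) v) \<and>
     (\<forall>v\<in>V. L2norm \<Omega> (\<lambda>x. inverse H * (v x - I v x)) + L2norm \<Omega> (grad \<Omega> (I v))
        \<le> CI * L2norm \<Omega> (grad \<Omega> v)) \<and>
     (\<forall>v\<in>L2 \<Omega>. L2norm \<Omega> (I v) \<le> CI * L2norm \<Omega> v)"

definition fine_space ::
  "(real^'d) set \<Rightarrow> (real^'d \<Rightarrow> real) set \<Rightarrow> ((real^'d \<Rightarrow> real) \<Rightarrow> (real^'d \<Rightarrow> real))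
   \<Rightarrow> (real^'d \<Rightarrow> real) set" where
  "fine_space \<Omega> V I = {w \<in> V. ae_eq \<Omega> (I w) (\<lambda>x. 0)}"

definition is_corrector ::
  "(real^'d) set \<Rightarrow> (real^'d \<Rightarrow> real^'d^'d) \<Rightarrow> (real^'d \<Rightarrow> real) set \<Rightarrow> (real^'d \<Rightarrow> real) set
   \<Rightarrow> ((real^'d \<Rightarrow> real) \<Rightarrow> (real^'d \<Rightarrow> real)) \<Rightarrow> bool" where
  "is_corrector \<Omega> A V W C \<longleftrightarrow>
     (\<forall>v\<in>V. C v \<in> W \<and> (\<forall>w\<in>W. bilin \<Omega> A (C v) w = bilin \<Omega> A v w))"

definition multiscale_space ::
  "(real^'d) set \<Rightarrow> (real^'d \<Rightarrow> real) set \<Rightarrow> (real^'d \<Rightarrow> real) set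
   \<Rightarrow> ((real^'d \<Rightarrow> real) \<Rightarrow> (real^'d \<Rightarrow> real)) \<Rightarrow> (real^'d \<Rightarrow> real) set" where
  "multiscale_space \<Omega> V VH C = {v \<in> V. \<exists>vH\<in>VH. ae_eq \<Omega> v (vH - C vH)}"

text \<open>On \<open>V\<close> this is the \<open>a\<close>-orthogonal projection onto the multiscale space; the formula extends it
to \<open>L\<^sup>2\<close>.\<close>

definition ms_proj ::
  "((real^'d \<Rightarrow> real) \<Rightarrow> (real^'d \<Rightarrow> real)) \<Rightarrow> ((real^'d \<Rightarrow> real) \<Rightarrow> (real^'d \<Rightarrow> real))
   \<Rightarrow> (real^'d \<Rightarrow> real) \<Rightarrow> (real^'d \<Rightarrow> real)" where
  "ms_proj C I v = I v - C (I v)"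

section \<open>Semi-discrete and fully discrete problems in the multiscale space\<close>

text \<open>\<open>z'\<close> and \<open>z''\<close> are the weak time derivatives of \<open>z\<close>; again \<open>z\<close> and \<open>z'\<close> are continuous
representatives.\<close>

definition semidiscrete_solution ::
  "(real^'d) set \<Rightarrow> (real^'d \<Rightarrow> real^'d^'d) \<Rightarrow> (real^'d \<Rightarrow> real) set \<Rightarrow> real
   \<Rightarrow> (real \<Rightarrow> real^'d \<Rightarrow> real) \<Rightarrow> (real^'d \<Rightarrow> real) \<Rightarrow> (real^'d \<Rightarrow> real)
   \<Rightarrow> (real \<Rightarrow> real^'d \<Rightarrow> real) \<Rightarrow> (real \<Rightarrow> real^'d \<Rightarrow> real) \<Rightarrow> (real \<Rightarrow> real^'d \<Rightarrow> real) \<Rightarrow> bool" where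
  "semidiscrete_solution \<Omega> A Vt T f z0 z1 z z' z'' \<longleftrightarrow>
     (\<forall>t\<in>{0..T}. z t \<in> Vt \<and> z' t \<in> Vt \<and> z'' t \<in> Vt) \<and>
     continuous_in (L2norm \<Omega>) {0..T} z \<and> continuous_in (L2norm \<Omega>) {0..T} z' \<and>
     bochner_Lp 2 T Vt (H1norm \<Omega>) z \<and>
     bochner_Lp 2 T Vt (H1norm \<Omega>) z' \<and>
     bochner_Lp 2 T Vt (H1norm \<Omega>) z'' \<and>
     L2_time_deriv 1 T \<Omega> z z' \<and> L2_time_deriv 1 T \<Omega> z' z'' \<and>
     (\<forall>t\<in>{0..T}. \<forall>v\<in>Vt. L2inner \<Omega> (z'' t) v + bilin \<Omega> A (z t) v = L2inner \<Omega> (f t) v) \<and>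
     ae_eq \<Omega> (z 0) z0 \<and> ae_eq \<Omega> (z' 0) z1"

text \<open>The time-stepping scheme with step size \<open>\<tau>\<close>, right-hand sides \<open>g n\<close> and free starting values.\<close>

definition leapfrog_solution ::
  "(real^'d) set \<Rightarrow> (real^'d \<Rightarrow> real^'d^'d) \<Rightarrow> (real^'d \<Rightarrow> real) set \<Rightarrow> real \<Rightarrow> nat
   \<Rightarrow> (nat \<Rightarrow> real^'d \<Rightarrow> real) \<Rightarrow> (nat \<Rightarrow> real^'d \<Rightarrow> real) \<Rightarrow> bool" where
  "leapfrog_solution \<Omega> A Vt \<tau> N g w \<longleftrightarrow> (\<forall>n\<le>N. w n \<in> Vt) \<and>
     (\<forall>n. 1 \<le> n \<and> n + 1 \<le> N \<longrightarrow> (\<forall>v\<in>Vt.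
        L2inner \<Omega> (\<lambda>x. (w (n + 1) x - 2 * w n x + w (n - 1) x) / \<tau>\<^sup>2) v + bilin \<Omega> A (w n) v
        = L2inner \<Omega> (g n) v))"

text \<open>\<open>Cs\<close> is a constant of the stability estimate of the scheme.\<close>

definition leapfrog_stable ::
  "(real^'d) set \<Rightarrow> (real^'d \<Rightarrow> real^'d^'d) \<Rightarrow> (real^'d \<Rightarrow> real) set \<Rightarrow> real \<Rightarrow> nat \<Rightarrow> real \<Rightarrow> bool" where
  "leapfrog_stable \<Omega> A Vt \<tau> N Cs \<longleftrightarrow>
     (\<forall>g w n. (\<forall>k. g k \<in> L2 \<Omega>) \<and> leapfrog_solution \<Omega> A Vt \<tau> N g w \<and> 1 \<le> n \<and> n + 1 \<le> N \<longrightarrow>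
        L2norm \<Omega> (\<lambda>x. (w (n + 1) x - w n x) / \<tau>) + L2norm \<Omega> (grad \<Omega> (w (n + 1)))
        \<le> Cs * (\<tau> * (\<Sum>k=1..n. L2norm \<Omega> (g k)) + L2norm \<Omega> (\<lambda>x. (w 1 x - w 0 x) / \<tau>)
               + L2norm \<Omega> (grad \<Omega> (w 0)) + L2norm \<Omega> (grad \<Omega> (w 1))))"

text \<open>The explicit constant of the stability estimate, with \<open>2\<close> as numerical factor. The product of
maxima alone suffices for the fully discrete scheme; the factor makes the same constant valid for the
analogous estimate of the semi-discrete problem.\<close>

definition stability_const :: "real \<Rightarrow> real \<Rightarrow> real \<Rightarrow> real" where
  "stability_const \<alpha> \<beta> \<delta> =
     2 * max (sqrt (2 / \<delta>)) (2 / sqrt \<alpha>) * max (sqrt (2 / \<delta>)) (sqrt \<beta>)"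

end

theory Submission
  imports Defs "HOL-Library.Function_Algebras"
begin

text \<open>The error is split with the semi-discrete solution and the \<open>a\<close>-orthogonal projection \<open>P = (1 - C) I\<close>
onto the multiscale space as intermediate points: \<open>ut - u = E + \<theta> - \<rho>\<close> with \<open>E = ut - z\<close>,
\<open>\<theta> = z - P u\<close> and \<open>\<rho> = u - P u\<close>. The projection error \<open>\<rho>\<close> enters the bound as it
stands; the other two take values in the multiscale space and are controlled by energy arguments.

The difference \<open>E\<close> solves the time-stepping scheme, and its right-hand side is the consistency error
\<open>z'' - D\<^sup>2 z\<close> of the second difference quotient \<open>D\<^sup>2\<close>. The scheme is stable
(\<open>leapfrog_energy\<close>): testing with the sum of two consecutive difference quotients makes a
discrete energy telescope, and the CFL condition keeps this energy positive. The CFL condition is stated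
with the inverse inequality of the finite element space; it carries over to the multiscale space because
\<open>1 - C\<close> does not increase the energy and \<open>I\<close> recovers the finite element function stably
(\<open>Vt_inverse\<close>).

The difference \<open>\<theta>\<close> satisfies \<open>(\<theta>'', v) + a(\<theta>, v) = (\<rho>'', v)\<close> for all
multiscale \<open>v\<close>, since \<open>P\<close> is \<open>a\<close>-orthogonal. Formally, multiplying by \<open>\<theta>'\<close> shows that the root of
the energy \<open>\<parallel>\<theta>'\<parallel>\<^sup>2 + a(\<theta>, \<theta>)\<close> grows at most at the rate
\<open>\<parallel>\<rho>''\<parallel>\<close>. But \<open>\<rho>''\<close> is merely integrable in time, and derivatives in time
are only known after testing. The energy is therefore compared at the ends of short time intervals
(\<open>evolution_energy\<close>); the multiscale space has an inverse inequality, so \<open>a(\<theta>,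
\<theta>)\<close> is differentiable, and replacing \<open>\<theta>'\<close> by end point values costs \<open>o(t - s)\<close>.

Three bodies of auxiliary facts make this rigorous. Scalar weak derivatives are turned into integral
identities by smooth test functions that approximate indicators of intervals
(\<open>has_integral_of_weak_deriv\<close>), and these identities give strong derivatives in the
\<open>L\<^sup>2\<close> seminorm (\<open>seminorm_deriv_of_integral\<close>), which commute with the bounded
operator \<open>P\<close>. Weak gradients are unique up to null sets (\<open>fundamental_lemma\<close>), so that
gradients are linear almost everywhere. Smooth functions belong to \<open>H\<^sup>1\<close>, so that functions with
vanishing trace form a subspace. Since functions are not identified when they agree almost everywhere,
all spaces carry semi-inner products only.\<close>

section \<open>Semi-inner products\<close>

text \<open>With the pointwise operations, the function spaces below are subspaces of a real vector space, and
arguments about forms on them need no reference to points.\<close>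

instantiation "fun" :: (type, real_vector) real_vector
begin

definition scaleR_fun_def: "scaleR c f = (\<lambda>x. c *\<^sub>R f x)"

instance
  by standard (simp_all add: scaleR_fun_def fun_eq_iff scaleR_add_right scaleR_add_left)

end

lemma scaleR_fun_apply [simp]: "(c *\<^sub>R f) x = c *\<^sub>R f x"
  by (simp add: scaleR_fun_def)

definition seminorm_of :: "('v \<Rightarrow> 'v \<Rightarrow> real) \<Rightarrow> 'v \<Rightarrow> real" where
  "seminorm_of ip x = sqrt (ip x x)"

text \<open>The same vectors are measured by several forms (the \<open>L\<^sup>2\<close>, Dirichlet and energy products), none of
which separates functions that agree almost everywhere. So the form is a parameter on a carrier \<open>X\<close>, and
only nonnegativity is required.\<close>

locale semi_inner =
  fixes X :: "'v::real_vector set" and ip :: "'v \<Rightarrow> 'v \<Rightarrow> real"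
  assumes subspace: "subspace X"
    and sym: "\<And>x y. x \<in> X \<Longrightarrow> y \<in> X \<Longrightarrow> ip x y = ip y x"
    and add_left: "\<And>x y z. x \<in> X \<Longrightarrow> y \<in> X \<Longrightarrow> z \<in> X \<Longrightarrow> ip (x + y) z = ip x z + ip y z"
    and scale_left: "\<And>c x y. x \<in> X \<Longrightarrow> y \<in> X \<Longrightarrow> ip (c *\<^sub>R x) y = c * ip x y"
    and nonneg: "\<And>x. x \<in> X \<Longrightarrow> 0 \<le> ip x x"
begin

abbreviation nrm :: "'v \<Rightarrow> real" where "nrm \<equiv> seminorm_of ip"

lemma closed [simp]:
  "0 \<in> X" "x \<in> X \<Longrightarrow> y \<in> X \<Longrightarrow> x + y \<in> X" "x \<in> X \<Longrightarrow> c *\<^sub>R x \<in> X"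
  "x \<in> X \<Longrightarrow> y \<in> X \<Longrightarrow> x - y \<in> X" "x \<in> X \<Longrightarrow> - x \<in> X"
  using subspace by (auto intro: subspace_0 subspace_add subspace_scale subspace_diff subspace_neg)

lemma bilinear:
  "x \<in> X \<Longrightarrow> y \<in> X \<Longrightarrow> z \<in> X \<Longrightarrow> ip (x + y) z = ip x z + ip y z"
  "x \<in> X \<Longrightarrow> y \<in> X \<Longrightarrow> z \<in> X \<Longrightarrow> ip z (x + y) = ip z x + ip z y"
  "x \<in> X \<Longrightarrow> y \<in> X \<Longrightarrow> ip (c *\<^sub>R x) y = c * ip x y"
  "x \<in> X \<Longrightarrow> y \<in> X \<Longrightarrow> ip x (c *\<^sub>R y) = c * ip x y"
  "x \<in> X \<Longrightarrow> y \<in> X \<Longrightarrow> z \<in> X \<Longrightarrow> ip (x - y) z = ip x z - ip y z"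
  "x \<in> X \<Longrightarrow> y \<in> X \<Longrightarrow> z \<in> X \<Longrightarrow> ip z (x - y) = ip z x - ip z y"
proof -
  show 1: "x \<in> X \<Longrightarrow> y \<in> X \<Longrightarrow> z \<in> X \<Longrightarrow> ip (x + y) z = ip x z + ip y z" for x y z
    by (rule add_left)
  show 2: "x \<in> X \<Longrightarrow> y \<in> X \<Longrightarrow> z \<in> X \<Longrightarrow> ip z (x + y) = ip z x + ip z y" for x y z
    using 1[of x y z] by (simp add: sym[of z])
  show 3: "x \<in> X \<Longrightarrow> y \<in> X \<Longrightarrow> ip (c *\<^sub>R x) y = c * ip x y" for c x y
    by (rule scale_left)
  show 4: "x \<in> X \<Longrightarrow> y \<in> X \<Longrightarrow> ip x (c *\<^sub>R y) = c * ip x y" for c x y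
    using 3[of y x c] by (simp add: sym[of x])
  show "x \<in> X \<Longrightarrow> y \<in> X \<Longrightarrow> z \<in> X \<Longrightarrow> ip (x - y) z = ip x z - ip y z"
    using 1[of x "(-1) *\<^sub>R y" z] 3[of y z "-1"] by simp
  show "x \<in> X \<Longrightarrow> y \<in> X \<Longrightarrow> z \<in> X \<Longrightarrow> ip z (x - y) = ip z x - ip z y"
    using 2[of x "(-1) *\<^sub>R y" z] 4[of z y "-1"] by simp
qed

lemma ip_zero [simp]: "x \<in> X \<Longrightarrow> ip 0 x = 0" "x \<in> X \<Longrightarrow> ip x 0 = 0"
  using bilinear(3)[of x x 0] bilinear(4)[of x x 0] by simp_all

lemma nrm_nonneg: "x \<in> X \<Longrightarrow> 0 \<le> nrm x"
  by (simp add: seminorm_of_def nonneg)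

lemma nrm_sq: "x \<in> X \<Longrightarrow> (nrm x)\<^sup>2 = ip x x"
  by (simp add: seminorm_of_def nonneg)

text \<open>The quadratic \<open>s \<mapsto> ip (x + s y) (x + s y)\<close> is nonnegative. If \<open>ip y y = 0\<close> it has no minimiser;
it is affine then, so its slope \<open>2 * ip x y\<close> vanishes.\<close>

lemma Cauchy_Schwarz:
  assumes x: "x \<in> X" and y: "y \<in> X"
  shows "\<bar>ip x y\<bar> \<le> nrm x * nrm y"
proof -
  have q: "0 \<le> ip x x + 2 * s * ip x y + s\<^sup>2 * ip y y" for s
    using nonneg[of "x + s *\<^sub>R y"] x y sym[of y x]
    by (simp add: bilinear algebra_simps power2_eq_square)
  have "(ip x y)\<^sup>2 \<le> ip x x * ip y y"
  proof (cases "ip y y = 0")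
    case True
    have "ip x y = 0"
    proof (rule ccontr)
      assume ne: "ip x y \<noteq> 0"
      show False
        using q[of "- (ip x x + 1) / (2 * ip x y)"] ne True by (simp add: field_simps)
    qed
    then show ?thesis by (simp add: True)
  next
    case False
    then have pos: "0 < ip y y" using nonneg[OF y] by simp
    show ?thesis
      using q[of "- ip x y / ip y y"] pos
      by (simp add: field_simps power2_eq_square)
  qed
  also have "\<dots> = (nrm x * nrm y)\<^sup>2"
    by (simp add: power_mult_distrib nrm_sq x y)
  finally have "\<bar>ip x y\<bar> \<le> \<bar>nrm x * nrm y\<bar>"
    by (simp only: abs_le_square_iff)
  also have "\<dots> = nrm x * nrm y"
    using nrm_nonneg[OF x] nrm_nonneg[OF y] by simp
  finally show ?thesis .
qed

lemma nrm_triangle: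
  assumes x: "x \<in> X" and y: "y \<in> X"
  shows "nrm (x + y) \<le> nrm x + nrm y"
proof (rule power2_le_imp_le)
  have "ip (x + y) (x + y) = ip x x + 2 * ip x y + ip y y"
    using x y sym[of y x] by (simp add: bilinear)
  then show "(nrm (x + y))\<^sup>2 \<le> (nrm x + nrm y)\<^sup>2"
    using Cauchy_Schwarz[OF x y] x y by (simp add: power2_sum nrm_sq)
qed (use x y nrm_nonneg in simp)

lemma nrm_scale: "x \<in> X \<Longrightarrow> nrm (c *\<^sub>R x) = \<bar>c\<bar> * nrm x"
  by (simp add: seminorm_of_def bilinear real_sqrt_mult mult.assoc[symmetric])

lemma nrm_minus_commute: "x \<in> X \<Longrightarrow> y \<in> X \<Longrightarrow> nrm (x - y) = nrm (y - x)"
  using nrm_scale[of "y - x" "-1"] by simp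

lemma nrm_triangle_diff: "x \<in> X \<Longrightarrow> y \<in> X \<Longrightarrow> nrm (x - y) \<le> nrm x + nrm y"
  using nrm_triangle[of x "- y"] nrm_scale[of y "-1"] by simp

lemma nrm_reverse_triangle: "x \<in> X \<Longrightarrow> y \<in> X \<Longrightarrow> \<bar>nrm x - nrm y\<bar> \<le> nrm (x - y)"
  using nrm_triangle[of "x - y" y] nrm_triangle[of "y - x" x] nrm_minus_commute[of x y] by simp

end

lemma semi_inner_subset:
  assumes "semi_inner X ip" "subspace Y" "Y \<subseteq> X"
  shows "semi_inner Y ip"
  using assms unfolding semi_inner_def by (meson subsetD)

text \<open>Energies are squares and their increments are bounded by a datum \<open>c\<close> times the sum of two consecutive
roots; dividing by that sum gives an additive bound for the roots. The statement covers a vanishing sum.\<close>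

lemma le_add_of_squares_le:
  fixes p r c :: real
  assumes "p\<^sup>2 - r\<^sup>2 \<le> c * (p + r)" "0 \<le> p" "0 \<le> r" "0 \<le> c"
  shows "p \<le> r + c"
proof (cases "p + r = 0")
  case False
  have "(p - r) * (p + r) \<le> c * (p + r)"
    using assms(1) by (simp add: power2_eq_square algebra_simps)
  then have "p - r \<le> c" using False assms by (simp add: mult_le_cancel_right)
  then show ?thesis by simp
qed (use assms in auto)

section \<open>The leapfrog energy\<close>

text \<open>Testing the \<open>k\<close>-th equation with \<open>w (k + 1) - w (k - 1) = \<tau> (d k + d (k - 1))\<close> makes \<open>q k = m (d k)
(d k) + a (w k) (w (k + 1))\<close> telescope. By polarisation, \<open>q k\<close> equals the mean of two energies plus \<open>m
(d k) (d k)\<close> minus \<open>\<tau>\<^sup>2/2\<close> times \<open>a (d k) (d k)\<close>; the CFL condition leaves at least the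
fraction \<open>\<delta>\<close> of \<open>m (d k) (d k)\<close>. Passing to \<open>sqrt (q k)\<close> lets the data accumulate linearly.\<close>

lemma leapfrog_energy:
  fixes m a :: "'v::real_vector \<Rightarrow> 'v \<Rightarrow> real" and w :: "nat \<Rightarrow> 'v"
  assumes m: "semi_inner X m" and a: "semi_inner X a"
    and \<tau>: "0 < \<tau>" and \<delta>: "0 < \<delta>"
    and cfl: "\<And>v. v \<in> X \<Longrightarrow> \<tau>\<^sup>2 / 2 * a v v \<le> (1 - \<delta>) * m v v"
    and w: "\<And>k. k \<le> Suc n \<Longrightarrow> w k \<in> X"
    and eq: "\<And>k v. 1 \<le> k \<Longrightarrow> k \<le> n \<Longrightarrow> v \<in> X \<Longrightarrow>
      m ((1 / \<tau>\<^sup>2) *\<^sub>R (w (Suc k) - 2 *\<^sub>R w k + w (k - 1))) v + a (w k) v = l k v"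
    and l: "\<And>k v. 1 \<le> k \<Longrightarrow> k \<le> n \<Longrightarrow> v \<in> X \<Longrightarrow> \<bar>l k v\<bar> \<le> G k * seminorm_of m v"
    and G: "\<And>k. 0 \<le> G k"
  defines "d \<equiv> \<lambda>k. (1 / \<tau>) *\<^sub>R (w (Suc k) - w k)"
  defines "S \<equiv> seminorm_of m (d 0) + sqrt ((a (w 0) (w 0) + a (w 1) (w 1)) / 2)
             + \<tau> / sqrt \<delta> * (\<Sum>k=1..n. G k)"
  shows "sqrt \<delta> * seminorm_of m (d n) \<le> S" and "seminorm_of a (w (Suc n)) \<le> sqrt 2 * S"
proof -
  interpret m: semi_inner X m by fact
  interpret a: semi_inner X a by fact
  have dX: "d k \<in> X" if "k \<le> n" for k
    unfolding d_def using that w by simp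
  define q where "q k = m (d k) (d k) + a (w k) (w (Suc k))" for k
  \<comment> \<open>polarisation of \<open>a (w k) (w (Suc k))\<close>\<close>
  have q_eq: "q k = m (d k) (d k) - \<tau>\<^sup>2 / 2 * a (d k) (d k)
      + (a (w k) (w k) + a (w (Suc k)) (w (Suc k))) / 2" if "k \<le> n" for k
    using that \<tau> w[of k] w[of "Suc k"] a.sym[of "w k" "w (Suc k)"]
    by (simp add: q_def d_def a.bilinear) (simp add: field_simps power2_eq_square)
  have q_lower: "\<delta> * m (d k) (d k) + (a (w k) (w k) + a (w (Suc k)) (w (Suc k))) / 2 \<le> q k"
    if "k \<le> n" for k
    using cfl[OF dX[OF that]] q_eq[OF that] by (simp add: algebra_simps)
  have q_ge: "\<delta> * m (d k) (d k) \<le> q k" and q_nonneg: "0 \<le> q k" and d_le: "sqrt \<delta> * seminorm_of m (d k) \<le> sqrt (q k)"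
    if "k \<le> n" for k
  proof -
    have pos: "0 \<le> a (w k) (w k)" "0 \<le> a (w (Suc k)) (w (Suc k))" "0 \<le> m (d k) (d k)"
      using that w dX a.nonneg m.nonneg by auto
    then have "0 \<le> (a (w k) (w k) + a (w (Suc k)) (w (Suc k))) / 2"
      by (intro divide_nonneg_nonneg add_nonneg_nonneg) auto
    then show le: "\<delta> * m (d k) (d k) \<le> q k"
      by (intro order_trans[OF _ q_lower[OF that]]) (simp only: le_add_same_cancel1)
    then show "sqrt \<delta> * seminorm_of m (d k) \<le> sqrt (q k)"
      by (simp only: seminorm_of_def flip: real_sqrt_mult) simp
    have "0 \<le> \<delta> * m (d k) (d k)" using pos \<delta> by simp
    then show "0 \<le> q k" using le by (rule order_trans)
  qed
  have step: "sqrt (q k) \<le> sqrt (q (k - 1)) + \<tau> / sqrt \<delta> * G k" if k: "1 \<le> k" "k \<le> n" for k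
  proof -
    obtain j where j: "k = Suc j" using k by (cases k) auto
    let ?v = "\<tau> *\<^sub>R (d k + d j)"
    have dj: "d j \<in> X" "d k \<in> X" using dX k j by auto
    have wX: "w j \<in> X" "w k \<in> X" "w (Suc k) \<in> X" using w k j by auto
    have v1: "?v = w (Suc k) - w j"
      using \<tau> by (simp add: d_def j scaleR_add_right[symmetric])
    have v2: "(1 / \<tau>\<^sup>2) *\<^sub>R (w (Suc k) - 2 *\<^sub>R w k + w (k - 1)) = (1 / \<tau>) *\<^sub>R (d k - d j)"
      by (simp add: d_def j power2_eq_square scaleR_diff_right scaleR_add_right
          algebra_simps scaleR_2)
    have "m ((1 / \<tau>) *\<^sub>R (d k - d j)) ?v = m (d k) (d k) - m (d j) (d j)"
      using \<tau> dj m.sym[of "d j" "d k"] by (simp add: m.bilinear algebra_simps)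
    moreover have "a (w k) ?v = a (w k) (w (Suc k)) - a (w j) (w k)"
      unfolding v1 using wX a.sym[of "w k" "w j"] by (simp add: a.bilinear)
    ultimately have "q k - q j = l k ?v"
      using eq[OF k, of ?v] dj unfolding v2 by (simp add: q_def j)
    also have "\<dots> \<le> G k * seminorm_of m ?v"
      using l[OF k, of ?v] dj by simp
    also have "\<dots> = \<tau> * G k * seminorm_of m (d k + d j)"
      using dj \<tau> by (simp add: m.nrm_scale)
    also have "\<dots> \<le> \<tau> * G k * (seminorm_of m (d k) + seminorm_of m (d j))"
      using dj \<tau> G by (intro mult_left_mono m.nrm_triangle) auto
    also have "\<dots> \<le> \<tau> * G k * ((sqrt (q k) + sqrt (q j)) / sqrt \<delta>)"
      using d_le[of k] d_le[of j] k j \<tau> G \<delta>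
      by (intro mult_left_mono) (auto simp: field_simps)
    finally have "(sqrt (q k))\<^sup>2 - (sqrt (q j))\<^sup>2 \<le> \<tau> / sqrt \<delta> * G k * (sqrt (q k) + sqrt (q j))"
      using q_nonneg[of k] q_nonneg[of j] k j by simp
    then have "sqrt (q k) \<le> sqrt (q j) + \<tau> / sqrt \<delta> * G k"
      using q_nonneg[of k] q_nonneg[of j] k j \<tau> \<delta> G[of k]
      by (intro le_add_of_squares_le) auto
    then show ?thesis by (simp add: j)
  qed
  have sum: "k \<le> n \<Longrightarrow> sqrt (q k) \<le> sqrt (q 0) + \<tau> / sqrt \<delta> * (\<Sum>i=1..k. G i)" for k
  proof (induction k)
    case (Suc k)
    then show ?case using step[of "Suc k"] by (simp add: algebra_simps)
  qed simp
  have q0: "sqrt (q 0) \<le> seminorm_of m (d 0) + sqrt ((a (w 0) (w 0) + a (w 1) (w 1)) / 2)"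
  proof -
    have pos: "0 \<le> a (d 0) (d 0)" "0 \<le> m (d 0) (d 0)" "0 \<le> a (w 0) (w 0)" "0 \<le> a (w 1) (w 1)"
      using dX w a.nonneg m.nonneg by auto
    have "q 0 \<le> m (d 0) (d 0) + (a (w 0) (w 0) + a (w 1) (w 1)) / 2"
      using q_eq[of 0] pos by simp
    then have "sqrt (q 0) \<le> sqrt (m (d 0) (d 0) + (a (w 0) (w 0) + a (w 1) (w 1)) / 2)"
      by simp
    also have "\<dots> \<le> sqrt (m (d 0) (d 0)) + sqrt ((a (w 0) (w 0) + a (w 1) (w 1)) / 2)"
      using pos by (intro sqrt_add_le_add_sqrt) auto
    finally show ?thesis by (simp add: seminorm_of_def)
  qed
  have S: "sqrt (q n) \<le> S" using sum[of n] q0 by (simp add: S_def)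
  then show "sqrt \<delta> * seminorm_of m (d n) \<le> S" using d_le[of n] by simp
  have "a (w (Suc n)) (w (Suc n)) \<le> 2 * q n"
  proof -
    have "0 \<le> \<delta> * m (d n) (d n) + a (w n) (w n) / 2"
      using dX[of n] w[of n] a.nonneg m.nonneg \<delta> by simp
    then have "a (w (Suc n)) (w (Suc n)) / 2 \<le> q n"
      by (intro order_trans[OF _ q_lower[of n]]) (auto simp only: add_divide_distrib add.assoc[symmetric] le_add_same_cancel2)
    then show ?thesis by simp
  qed
  then have "seminorm_of a (w (Suc n)) \<le> sqrt 2 * sqrt (q n)"
    by (simp add: seminorm_of_def flip: real_sqrt_mult)
  also have "\<dots> \<le> sqrt 2 * S" using S by simp
  finally show "seminorm_of a (w (Suc n)) \<le> sqrt 2 * S" .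
qed

section \<open>Differentiation in time with respect to a seminorm\<close>

text \<open>The vectors carry no topology, so the limits here and in the next definition are limits of real numbers.\<close>

definition seminorm_cont :: "('v \<Rightarrow> real) \<Rightarrow> real set \<Rightarrow> (real \<Rightarrow> 'v::real_vector) \<Rightarrow> bool" where
  "seminorm_cont N S \<theta> \<longleftrightarrow> (\<forall>t\<in>S. ((\<lambda>s. N (\<theta> s - \<theta> t)) \<longlongrightarrow> 0) (at t within S))"

definition seminorm_deriv ::
  "('v \<Rightarrow> real) \<Rightarrow> real set \<Rightarrow> (real \<Rightarrow> 'v::real_vector) \<Rightarrow> (real \<Rightarrow> 'v) \<Rightarrow> bool" where
  "seminorm_deriv N S \<theta> \<theta>' \<longleftrightarrow>
     (\<forall>t\<in>S. ((\<lambda>s. N ((1 / (s - t)) *\<^sub>R (\<theta> s - \<theta> t) - \<theta>' t)) \<longlongrightarrow> 0) (at t within S))"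

lemma eventually_within_mem_ne: "eventually (\<lambda>s. s \<in> S \<and> s \<noteq> t) (at t within S)"
  by (simp add: eventually_at_filter)

lemma null_comparison_within:
  fixes f g :: "real \<Rightarrow> real"
  assumes "(g \<longlongrightarrow> 0) (at t within S)" "\<And>s. s \<in> S \<Longrightarrow> s \<noteq> t \<Longrightarrow> \<bar>f s\<bar> \<le> g s"
  shows "(f \<longlongrightarrow> 0) (at t within S)"
  by (rule Lim_null_comparison[OF eventually_mono[OF eventually_within_mem_ne] assms(1)])
     (use assms(2) in auto)

text \<open>Summing the one-step estimates over equal steps of length below \<open>d\<close> bounds \<open>F t - F 0\<close> by \<open>\<epsilon> *
t\<close>. Since \<open>d\<close> depends on \<open>\<epsilon>\<close> only, this holds for every \<open>\<epsilon>\<close>.\<close>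

lemma nonincreasing_of_small_steps:
  fixes F :: "real \<Rightarrow> real"
  assumes step: "\<And>\<epsilon>. 0 < \<epsilon> \<Longrightarrow> \<exists>d>0. \<forall>s\<in>{0..T}. \<forall>t\<in>{0..T}. s \<le> t \<longrightarrow> t - s < d \<longrightarrow>
      F t \<le> F s + \<epsilon> * (t - s)"
    and t: "t \<in> {0..T}"
  shows "F t \<le> F 0"
proof (rule field_le_epsilon)
  fix e :: real assume e: "0 < e"
  define \<epsilon> where "\<epsilon> = e / (t + 1)"
  have \<epsilon>: "0 < \<epsilon>" using e t by (simp add: \<epsilon>_def)
  obtain d where d: "0 < d" and D: "\<And>s t. s \<in> {0..T} \<Longrightarrow> t \<in> {0..T} \<Longrightarrow> s \<le> t \<Longrightarrow> t - s < d \<Longrightarrow>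
      F t \<le> F s + \<epsilon> * (t - s)"
    using step[OF \<epsilon>] by blast
  obtain k :: nat where k: "t / d < real k" using reals_Archimedean2 by blast
  have k0: "0 < real k" using k d t by (smt (verit) atLeastAtMost_iff divide_nonneg_pos)
  define h where "h = t / real k"
  have h: "0 \<le> h" "h < d" "real k * h = t"
    using t k k0 d by (auto simp: h_def field_simps)
  have "i \<le> k \<Longrightarrow> F (real i * h) \<le> F 0 + \<epsilon> * (real i * h)" for i
  proof (induction i)
    case (Suc i)
    have le: "real (Suc i) * h \<le> t"
      using Suc.prems h by (metis mult_right_mono of_nat_le_iff)
    have eq: "real (Suc i) * h = real i * h + h" by (simp add: algebra_simps)
    have "F (real (Suc i) * h) \<le> F (real i * h) + \<epsilon> * (real (Suc i) * h - real i * h)"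
      by (rule D) (use le eq h t in auto)
    also have "\<dots> \<le> F 0 + \<epsilon> * (real (Suc i) * h)"
      using Suc by (simp add: algebra_simps)
    finally show ?case .
  qed simp
  from this[of k] have "F t \<le> F 0 + \<epsilon> * t" using h by simp
  also have "\<epsilon> * t \<le> e" using t e by (simp add: \<epsilon>_def field_simps)
  finally show "F t \<le> F 0 + e" by simp
qed

context semi_inner
begin

lemma continuous_on_ip:
  assumes "\<And>t. t \<in> S \<Longrightarrow> \<theta> t \<in> X" "seminorm_cont nrm S \<theta>" "w \<in> X"
  shows "continuous_on S (\<lambda>t. ip (\<theta> t) w)"
  unfolding continuous_on_def
proof
  fix t assume t: "t \<in> S"
  have "((\<lambda>s. nrm (\<theta> s - \<theta> t) * nrm w) \<longlongrightarrow> 0 * nrm w) (at t within S)"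
    using assms t by (intro tendsto_intros) (auto simp: seminorm_cont_def)
  then have "((\<lambda>s. nrm (\<theta> s - \<theta> t) * nrm w) \<longlongrightarrow> 0) (at t within S)" by simp
  then have "((\<lambda>s. ip (\<theta> s) w - ip (\<theta> t) w) \<longlongrightarrow> 0) (at t within S)"
    by (rule null_comparison_within)
       (use Cauchy_Schwarz assms t in \<open>simp flip: bilinear(5)\<close>)
  then show "((\<lambda>s. ip (\<theta> s) w) \<longlongrightarrow> ip (\<theta> t) w) (at t within S)"
    by (simp add: LIM_zero_iff)
qed

lemma continuous_on_nrm:
  assumes "\<And>t. t \<in> S \<Longrightarrow> \<theta> t \<in> X" "seminorm_cont nrm S \<theta>"
  shows "continuous_on S (\<lambda>t. nrm (\<theta> t))"
  unfolding continuous_on_def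
proof
  fix t assume t: "t \<in> S"
  have "((\<lambda>s. nrm (\<theta> s - \<theta> t)) \<longlongrightarrow> 0) (at t within S)"
    using assms t by (auto simp: seminorm_cont_def)
  then have "((\<lambda>s. nrm (\<theta> s) - nrm (\<theta> t)) \<longlongrightarrow> 0) (at t within S)"
    by (rule null_comparison_within) (use nrm_reverse_triangle assms t in auto)
  then show "((\<lambda>s. nrm (\<theta> s)) \<longlongrightarrow> nrm (\<theta> t)) (at t within S)"
    by (simp add: LIM_zero_iff)
qed

text \<open>The seminorm need not come from a metric on the type of its arguments, so the theorem of Heine and
Cantor is applied to the real function \<open>(s, t) \<mapsto> nrm (\<theta> s - \<theta> t)\<close>, which vanishes
on the diagonal.\<close>

lemma seminorm_cont_uniform:
  assumes S: "compact S" and X: "\<And>t. t \<in> S \<Longrightarrow> \<theta> t \<in> X" and c: "seminorm_cont nrm S \<theta>"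
    and e: "0 < e"
  shows "\<exists>d>0. \<forall>s\<in>S. \<forall>t\<in>S. \<bar>s - t\<bar> < d \<longrightarrow> nrm (\<theta> s - \<theta> t) < e"
proof -
  define D where "D p = nrm (\<theta> (fst p) - \<theta> (snd p))" for p
  have "continuous_on (S \<times> S) D"
    unfolding continuous_on_iff
  proof (intro ballI allI impI)
    fix p r assume p: "p \<in> S \<times> S" and r: "(0::real) < r"
    have lim: "\<exists>d>0. \<forall>s\<in>S. dist s t < d \<longrightarrow> nrm (\<theta> s - \<theta> t) < r / 2" if t: "t \<in> S" for t
    proof -
      have "eventually (\<lambda>s. dist (nrm (\<theta> s - \<theta> t)) 0 < r / 2) (at t within S)"
        using c t half_gt_zero[OF r] unfolding seminorm_cont_def tendsto_iff by blast
      then obtain d where d: "d > 0"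
        "\<And>s. s \<in> S \<Longrightarrow> s \<noteq> t \<Longrightarrow> dist s t < d \<Longrightarrow> dist (nrm (\<theta> s - \<theta> t)) 0 < r / 2"
        by (auto simp: eventually_at)
      have z: "nrm (\<theta> t - \<theta> t) = 0" by (simp add: seminorm_of_def)
      show ?thesis
      proof (intro exI[of _ d] conjI ballI impI)
        fix s assume "s \<in> S" "dist s t < d"
        then show "nrm (\<theta> s - \<theta> t) < r / 2"
          using d(2)[of s] z r X t by (cases "s = t") (auto simp: dist_real_def)
      qed (fact d(1))
    qed
    obtain d1 where d1: "d1 > 0" "\<And>s. s \<in> S \<Longrightarrow> dist s (fst p) < d1 \<Longrightarrow> nrm (\<theta> s - \<theta> (fst p)) < r / 2"
      using lim[of "fst p"] p by auto
    obtain d2 where d2: "d2 > 0" "\<And>s. s \<in> S \<Longrightarrow> dist s (snd p) < d2 \<Longrightarrow> nrm (\<theta> s - \<theta> (snd p)) < r / 2"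
      using lim[of "snd p"] p by auto
    show "\<exists>d>0. \<forall>q\<in>S \<times> S. dist q p < d \<longrightarrow> dist (D q) (D p) < r"
    proof (intro exI[of _ "min d1 d2"] conjI ballI impI)
      fix q assume q: "q \<in> S \<times> S" and qp: "dist q p < min d1 d2"
      have mem: "\<theta> (fst p) \<in> X" "\<theta> (snd p) \<in> X" "\<theta> (fst q) \<in> X" "\<theta> (snd q) \<in> X"
        using p q X by auto
      have "\<bar>D q - D p\<bar> \<le> nrm ((\<theta> (fst q) - \<theta> (snd q)) - (\<theta> (fst p) - \<theta> (snd p)))"
        unfolding D_def using mem by (intro nrm_reverse_triangle) auto
      also have "(\<theta> (fst q) - \<theta> (snd q)) - (\<theta> (fst p) - \<theta> (snd p))
          = (\<theta> (fst q) - \<theta> (fst p)) - (\<theta> (snd q) - \<theta> (snd p))" by simp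
      also have "nrm \<dots> \<le> nrm (\<theta> (fst q) - \<theta> (fst p)) + nrm (\<theta> (snd q) - \<theta> (snd p))"
        using mem by (intro nrm_triangle_diff) auto
      also have "\<dots> < r"
        using d1(2)[of "fst q"] d2(2)[of "snd q"] q qp
          order_le_less_trans[OF dist_fst_le[of q p]] order_le_less_trans[OF dist_snd_le[of q p]]
        by fastforce
      finally show "dist (D q) (D p) < r" by (simp add: dist_real_def)
    qed (use d1 d2 in auto)
  qed
  then have "uniformly_continuous_on (S \<times> S) D"
    using S by (intro compact_uniformly_continuous compact_Times)
  then obtain d where d: "d > 0"
    "\<And>p q. p \<in> S \<times> S \<Longrightarrow> q \<in> S \<times> S \<Longrightarrow> dist q p < d \<Longrightarrow> dist (D q) (D p) < e"
    unfolding uniformly_continuous_on_def using e by blast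
  show ?thesis
  proof (intro exI[of _ d] conjI ballI impI)
    fix s t assume st: "s \<in> S" "t \<in> S" "\<bar>s - t\<bar> < d"
    have "dist (s, t) (t, t) < d" using st by (simp add: dist_Pair_Pair dist_real_def)
    from d(2)[OF _ _ this] st have "dist (D (s, t)) (D (t, t)) < e" by auto
    then show "nrm (\<theta> s - \<theta> t) < e"
      using X st nrm_nonneg[of "\<theta> s - \<theta> t"] by (simp add: D_def dist_real_def seminorm_of_def)
  qed (fact d(1))
qed

lemma nrm_increment_le:
  assumes st: "s \<le> t" and e: "0 \<le> e" and D: "D \<in> X"
    and int: "(f has_integral ip D D) {s..t}"
    and bound: "\<And>r. r \<in> {s..t} \<Longrightarrow> f r \<le> e * nrm D"
  shows "nrm D \<le> e * (t - s)"
proof -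
  have "ip D D \<le> e * nrm D * (t - s)"
    by (rule has_integral_le[OF int])
       (use has_integral_const_real[of "e * nrm D" s t] st bound in \<open>auto simp: mult.commute\<close>)
  then have sq: "nrm D * nrm D \<le> nrm D * (e * (t - s))"
    using nrm_sq[OF D] by (simp add: power2_eq_square mult_ac)
  show ?thesis
  proof (cases "nrm D = 0")
    case True
    have "0 \<le> e * (t - s)" using e st by simp
    then show ?thesis using True by simp
  next
    case False
    then show ?thesis using sq nrm_nonneg[OF D] by (simp add: mult_le_cancel_left)
  qed
qed

text \<open>Let \<open>D\<close> be the error of the first-order expansion at \<open>t\<close>. Tested with \<open>D\<close> itself, the integral identity
reads \<open>ip D D = \<integral> ip (\<theta>' r - \<theta>' t) D\<close>, so that \<open>nrm D\<close> is at most the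
oscillation of \<open>\<theta>'\<close> times the length of the interval. Only scalar functions are integrated.\<close>

lemma seminorm_deriv_of_integral:
  assumes X: "\<And>t. t \<in> {0..T} \<Longrightarrow> \<theta> t \<in> X" "\<And>t. t \<in> {0..T} \<Longrightarrow> \<theta>' t \<in> X"
    and cont: "seminorm_cont nrm {0..T} \<theta>'"
    and int: "\<And>s t w. 0 \<le> s \<Longrightarrow> s \<le> t \<Longrightarrow> t \<le> T \<Longrightarrow> w \<in> X \<Longrightarrow>
      ((\<lambda>r. ip (\<theta>' r) w) has_integral ip (\<theta> t - \<theta> s) w) {s..t}"
  shows "seminorm_deriv nrm {0..T} \<theta> \<theta>'"
  unfolding seminorm_deriv_def
proof
  fix t assume t: "t \<in> {0..T}"
  \<comment> \<open>\<open>t\<close> is one of the end points \<open>p\<close>, \<open>q\<close>; both orders occur below\<close>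
  have incr: "nrm ((\<theta> q - \<theta> p) - (q - p) *\<^sub>R \<theta>' t) \<le> e * (q - p)"
    if pq: "0 \<le> p" "p \<le> q" "q \<le> T" and e: "0 < e" and
      close: "\<And>r. r \<in> {p..q} \<Longrightarrow> nrm (\<theta>' r - \<theta>' t) \<le> e" for p q e
  proof -
    define D where "D = (\<theta> q - \<theta> p) - (q - p) *\<^sub>R \<theta>' t"
    have mem: "\<theta> q \<in> X" "\<theta> p \<in> X" "\<theta>' t \<in> X" using X t pq by auto
    then have D: "D \<in> X" by (simp add: D_def)
    have "((\<lambda>r. ip (\<theta>' r) D - ip (\<theta>' t) D) has_integral
        (ip (\<theta> q - \<theta> p) D - (q - p) * ip (\<theta>' t) D)) {p..q}"
      using int[OF pq D] has_integral_const_real[of "ip (\<theta>' t) D" p q] pq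
      by (intro has_integral_diff) auto
    also have "ip (\<theta> q - \<theta> p) D - (q - p) * ip (\<theta>' t) D = ip ((\<theta> q - \<theta> p) - (q - p) *\<^sub>R \<theta>' t) D"
      using mem D by (simp add: bilinear)
    also have "\<dots> = ip D D" by (simp add: D_def)
    finally have hi: "((\<lambda>r. ip (\<theta>' r) D - ip (\<theta>' t) D) has_integral ip D D) {p..q}" .
    have "nrm D \<le> e * (q - p)"
    proof (rule nrm_increment_le[OF pq(2) _ D hi])
      fix r assume r: "r \<in> {p..q}"
      then have r': "\<theta>' r \<in> X" using X pq by auto
      have "ip (\<theta>' r) D - ip (\<theta>' t) D = ip (\<theta>' r - \<theta>' t) D"
        using r' mem D by (simp add: bilinear)
      also have "\<dots> \<le> nrm (\<theta>' r - \<theta>' t) * nrm D"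
        using Cauchy_Schwarz[of "\<theta>' r - \<theta>' t" D] r' mem D by simp
      also have "\<dots> \<le> e * nrm D"
        using close[OF r] nrm_nonneg[OF D] by (intro mult_right_mono)
      finally show "ip (\<theta>' r) D - ip (\<theta>' t) D \<le> e * nrm D" .
    qed (use e in simp)
    then show ?thesis by (simp add: D_def)
  qed
  show "((\<lambda>s. nrm ((1 / (s - t)) *\<^sub>R (\<theta> s - \<theta> t) - \<theta>' t)) \<longlongrightarrow> 0) (at t within {0..T})"
  proof (rule tendstoI)
    fix e :: real assume e: "0 < e"
    define \<epsilon> where "\<epsilon> = e / 2"
    have \<epsilon>: "0 < \<epsilon>" using e by (simp add: \<epsilon>_def)
    obtain d where d: "d > 0" "\<And>s. s \<in> {0..T} \<Longrightarrow> \<bar>s - t\<bar> < d \<Longrightarrow> nrm (\<theta>' s - \<theta>' t) < \<epsilon>"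
      using seminorm_cont_uniform[OF compact_Icc X(2) cont \<epsilon>] t by blast
    show "eventually (\<lambda>s. dist (nrm ((1 / (s - t)) *\<^sub>R (\<theta> s - \<theta> t) - \<theta>' t)) 0 < e) (at t within {0..T})"
      unfolding eventually_at
    proof (intro exI[of _ d] conjI ballI impI)
      fix s assume s: "s \<in> {0..T}" and st: "s \<noteq> t \<and> dist s t < d"
      have mem: "\<theta> s \<in> X" "\<theta> t \<in> X" "\<theta>' t \<in> X" using X t s by auto
      have "nrm ((\<theta> s - \<theta> t) - (s - t) *\<^sub>R \<theta>' t) \<le> \<epsilon> * \<bar>s - t\<bar>"
      proof (cases "t \<le> s")
        case True
        have "nrm (\<theta>' r - \<theta>' t) \<le> \<epsilon>" if "r \<in> {t..s}" for r
          using d(2)[of r] that s t st by (auto simp: dist_real_def)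
        with True show ?thesis
          using incr[of t s \<epsilon>] s t \<epsilon> by simp
      next
        case False
        have "(\<theta> s - \<theta> t) - (s - t) *\<^sub>R \<theta>' t = - ((\<theta> t - \<theta> s) - (t - s) *\<^sub>R \<theta>' t)"
          by (simp add: algebra_simps)
        then have "nrm ((\<theta> s - \<theta> t) - (s - t) *\<^sub>R \<theta>' t) = nrm ((\<theta> t - \<theta> s) - (t - s) *\<^sub>R \<theta>' t)"
          using nrm_minus_commute[of 0 "(\<theta> t - \<theta> s) - (t - s) *\<^sub>R \<theta>' t"] mem
          by (simp only: diff_0_right diff_0 closed)
        moreover have "nrm (\<theta>' r - \<theta>' t) \<le> \<epsilon>" if "r \<in> {s..t}" for r
          using d(2)[of r] that s t st by (auto simp: dist_real_def)
        ultimately show ?thesis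
          using incr[of s t \<epsilon>] s t \<epsilon> False by simp
      qed
      moreover have "(1 / (s - t)) *\<^sub>R (\<theta> s - \<theta> t) - \<theta>' t
          = (1 / (s - t)) *\<^sub>R ((\<theta> s - \<theta> t) - (s - t) *\<^sub>R \<theta>' t)"
        using st by (simp add: scaleR_diff_right)
      ultimately have "nrm ((1 / (s - t)) *\<^sub>R (\<theta> s - \<theta> t) - \<theta>' t)
          = nrm ((\<theta> s - \<theta> t) - (s - t) *\<^sub>R \<theta>' t) / \<bar>s - t\<bar>"
        using mem by (simp only: nrm_scale closed) (simp add: abs_divide)
      also have "\<dots> \<le> \<epsilon>"
        using st \<open>nrm ((\<theta> s - \<theta> t) - (s - t) *\<^sub>R \<theta>' t) \<le> \<epsilon> * \<bar>s - t\<bar>\<close>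
        by (simp add: pos_divide_le_eq)
      finally have "nrm ((1 / (s - t)) *\<^sub>R (\<theta> s - \<theta> t) - \<theta>' t) \<le> \<epsilon>" .
      then show "dist (nrm ((1 / (s - t)) *\<^sub>R (\<theta> s - \<theta> t) - \<theta>' t)) 0 < e"
        using \<epsilon> mem nrm_nonneg[of "(1 / (s - t)) *\<^sub>R (\<theta> s - \<theta> t) - \<theta>' t"]
        by (simp add: dist_real_def \<epsilon>_def)
    qed (fact d(1))
  qed
qed

lemma seminorm_deriv_imp_cont:
  assumes X: "\<And>t. t \<in> S \<Longrightarrow> \<theta> t \<in> X" "\<And>t. t \<in> S \<Longrightarrow> \<theta>' t \<in> X"
    and der: "seminorm_deriv nrm S \<theta> \<theta>'"
  shows "seminorm_cont nrm S \<theta>"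
  unfolding seminorm_cont_def
proof
  fix t assume t: "t \<in> S"
  let ?q = "\<lambda>s. (1 / (s - t)) *\<^sub>R (\<theta> s - \<theta> t)"
  have "((\<lambda>s. \<bar>s - t\<bar> * (nrm (?q s - \<theta>' t) + nrm (\<theta>' t))) \<longlongrightarrow> \<bar>t - t\<bar> * (0 + nrm (\<theta>' t))) (at t within S)"
    using der t by (intro tendsto_intros) (auto simp: seminorm_deriv_def)
  then have lim: "((\<lambda>s. \<bar>s - t\<bar> * (nrm (?q s - \<theta>' t) + nrm (\<theta>' t))) \<longlongrightarrow> 0) (at t within S)" by simp
  show "((\<lambda>s. nrm (\<theta> s - \<theta> t)) \<longlongrightarrow> 0) (at t within S)"
  proof (rule null_comparison_within[OF lim])
    fix s assume s: "s \<in> S" "s \<noteq> t"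
    have mem: "\<theta> s \<in> X" "\<theta> t \<in> X" "\<theta>' t \<in> X" using X t s by auto
    have "nrm (\<theta> s - \<theta> t) = nrm ((s - t) *\<^sub>R ?q s)" using s by simp
    also have "\<dots> = \<bar>s - t\<bar> * nrm ((?q s - \<theta>' t) + \<theta>' t)"
      using mem by (subst nrm_scale) auto
    also have "\<dots> \<le> \<bar>s - t\<bar> * (nrm (?q s - \<theta>' t) + nrm (\<theta>' t))"
      using mem by (intro mult_left_mono nrm_triangle) auto
    finally show "\<bar>nrm (\<theta> s - \<theta> t)\<bar> \<le> \<bar>s - t\<bar> * (nrm (?q s - \<theta>' t) + nrm (\<theta>' t))"
      using mem nrm_nonneg[of "\<theta> s - \<theta> t"] by simp
  qed
qed

lemma has_derivative_ip:
  assumes X: "\<And>t. t \<in> S \<Longrightarrow> \<theta> t \<in> X" "\<And>t. t \<in> S \<Longrightarrow> \<theta>' t \<in> X"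
    and der: "seminorm_deriv nrm S \<theta> \<theta>'" and t: "t \<in> S" and w: "w \<in> X"
  shows "((\<lambda>s. ip (\<theta> s) w) has_real_derivative ip (\<theta>' t) w) (at t within S)"
  unfolding has_field_derivative_iff
proof -
  let ?q = "\<lambda>s. (1 / (s - t)) *\<^sub>R (\<theta> s - \<theta> t)"
  have "((\<lambda>s. nrm (?q s - \<theta>' t) * nrm w) \<longlongrightarrow> 0 * nrm w) (at t within S)"
    using der t by (intro tendsto_intros) (auto simp: seminorm_deriv_def)
  then have lim: "((\<lambda>s. nrm (?q s - \<theta>' t) * nrm w) \<longlongrightarrow> 0) (at t within S)" by simp
  have "((\<lambda>s. (ip (\<theta> s) w - ip (\<theta> t) w) / (s - t) - ip (\<theta>' t) w) \<longlongrightarrow> 0) (at t within S)"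
  proof (rule null_comparison_within[OF lim])
    fix s assume s: "s \<in> S" "s \<noteq> t"
    have mem: "\<theta> s \<in> X" "\<theta> t \<in> X" "\<theta>' t \<in> X" using X t s by auto
    have "(ip (\<theta> s) w - ip (\<theta> t) w) / (s - t) - ip (\<theta>' t) w = ip (?q s - \<theta>' t) w"
      using mem w by (simp add: bilinear)
    then show "\<bar>(ip (\<theta> s) w - ip (\<theta> t) w) / (s - t) - ip (\<theta>' t) w\<bar> \<le> nrm (?q s - \<theta>' t) * nrm w"
      using Cauchy_Schwarz[of "?q s - \<theta>' t" w] mem w by simp
  qed
  then show "((\<lambda>s. (ip (\<theta> s) w - ip (\<theta> t) w) / (s - t)) \<longlongrightarrow> ip (\<theta>' t) w) (at t within S)"
    by (simp add: LIM_zero_iff)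
qed

text \<open>The increment of \<open>ip \<theta> \<theta>\<close> is \<open>ip (\<theta> s - \<theta> t) (\<theta> s + \<theta> t)\<close>, a
bilinear form in the difference quotient and a sum that tends to \<open>2 * \<theta> t\<close>.\<close>

lemma has_derivative_ip_self:
  assumes X: "\<And>t. t \<in> S \<Longrightarrow> \<theta> t \<in> X" "\<And>t. t \<in> S \<Longrightarrow> \<theta>' t \<in> X"
    and der: "seminorm_deriv nrm S \<theta> \<theta>'" and t: "t \<in> S"
  shows "((\<lambda>s. ip (\<theta> s) (\<theta> s)) has_real_derivative 2 * ip (\<theta> t) (\<theta>' t)) (at t within S)"
  unfolding has_field_derivative_iff
proof -
  let ?q = "\<lambda>s. (1 / (s - t)) *\<^sub>R (\<theta> s - \<theta> t)"
  let ?g = "\<lambda>s. nrm (?q s - \<theta>' t) * (nrm (\<theta> s - \<theta> t) + 2 * nrm (\<theta> t)) + nrm (\<theta>' t) * nrm (\<theta> s - \<theta> t)"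
  have "(?g \<longlongrightarrow> 0 * (0 + 2 * nrm (\<theta> t)) + nrm (\<theta>' t) * 0) (at t within S)"
    using der t seminorm_deriv_imp_cont[OF X der]
    by (intro tendsto_intros) (auto simp: seminorm_deriv_def seminorm_cont_def)
  then have lim: "(?g \<longlongrightarrow> 0) (at t within S)" by simp
  have "((\<lambda>s. (ip (\<theta> s) (\<theta> s) - ip (\<theta> t) (\<theta> t)) / (s - t) - 2 * ip (\<theta> t) (\<theta>' t)) \<longlongrightarrow> 0) (at t within S)"
  proof (rule null_comparison_within[OF lim])
    fix s assume s: "s \<in> S" "s \<noteq> t"
    have mem: "\<theta> s \<in> X" "\<theta> t \<in> X" "\<theta>' t \<in> X" using X t s by auto
    have "ip (?q s - \<theta>' t) ((\<theta> s - \<theta> t) + 2 *\<^sub>R \<theta> t) + ip (\<theta>' t) (\<theta> s - \<theta> t)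
        = (ip (\<theta> s) (\<theta> s) - ip (\<theta> t) (\<theta> t)) / (s - t) - 2 * ip (\<theta> t) (\<theta>' t)"
      using mem sym[of "\<theta> s" "\<theta> t"] sym[of "\<theta>' t" "\<theta> t"]
      by (simp add: bilinear divide_inverse ring_distribs)
    moreover have "\<bar>ip (?q s - \<theta>' t) ((\<theta> s - \<theta> t) + 2 *\<^sub>R \<theta> t)\<bar>
        \<le> nrm (?q s - \<theta>' t) * nrm ((\<theta> s - \<theta> t) + 2 *\<^sub>R \<theta> t)"
      using mem by (intro Cauchy_Schwarz) auto
    moreover have "\<dots> \<le> nrm (?q s - \<theta>' t) * (nrm (\<theta> s - \<theta> t) + 2 * nrm (\<theta> t))"
      using mem nrm_triangle[of "\<theta> s - \<theta> t" "2 *\<^sub>R \<theta> t"]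
      by (intro mult_left_mono nrm_nonneg) (auto simp: nrm_scale)
    moreover have "\<bar>ip (\<theta>' t) (\<theta> s - \<theta> t)\<bar> \<le> nrm (\<theta>' t) * nrm (\<theta> s - \<theta> t)"
      using mem by (intro Cauchy_Schwarz) auto
    ultimately show "\<bar>(ip (\<theta> s) (\<theta> s) - ip (\<theta> t) (\<theta> t)) / (s - t) - 2 * ip (\<theta> t) (\<theta>' t)\<bar> \<le> ?g s"
      by linarith
  qed
  then show "((\<lambda>s. (ip (\<theta> s) (\<theta> s) - ip (\<theta> t) (\<theta> t)) / (s - t)) \<longlongrightarrow> 2 * ip (\<theta> t) (\<theta>' t)) (at t within S)"
    by (simp add: LIM_zero_iff)
qed

end

lemma seminorm_deriv_dominated:
  assumes "seminorm_deriv N S \<theta> \<theta>'" "subspace X"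
    and X: "\<And>t. t \<in> S \<Longrightarrow> \<theta> t \<in> X" "\<And>t. t \<in> S \<Longrightarrow> \<theta>' t \<in> X"
    and dom: "\<And>v. v \<in> X \<Longrightarrow> \<bar>N' v\<bar> \<le> K * N v"
  shows "seminorm_deriv N' S \<theta> \<theta>'"
  unfolding seminorm_deriv_def
proof
  fix t assume t: "t \<in> S"
  let ?q = "\<lambda>s. (1 / (s - t)) *\<^sub>R (\<theta> s - \<theta> t) - \<theta>' t"
  have "((\<lambda>s. K * N (?q s)) \<longlongrightarrow> K * 0) (at t within S)"
    using assms(1) t by (intro tendsto_intros) (auto simp: seminorm_deriv_def)
  then have lim: "((\<lambda>s. K * N (?q s)) \<longlongrightarrow> 0) (at t within S)" by simp
  show "((\<lambda>s. N' (?q s)) \<longlongrightarrow> 0) (at t within S)"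
    by (rule null_comparison_within[OF lim])
       (intro dom subspace_diff[OF assms(2)] subspace_scale[OF assms(2)] X t)
qed

section \<open>The energy of a second-order evolution\<close>

text \<open>Formally the energy \<open>e2 = m \<theta>' \<theta>' + a \<theta> \<theta>\<close> has the derivative \<open>2 * l
\<theta>'\<close>, at most \<open>2 * G * sqrt e2\<close>. As \<open>\<theta>'\<close> is known only through its increments tested with
fixed vectors, the equation on \<open>{s..t}\<close> is tested with \<open>w = \<theta>' t + \<theta>' s\<close>: this gives
exactly the increment of \<open>m \<theta>' \<theta>'\<close>. The form \<open>a\<close> is dominated by \<open>m\<close>, so \<open>a \<theta>
\<theta>\<close> is differentiable and its increment is an integral of \<open>2 * a \<theta> \<theta>'\<close>. The two
\<open>a\<close>-terms cancel up to \<open>a \<theta> (2 * \<theta>' r - w)\<close>, which is small by uniform continuity of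
\<open>\<theta>'\<close>.\<close>

theorem evolution_energy:
  fixes m a :: "'v::real_vector \<Rightarrow> 'v \<Rightarrow> real" and \<theta> \<theta>' :: "real \<Rightarrow> 'v"
  assumes m: "semi_inner X m" and a: "semi_inner X a"
    and dom: "\<And>v. v \<in> X \<Longrightarrow> a v v \<le> K * m v v" and K: "0 \<le> K"
    and X: "\<And>t. t \<in> {0..T} \<Longrightarrow> \<theta> t \<in> X" "\<And>t. t \<in> {0..T} \<Longrightarrow> \<theta>' t \<in> X"
    and der: "seminorm_deriv (seminorm_of m) {0..T} \<theta> \<theta>'"
    and cont: "seminorm_cont (seminorm_of m) {0..T} \<theta>'"
    and weak: "\<And>s t v. 0 \<le> s \<Longrightarrow> s \<le> t \<Longrightarrow> t \<le> T \<Longrightarrow> v \<in> X \<Longrightarrow>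
      ((\<lambda>r. l r v - a (\<theta> r) v) has_integral m (\<theta>' t - \<theta>' s) v) {s..t}"
    and l: "\<And>r v. r \<in> {0..T} \<Longrightarrow> v \<in> X \<Longrightarrow> l r v \<le> G r * seminorm_of m v"
    and G: "G integrable_on {0..T}" "\<And>r. r \<in> {0..T} \<Longrightarrow> 0 \<le> G r"
    and t: "t \<in> {0..T}"
  shows "sqrt (m (\<theta>' t) (\<theta>' t) + a (\<theta> t) (\<theta> t))
    \<le> sqrt (m (\<theta>' 0) (\<theta>' 0) + a (\<theta> 0) (\<theta> 0)) + integral {0..t} G"
proof -
  interpret m: semi_inner X m by fact
  interpret a: semi_inner X a by fact
  have a_le: "seminorm_of a v \<le> sqrt K * seminorm_of m v" if "v \<in> X" for v
    using dom[OF that] by (simp add: seminorm_of_def flip: real_sqrt_mult)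
  have der_a: "seminorm_deriv (seminorm_of a) {0..T} \<theta> \<theta>'"
    by (rule seminorm_deriv_dominated[OF der m.subspace X, where K = "sqrt K"])
       (use a_le a.nrm_nonneg in auto)
  define e2 where "e2 t = m (\<theta>' t) (\<theta>' t) + a (\<theta> t) (\<theta> t)" for t
  define R where "R t = integral {0..t} G" for t
  have e2_nonneg: "0 \<le> e2 t" if "t \<in> {0..T}" for t
    using X[OF that] m.nonneg a.nonneg by (simp add: e2_def)
  have R_incr: "(G has_integral R t - R s) {s..t}" and R_mono: "R s \<le> R t"
    if "0 \<le> s" "s \<le> t" "t \<le> T" for s t
  proof -
    have int: "G integrable_on {0..t}" "G integrable_on {s..t}"
      using that by (auto intro: integrable_on_subinterval[OF G(1)])
    have "integral {0..s} G + integral {s..t} G = integral {0..t} G"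
      using that int by (intro Henstock_Kurzweil_Integration.integral_combine) auto
    then have eq: "R t - R s = integral {s..t} G" by (simp add: R_def)
    then show "(G has_integral R t - R s) {s..t}"
      using int by (simp add: integrable_integral)
    have "0 \<le> integral {s..t} G"
      using int G(2) that by (intro integral_nonneg) auto
    then show "R s \<le> R t" using eq by simp
  qed
  have "compact ((\<lambda>t. seminorm_of a (\<theta> t)) ` {0..T})"
    by (intro compact_continuous_image a.continuous_on_nrm[OF X(1)] compact_Icc
        a.seminorm_deriv_imp_cont[OF X der_a])
  then obtain M where "0 < M" "\<forall>x\<in>(\<lambda>t. seminorm_of a (\<theta> t)) ` {0..T}. norm x \<le> M"
    using compact_imp_bounded bounded_pos by blast
  then have M: "\<And>t. t \<in> {0..T} \<Longrightarrow> seminorm_of a (\<theta> t) \<le> M" "0 < M"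
    by (force dest: abs_le_D1)+
  have step: "\<exists>d>0. \<forall>s\<in>{0..T}. \<forall>t\<in>{0..T}. s \<le> t \<longrightarrow> t - s < d \<longrightarrow>
      e2 t - e2 s \<le> (R t - R s) * (sqrt (e2 t) + sqrt (e2 s)) + \<epsilon> * (t - s)" if \<epsilon>: "0 < \<epsilon>" for \<epsilon>
  proof -
    \<comment> \<open>chosen such that the replacement of \<open>2 * \<theta>' r\<close> by \<open>w\<close> costs at most \<open>\<epsilon>\<close> per unit of time\<close>
    define \<mu> where "\<mu> = \<epsilon> / (2 * M * (sqrt K + 1))"
    have K1: "0 < sqrt K + 1" using K by (simp add: add_nonneg_pos)
    have \<mu>: "0 < \<mu>" using \<epsilon> M K1 by (simp add: \<mu>_def)
    have "M * (sqrt K * (2 * \<mu>)) \<le> M * ((sqrt K + 1) * (2 * \<mu>))"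
      using M \<mu> by (intro mult_left_mono mult_right_mono) auto
    also have "\<dots> = \<epsilon>" using M K1 by (simp add: \<mu>_def)
    finally have \<mu>\<epsilon>: "M * (sqrt K * (2 * \<mu>)) \<le> \<epsilon>" .
    obtain d where d: "d > 0" "\<And>s t. s \<in> {0..T} \<Longrightarrow> t \<in> {0..T} \<Longrightarrow> \<bar>s - t\<bar> < d \<Longrightarrow>
        seminorm_of m (\<theta>' s - \<theta>' t) < \<mu>"
      using m.seminorm_cont_uniform[OF compact_Icc X(2) cont \<mu>] by blast
    show ?thesis
    proof (intro exI[of _ d] conjI ballI impI)
      fix s t assume st: "s \<in> {0..T}" "t \<in> {0..T}" "s \<le> t" "t - s < d"
      define w where "w = \<theta>' t + \<theta>' s"
      have mem: "\<theta>' t \<in> X" "\<theta>' s \<in> X" "\<theta> t \<in> X" "\<theta> s \<in> X" "w \<in> X"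
        using X st by (auto simp: w_def)
      have "((\<lambda>r. 2 * a (\<theta> r) (\<theta>' r)) has_integral a (\<theta> t) (\<theta> t) - a (\<theta> s) (\<theta> s)) {s..t}"
      proof (rule fundamental_theorem_of_calculus[OF st(3)])
        fix r assume r: "r \<in> {s..t}"
        have "((\<lambda>s. a (\<theta> s) (\<theta> s)) has_real_derivative 2 * a (\<theta> r) (\<theta>' r)) (at r within {0..T})"
          by (rule a.has_derivative_ip_self[OF X der_a]) (use r st in auto)
        then show "((\<lambda>s. a (\<theta> s) (\<theta> s)) has_vector_derivative 2 * a (\<theta> r) (\<theta>' r)) (at r within {s..t})"
          using st by (auto simp: has_real_derivative_iff_has_vector_derivative
              intro: has_vector_derivative_within_subset)
      qed
      from has_integral_add[OF weak[OF _ st(3) _ mem(5)] this] st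
      have "((\<lambda>r. l r w - a (\<theta> r) w + 2 * a (\<theta> r) (\<theta>' r)) has_integral
          m (\<theta>' t - \<theta>' s) w + (a (\<theta> t) (\<theta> t) - a (\<theta> s) (\<theta> s))) {s..t}"
        by auto
      also have "m (\<theta>' t - \<theta>' s) w + (a (\<theta> t) (\<theta> t) - a (\<theta> s) (\<theta> s)) = e2 t - e2 s"
        using mem m.sym[of "\<theta>' s" "\<theta>' t"] by (simp add: w_def m.bilinear e2_def)
      finally have lhs: "((\<lambda>r. l r w - a (\<theta> r) w + 2 * a (\<theta> r) (\<theta>' r)) has_integral e2 t - e2 s) {s..t}" .
      have "((\<lambda>r. G r * seminorm_of m w + \<epsilon>) has_integral (R t - R s) * seminorm_of m w + \<epsilon> * (t - s)) {s..t}"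
        using has_integral_add[OF has_integral_mult_left[OF R_incr] has_integral_const_real, of s t "seminorm_of m w" \<epsilon>] st
        by (simp add: mult.commute)
      then have "e2 t - e2 s \<le> (R t - R s) * seminorm_of m w + \<epsilon> * (t - s)"
      proof (rule has_integral_le[OF lhs])
        fix r assume r: "r \<in> {s..t}"
        then have rT: "r \<in> {0..T}" using st by auto
        have memr: "\<theta> r \<in> X" "\<theta>' r \<in> X" using X rT by auto
        have "2 *\<^sub>R \<theta>' r - w = (\<theta>' r - \<theta>' t) + (\<theta>' r - \<theta>' s)"
          by (simp add: w_def scaleR_2)
        then have "seminorm_of m (2 *\<^sub>R \<theta>' r - w) \<le> seminorm_of m (\<theta>' r - \<theta>' t) + seminorm_of m (\<theta>' r - \<theta>' s)"
          using m.nrm_triangle[of "\<theta>' r - \<theta>' t" "\<theta>' r - \<theta>' s"] mem memr by simp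
        also have "\<dots> \<le> 2 * \<mu>"
          using d(2)[OF rT st(2)] d(2)[OF rT st(1)] r st by auto
        finally have close: "seminorm_of m (2 *\<^sub>R \<theta>' r - w) \<le> 2 * \<mu>" .
        have "2 * a (\<theta> r) (\<theta>' r) - a (\<theta> r) w = a (\<theta> r) (2 *\<^sub>R \<theta>' r - w)"
          using mem memr by (simp add: a.bilinear)
        also have "\<dots> \<le> seminorm_of a (\<theta> r) * seminorm_of a (2 *\<^sub>R \<theta>' r - w)"
          using a.Cauchy_Schwarz[of "\<theta> r" "2 *\<^sub>R \<theta>' r - w"] mem memr by simp
        also have "\<dots> \<le> M * (sqrt K * (2 * \<mu>))"
        proof (rule mult_mono[OF M(1)[OF rT]])
          have "seminorm_of a (2 *\<^sub>R \<theta>' r - w) \<le> sqrt K * seminorm_of m (2 *\<^sub>R \<theta>' r - w)"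
            using a_le mem memr by simp
          also have "\<dots> \<le> sqrt K * (2 * \<mu>)" using close K by (intro mult_left_mono) auto
          finally show "seminorm_of a (2 *\<^sub>R \<theta>' r - w) \<le> sqrt K * (2 * \<mu>)" .
        qed (use M memr mem in \<open>auto intro!: a.nrm_nonneg\<close>)
        also have "\<dots> \<le> \<epsilon>" by (fact \<mu>\<epsilon>)
        finally show "l r w - a (\<theta> r) w + 2 * a (\<theta> r) (\<theta>' r) \<le> G r * seminorm_of m w + \<epsilon>"
          using l[OF rT mem(5)] by simp
      qed
      also have "seminorm_of m w \<le> sqrt (e2 t) + sqrt (e2 s)"
      proof -
        have "seminorm_of m (\<theta>' r) \<le> sqrt (e2 r)" if "r \<in> {0..T}" for r
          using a.nonneg[of "\<theta> r"] X that by (simp add: seminorm_of_def e2_def)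
        from this[of s] this[of t] st show ?thesis
          using m.nrm_triangle[of "\<theta>' t" "\<theta>' s"] mem by (simp add: w_def)
      qed
      finally show "e2 t - e2 s \<le> (R t - R s) * (sqrt (e2 t) + sqrt (e2 s)) + \<epsilon> * (t - s)"
        using R_mono[of s t] st by (simp add: mult_left_mono)
    qed (fact d(1))
  qed
  \<comment> \<open>regularised, as the energy may vanish: \<open>p + q\<close> is at least \<open>2 * \<eta>\<close>, so the error can be divided by it\<close>
  have reg: "sqrt (e2 t + \<eta>\<^sup>2) - R t \<le> sqrt (e2 0 + \<eta>\<^sup>2) - R 0" if \<eta>: "0 < \<eta>" for \<eta>
  proof (rule nonincreasing_of_small_steps[OF _ t, where F = "\<lambda>t. sqrt (e2 t + \<eta>\<^sup>2) - R t"])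
    fix \<epsilon> :: real assume \<epsilon>: "0 < \<epsilon>"
    then have "0 < 2 * \<eta> * \<epsilon>" using \<eta> by simp
    from step[OF this] obtain d where d: "d > 0" "\<And>s t. s \<in> {0..T} \<Longrightarrow> t \<in> {0..T} \<Longrightarrow> s \<le> t \<Longrightarrow> t - s < d \<Longrightarrow>
      e2 t - e2 s \<le> (R t - R s) * (sqrt (e2 t) + sqrt (e2 s)) + 2 * \<eta> * \<epsilon> * (t - s)" by blast
    show "\<exists>d>0. \<forall>s\<in>{0..T}. \<forall>t\<in>{0..T}. s \<le> t \<longrightarrow> t - s < d \<longrightarrow>
      sqrt (e2 t + \<eta>\<^sup>2) - R t \<le> sqrt (e2 s + \<eta>\<^sup>2) - R s + \<epsilon> * (t - s)"
    proof (intro exI[of _ d] conjI ballI impI)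
      fix s t assume st: "s \<in> {0..T}" "t \<in> {0..T}" "s \<le> t" "t - s < d"
      define p q where "p = sqrt (e2 t + \<eta>\<^sup>2)" and "q = sqrt (e2 s + \<eta>\<^sup>2)"
      have nn: "0 \<le> e2 t" "0 \<le> e2 s" using e2_nonneg st by auto
      have pq: "sqrt (e2 t) \<le> p" "sqrt (e2 s) \<le> q" "p\<^sup>2 = e2 t + \<eta>\<^sup>2" "q\<^sup>2 = e2 s + \<eta>\<^sup>2" "0 \<le> p" "0 \<le> q"
        using nn by (auto simp: p_def q_def)
      have "\<eta> \<le> p" "\<eta> \<le> q"
        using nn \<eta> by (auto simp: p_def q_def intro!: real_le_rsqrt)
      then have "2 * \<eta> * (\<epsilon> * (t - s)) \<le> (p + q) * (\<epsilon> * (t - s))"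
        using \<epsilon> st by (intro mult_right_mono) auto
      moreover have "(R t - R s) * (sqrt (e2 t) + sqrt (e2 s)) \<le> (R t - R s) * (p + q)"
        using pq R_mono[of s t] st by (intro mult_left_mono) auto
      ultimately have sq: "p\<^sup>2 - q\<^sup>2 \<le> ((R t - R s) + \<epsilon> * (t - s)) * (p + q)"
        using d(2)[OF st] pq by (simp add: algebra_simps)
      have "0 \<le> (R t - R s) + \<epsilon> * (t - s)"
        using R_mono[of s t] st \<epsilon> by (intro add_nonneg_nonneg) auto
      then have "p \<le> q + ((R t - R s) + \<epsilon> * (t - s))"
        by (rule le_add_of_squares_le[OF sq pq(5,6)])
      then show "p - R t \<le> q - R s + \<epsilon> * (t - s)" by simp
    qed (fact d(1))
  qed
  have "sqrt (e2 t) - R t \<le> sqrt (e2 0) - R 0"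
  proof (rule field_le_epsilon)
    fix e :: real assume e: "0 < e"
    have zero: "0 \<le> e2 0" "0 \<le> e2 t" using e2_nonneg[of 0] e2_nonneg[OF t] t by auto
    have "sqrt (e2 t) - R t \<le> sqrt (e2 t + e\<^sup>2) - R t" by simp
    also have "\<dots> \<le> sqrt (e2 0 + e\<^sup>2) - R 0" by (rule reg[OF e])
    also have "sqrt (e2 0 + e\<^sup>2) \<le> sqrt (e2 0) + sqrt (e\<^sup>2)"
      using zero by (intro sqrt_add_le_add_sqrt) auto
    finally show "sqrt (e2 t) - R t \<le> sqrt (e2 0) - R 0 + e" using e by simp
  qed
  then show ?thesis by (simp add: e2_def R_def)
qed

section \<open>Smooth test functions\<close>

text \<open>For \<open>n = 0\<close> this is the usual smooth function that vanishes exactly for nonpositive arguments. The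
factors \<open>inverse t ^ n\<close> make the family closed under differentiation up to linear combinations.\<close>

definition bump :: "nat \<Rightarrow> real \<Rightarrow> real" where
  "bump n t = (if t \<le> 0 then 0 else inverse t ^ n * exp (- inverse t))"

lemma bump_tendsto_0_right: "((\<lambda>t. inverse t ^ n * exp (- inverse t)) \<longlongrightarrow> 0) (at_right (0::real))"
proof -
  have "((\<lambda>y::real. y ^ n / exp y) \<longlongrightarrow> 0) at_top"
    by (rule tendsto_power_div_exp_0)
  from filterlim_compose[OF this filterlim_inverse_at_top_right]
  show ?thesis by (simp add: exp_minus field_simps)
qed

lemma bump_tendsto_0: "(bump n \<longlongrightarrow> 0) (at 0)"
proof -
  have "(bump n \<longlongrightarrow> 0) (at_left 0)"
    by (rule Lim_transform_eventually[OF tendsto_const])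
       (auto simp: eventually_at_filter bump_def)
  moreover have "(bump n \<longlongrightarrow> 0) (at_right 0)"
    by (rule Lim_transform_eventually[OF bump_tendsto_0_right[of n]])
       (auto simp: eventually_at_filter bump_def)
  ultimately show ?thesis by (simp add: filterlim_split_at)
qed

lemma has_derivative_bump:
  "(bump n has_real_derivative (bump (n + 2) t - real n * bump (n + 1) t)) (at t)"
proof -
  consider "t < 0" | "t = 0" | "0 < t" by linarith
  then show ?thesis
  proof cases
    case 1
    have "((\<lambda>_. 0) has_real_derivative 0) (at t)" by simp
    then have "(bump n has_real_derivative 0) (at t)"
      by (rule has_field_derivative_transform_within_open[where S = "{..<0}"]) (use 1 in \<open>auto simp: bump_def\<close>)
    then show ?thesis using 1 by (simp add: bump_def)
  next
    case 2
    have "((\<lambda>s. (bump n s - bump n 0) / (s - 0)) \<longlongrightarrow> 0) (at 0)"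
      by (rule Lim_transform_eventually[OF bump_tendsto_0[of "Suc n"]])
         (auto simp: eventually_at_filter bump_def field_simps)
    then show ?thesis using 2 by (simp add: has_field_derivative_iff bump_def)
  next
    case 3
    have "((\<lambda>t. inverse t ^ n * exp (- inverse t)) has_real_derivative
        ((real n * (- (inverse t ^ 2)) * inverse t ^ (n - 1)) * exp (- inverse t)
        + inverse t ^ n * (exp (- inverse t) * inverse t ^ 2))) (at t)"
      using 3 by (auto intro!: derivative_eq_intros simp: power2_eq_square)
    moreover have "(real n * (- (inverse t ^ 2)) * inverse t ^ (n - 1)) * exp (- inverse t)
        + inverse t ^ n * (exp (- inverse t) * inverse t ^ 2) = bump (n + 2) t - real n * bump (n + 1) t"
      using 3 by (cases n) (auto simp: bump_def power2_eq_square algebra_simps)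
    ultimately have "((\<lambda>t. inverse t ^ n * exp (- inverse t)) has_real_derivative
        (bump (n + 2) t - real n * bump (n + 1) t)) (at t)" by simp
    then show ?thesis
      by (rule has_field_derivative_transform_within_open[where S = "{0<..}"]) (use 3 in \<open>auto simp: bump_def\<close>)
  qed
qed

lemma bump_nonneg: "0 \<le> bump n t"
  by (simp add: bump_def)

lemma bump_0_le_1: "bump 0 t \<le> 1"
  by (simp add: bump_def)

lemma bump_0_tendsto_1:
  assumes "0 < y" shows "(\<lambda>k. bump 0 (real (Suc k) * y)) \<longlonglongrightarrow> 1"
proof -
  have "(\<lambda>k. exp (- (inverse y * inverse (real (Suc k))))) \<longlonglongrightarrow> exp (- (inverse y * 0))"
    by (intro tendsto_intros LIMSEQ_inverse_real_of_nat)
  moreover have "bump 0 (real (Suc k) * y) = exp (- (inverse y * inverse (real (Suc k))))" for k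
    using assms by (auto simp: bump_def zero_less_mult_iff not_le)
  ultimately show ?thesis by simp
qed

text \<open>An algebra of functions containing the bumps along arbitrary directions. It is closed under partial
derivatives, so that its members are smooth.\<close>

inductive bump_algebra :: "('a::euclidean_space \<Rightarrow> real) \<Rightarrow> bool" where
  bump: "bump_algebra (\<lambda>x. bump n (x \<bullet> v + r))"
| const: "bump_algebra (\<lambda>x. c)"
| add: "bump_algebra f \<Longrightarrow> bump_algebra g \<Longrightarrow> bump_algebra (\<lambda>x. f x + g x)"
| mult: "bump_algebra f \<Longrightarrow> bump_algebra g \<Longrightarrow> bump_algebra (\<lambda>x. f x * g x)"

lemma bump_algebra_derivative:
  assumes "bump_algebra f"
  shows "(\<forall>x. f differentiable (at x)) \<and> (\<forall>b. bump_algebra (\<lambda>x. frechet_derivative f (at x) b))"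
  using assms
proof induction
  case (bump n v r)
  have der: "((\<lambda>x. bump n (x \<bullet> v + r)) has_derivative
      (\<lambda>h. (bump (n + 2) (x \<bullet> v + r) - real n * bump (n + 1) (x \<bullet> v + r)) * (h \<bullet> v))) (at x)" for x
  proof -
    have 1: "((\<lambda>x. x \<bullet> v + r) has_derivative (\<lambda>h. h \<bullet> v)) (at x)"
      by (auto intro!: derivative_eq_intros)
    show ?thesis
      using has_derivative_compose[OF 1 has_derivative_bump[unfolded has_field_derivative_def]]
      by (simp add: algebra_simps)
  qed
  have fd: "frechet_derivative (\<lambda>x. bump n (x \<bullet> v + r)) (at x) =
      (\<lambda>h. (bump (n + 2) (x \<bullet> v + r) - real n * bump (n + 1) (x \<bullet> v + r)) * (h \<bullet> v))" for x
    by (rule frechet_derivative_at[symmetric, OF der])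
  have "bump_algebra (\<lambda>x. (bump (n + 2) (x \<bullet> v + r) + (- real n) * bump (n + 1) (x \<bullet> v + r)) * (b \<bullet> v))" for b
    by (intro bump_algebra.intros)
  then show ?case
    using der by (auto simp: fd differentiable_def)
next
  case (const c)
  then show ?case by (auto intro: bump_algebra.intros)
next
  case (add f g)
  then have "frechet_derivative (\<lambda>x. f x + g x) (at x) =
      (\<lambda>h. frechet_derivative f (at x) h + frechet_derivative g (at x) h)" for x
    by (intro frechet_derivative_at[symmetric] has_derivative_add) (auto simp: frechet_derivative_works[symmetric])
  with add show ?case by (auto intro: bump_algebra.intros)
next
  case (mult f g)
  then have "frechet_derivative (\<lambda>x. f x * g x) (at x) =
      (\<lambda>h. f x * frechet_derivative g (at x) h + frechet_derivative f (at x) h * g x)" for x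
    by (intro frechet_derivative_at[symmetric] has_derivative_mult) (auto simp: frechet_derivative_works[symmetric])
  with mult show ?case by (auto intro!: bump_algebra.intros differentiable_mult)
qed

lemma bump_algebra_smooth:
  assumes "bump_algebra f"
  shows "smooth f"
proof -
  have "Ck k f" if "bump_algebra f" for k f
    using that
  proof (induction k arbitrary: f)
    case 0
    then have "\<forall>x. f differentiable (at x)" using bump_algebra_derivative by blast
    then show ?case
      by (simp add: continuous_at_imp_continuous_on differentiable_imp_continuous_within)
  next
    case (Suc k)
    then show ?case using bump_algebra_derivative by auto
  qed
  then show ?thesis using assms unfolding smooth_def by blast
qed

lemma bump_algebra_prod: "finite S \<Longrightarrow> (\<And>i. i \<in> S \<Longrightarrow> bump_algebra (f i)) \<Longrightarrow> bump_algebra (\<lambda>x. \<Prod>i\<in>S. f i x)"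
  by (induction S rule: finite_induct) (auto intro: bump_algebra.intros)

text \<open>Test functions between zero and the indicator of a box that converge to the latter, because \<open>bump 0 (k *
y)\<close> tends to one for every positive \<open>y\<close>. The factor is \<open>Suc k\<close> to keep the argument positive for \<open>k =
0\<close>.\<close>

definition box_bump :: "'a::euclidean_space \<Rightarrow> 'a \<Rightarrow> nat \<Rightarrow> 'a \<Rightarrow> real" where
  "box_bump a b k x = (\<Prod>i\<in>Basis. bump 0 (real (Suc k) * (x \<bullet> i - a \<bullet> i)) * bump 0 (real (Suc k) * (b \<bullet> i - x \<bullet> i)))"

lemma box_bump_smooth: "smooth (box_bump a b k)"
proof -
  have "bump_algebra (\<lambda>x. bump 0 (x \<bullet> (real (Suc k) *\<^sub>R i) + (- (real (Suc k) * (a \<bullet> i))))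
      * bump 0 (x \<bullet> (- (real (Suc k) *\<^sub>R i)) + real (Suc k) * (b \<bullet> i)))" for i
    by (intro bump_algebra.intros)
  then have "bump_algebra (\<lambda>x. bump 0 (real (Suc k) * (x \<bullet> i - a \<bullet> i)) * bump 0 (real (Suc k) * (b \<bullet> i - x \<bullet> i)))" for i
    by (simp add: algebra_simps)
  then have "bump_algebra (box_bump a b k)"
    unfolding box_bump_def[abs_def] by (intro bump_algebra_prod) auto
  then show ?thesis by (rule bump_algebra_smooth)
qed

lemma box_bump_outside:
  assumes "x \<notin> box a b" shows "box_bump a b k x = 0"
proof -
  obtain i where i: "i \<in> Basis" "x \<bullet> i \<le> a \<bullet> i \<or> b \<bullet> i \<le> x \<bullet> i"
    using assms by (auto simp: mem_box not_less)
  then have "bump 0 (real (Suc k) * (x \<bullet> i - a \<bullet> i)) * bump 0 (real (Suc k) * (b \<bullet> i - x \<bullet> i)) = 0"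
    by (auto simp: bump_def mult_le_0_iff)
  then show ?thesis
    unfolding box_bump_def using i by (intro prod_zero) auto
qed

lemma box_bump_bounds: "0 \<le> box_bump a b k x" "box_bump a b k x \<le> 1"
  unfolding box_bump_def
  by (auto intro!: prod_nonneg prod_le_1 mult_le_one simp: bump_nonneg bump_0_le_1)

lemma box_bump_tendsto: "(\<lambda>k. box_bump a b k x) \<longlonglongrightarrow> indicator (box a b) x"
proof (cases "x \<in> box a b")
  case True
  then have "(\<lambda>k. box_bump a b k x) \<longlonglongrightarrow> (\<Prod>i\<in>(Basis::'a set). 1 * 1)"
    unfolding box_bump_def by (intro tendsto_intros bump_0_tendsto_1) (auto simp: mem_box)
  then show ?thesis using True by simp
qed (simp add: box_bump_outside)

lemma box_bump_test_function:
  assumes "cbox a b \<subseteq> \<Omega>" shows "box_bump a b k \<in> test_functions \<Omega>"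
  unfolding test_functions_def
proof (intro CollectI conjI exI[of _ "cbox a b"] allI impI)
  show "box_bump a b k x = 0" if "x \<notin> cbox a b" for x
    using that box_subset_cbox[of a b] by (intro box_bump_outside) auto
qed (use assms box_bump_smooth in auto)

lemma integral_box_bump_tendsto:
  assumes q: "integrable (lebesgue_on \<Omega>) q" and \<Omega>: "\<Omega> \<in> sets lebesgue" and ab: "box a b \<subseteq> \<Omega>"
  shows "(\<lambda>k. integral\<^sup>L (lebesgue_on \<Omega>) (\<lambda>x. q x * box_bump a b k x)) \<longlonglongrightarrow> integral (cbox a b) q"
proof -
  have qm: "q \<in> borel_measurable (lebesgue_on \<Omega>)" using q by auto
  have bm: "box_bump a b k \<in> borel_measurable (lebesgue_on \<Omega>)" for k
  proof -
    have "continuous_on UNIV (box_bump a b k)"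
      using box_bump_smooth[of a b k] unfolding smooth_def by (metis Ck.simps(1))
    then have "box_bump a b k \<in> borel_measurable borel" by (rule borel_measurable_continuous_onI)
    then show ?thesis
      by (intro measurable_restrict_space1 measurable_completion) simp
  qed
  have lim: "(\<lambda>k. integral\<^sup>L (lebesgue_on \<Omega>) (\<lambda>x. q x * box_bump a b k x))
      \<longlonglongrightarrow> integral\<^sup>L (lebesgue_on \<Omega>) (\<lambda>x. q x * indicator (box a b) x)"
  proof (rule integral_dominated_convergence[where w = "\<lambda>x. norm (q x)"])
    show "(\<lambda>x. q x * indicator (box a b) x) \<in> borel_measurable (lebesgue_on \<Omega>)"
    proof -
      have "(\<lambda>x. indicator (box a b) x :: real) \<in> borel_measurable (lebesgue_on \<Omega>)"
        by (intro measurable_restrict_space1 measurable_completion) simp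
      then show ?thesis using qm by (intro borel_measurable_times)
    qed
    show "AE x in lebesgue_on \<Omega>. (\<lambda>k. q x * box_bump a b k x) \<longlonglongrightarrow> q x * indicator (box a b) x"
      by (intro AE_I2 tendsto_intros box_bump_tendsto)
    show "AE x in lebesgue_on \<Omega>. norm (q x * box_bump a b k x) \<le> norm (q x)" for k
      using box_bump_bounds[of a b k]
      by (intro AE_I2) (simp add: abs_mult mult_left_le)
  qed (use q qm bm in auto)
  have "integrable (lebesgue_on \<Omega>) (\<lambda>x. q x * indicator (box a b) x)"
  proof -
    have "integrable (lebesgue_on \<Omega>) (\<lambda>x. indicator (box a b) x *\<^sub>R q x)"
    proof (rule integrable_mult_indicator[OF _ q])
      have "box a b = box a b \<inter> \<Omega>" using ab by auto
      then show "box a b \<in> sets (lebesgue_on \<Omega>)"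
        using ab by (simp add: sets_restrict_space_iff \<Omega>)
    qed
    then show ?thesis by (simp add: mult.commute)
  qed
  from has_integral_integral_lebesgue_on[OF this \<Omega>]
  have "((\<lambda>x. if x \<in> box a b then q x else 0) has_integral
      integral\<^sup>L (lebesgue_on \<Omega>) (\<lambda>x. q x * indicator (box a b) x)) \<Omega>"
    by (rule has_integral_eq[rotated]) (auto simp: indicator_def)
  then have "(q has_integral integral\<^sup>L (lebesgue_on \<Omega>) (\<lambda>x. q x * indicator (box a b) x)) (box a b)"
    using has_integral_restrict[OF ab, of q] by auto
  then have "(q has_integral integral\<^sup>L (lebesgue_on \<Omega>) (\<lambda>x. q x * indicator (box a b) x)) (cbox a b)"
    by (simp add: has_integral_open_interval)
  then show ?thesis using lim by (simp add: integral_unique)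
qed

text \<open>The fundamental lemma of the calculus of variations. Box bumps show that the integral of \<open>g\<close> over every
closed box inside \<open>\<Omega>\<close> vanishes; by the differentiation theorem of Lebesgue, \<open>g\<close> is almost
everywhere the limit of its means over small boxes.\<close>

lemma fundamental_lemma:
  fixes g :: "'a::euclidean_space \<Rightarrow> real"
  assumes \<Omega>: "open \<Omega>" and g: "integrable (lebesgue_on \<Omega>) g"
    and zero: "\<And>\<phi>. \<phi> \<in> test_functions \<Omega> \<Longrightarrow> integral\<^sup>L (lebesgue_on \<Omega>) (\<lambda>x. g x * \<phi> x) = 0"
  shows "AE x in lebesgue_on \<Omega>. g x = 0"
proof -
  have \<Omega>l: "\<Omega> \<in> sets lebesgue" using \<Omega> by auto
  \<comment> \<open>extension by zero, as the differentiation theorem is stated for functions on the whole space\<close>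
  define f where "f x = (if x \<in> \<Omega> then g x else 0)" for x
  have "g integrable_on \<Omega>" by (rule integrable_on_lebesgue_on[OF g \<Omega>l])
  then have fint: "f integrable_on UNIV"
    unfolding f_def by (simp add: integrable_restrict_UNIV)
  have box0: "integral (cbox a b) f = 0" if ab: "cbox a b \<subseteq> \<Omega>" for a b
  proof -
    have "box a b \<subseteq> \<Omega>" using ab box_subset_cbox by blast
    from integral_box_bump_tendsto[OF g \<Omega>l this] zero[OF box_bump_test_function[OF ab]]
    have "integral (cbox a b) g = 0"
      by (simp add: LIMSEQ_const_iff)
    moreover have "integral (cbox a b) f = integral (cbox a b) g"
      using ab by (intro integral_cong) (auto simp: f_def)
    ultimately show ?thesis by simp
  qed
  have "f integrable_on cbox a b" for a b
    by (rule integrable_on_subcbox[OF fint]) simp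
  then obtain N where N: "negligible N" and lim: "\<And>x e. x \<notin> N \<Longrightarrow> 0 < e \<Longrightarrow>
      \<exists>d>0. \<forall>h. 0 < h \<and> h < d \<longrightarrow> norm (integral (cbox x (x + h *\<^sub>R One)) f /\<^sub>R h ^ DIM('a) - f x) < e"
    using integrable_ccontinuous_explicit[of f] by blast
  have "g x = 0" if x: "x \<in> \<Omega>" "x \<notin> N" for x
  proof (rule ccontr)
    assume "g x \<noteq> 0"
    then have fx: "0 < norm (f x)" using x by (simp add: f_def)
    obtain d where d: "d > 0" "\<And>h. 0 < h \<Longrightarrow> h < d \<Longrightarrow>
        norm (integral (cbox x (x + h *\<^sub>R One)) f /\<^sub>R h ^ DIM('a) - f x) < norm (f x)"
      using lim[OF x(2) fx] by blast
    obtain r where r: "r > 0" "cball x r \<subseteq> \<Omega>"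
      using \<Omega> x open_contains_cball by blast
    define h where "h = min (d / 2) (r / (real DIM('a) + 1))"
    have h: "0 < h" "h < d" using d r by (auto simp: h_def)
    have "cbox x (x + h *\<^sub>R One) \<subseteq> cball x r"
    proof
      fix y assume y: "y \<in> cbox x (x + h *\<^sub>R One)"
      have "norm (y - x) \<le> (\<Sum>i\<in>Basis. \<bar>(y - x) \<bullet> i\<bar>)" by (rule norm_le_l1)
      also have "\<dots> \<le> (\<Sum>i\<in>(Basis::'a set). h)"
      proof (rule sum_mono)
        fix i :: 'a assume i: "i \<in> Basis"
        then have "x \<bullet> i \<le> y \<bullet> i" "y \<bullet> i \<le> x \<bullet> i + h"
          using y by (auto simp: mem_box inner_add_left)
        then show "\<bar>(y - x) \<bullet> i\<bar> \<le> h" by (simp add: inner_diff_left)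
      qed
      also have "\<dots> = real DIM('a) * h" by simp
      also have "\<dots> \<le> real DIM('a) * (r / (real DIM('a) + 1))"
        by (intro mult_left_mono) (auto simp: h_def)
      also have "\<dots> \<le> r" using r by (simp add: field_simps)
      finally show "y \<in> cball x r" by (simp add: dist_norm norm_minus_commute)
    qed
    with r have "integral (cbox x (x + h *\<^sub>R One)) f = 0" by (intro box0) auto
    then show False using d(2)[OF h] by simp
  qed
  then have "{x \<in> \<Omega>. g x \<noteq> 0} \<subseteq> N" by auto
  then have "negligible {x \<in> \<Omega>. g x \<noteq> 0}" using N negligible_subset by blast
  then have "{x \<in> \<Omega>. g x \<noteq> 0} \<in> null_sets lebesgue" by (simp add: negligible_iff_null_sets)
  then have "AE x in lebesgue. x \<in> \<Omega> \<longrightarrow> g x = 0"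
    by (intro AE_I'[where N = "{x \<in> \<Omega>. g x \<noteq> 0}"]) auto
  then show ?thesis using \<Omega>l by (simp add: AE_restrict_space_iff)
qed

section \<open>Weak derivatives in one variable\<close>

text \<open>The measures with density \<open>\<psi>' k\<close> on \<open>{s..m}\<close> are nonnegative with mass \<open>\<psi> k m\<close>, which tends to
one, and their mass \<open>\<psi> k m - \<psi> k (s + d)\<close> away from \<open>s\<close> tends to zero. So they converge to the
point mass at \<open>s\<close>.\<close>

lemma tendsto_integral_concentrating:
  fixes p :: "real \<Rightarrow> real" and \<psi> \<psi>' :: "nat \<Rightarrow> real \<Rightarrow> real"
  assumes sm: "s < m" and p: "continuous_on {s..m} p"
    and der: "\<And>k x. x \<in> {s..m} \<Longrightarrow> (\<psi> k has_real_derivative \<psi>' k x) (at x)"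
    and cont: "\<And>k. continuous_on {s..m} (\<psi>' k)"
    and nonneg: "\<And>k x. x \<in> {s..m} \<Longrightarrow> 0 \<le> \<psi>' k x"
    and zero: "\<And>k. \<psi> k s = 0"
    and one: "\<And>x. x \<in> {s<..m} \<Longrightarrow> (\<lambda>k. \<psi> k x) \<longlonglongrightarrow> 1"
  shows "(\<lambda>k. integral {s..m} (\<lambda>x. p x * \<psi>' k x)) \<longlonglongrightarrow> p s"
proof (rule tendstoI)
  fix e :: real assume e: "0 < e"
  define \<epsilon> where "\<epsilon> = e / 2"
  have \<epsilon>: "0 < \<epsilon>" "\<epsilon> < e" using e by (auto simp: \<epsilon>_def)
  obtain d0 where d0: "d0 > 0" "\<And>x. x \<in> {s..m} \<Longrightarrow> dist x s < d0 \<Longrightarrow> dist (p x) (p s) < \<epsilon>"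
    using p sm \<epsilon>(1) unfolding continuous_on_iff by (metis atLeastAtMost_iff less_imp_le order_refl)
  define d where "d = min (d0 / 2) (m - s)"
  have d: "0 < d" "s + d \<le> m" "d < d0" using d0(1) sm by (auto simp: d_def)
  have near: "\<bar>p x - p s\<bar> \<le> \<epsilon>" if "x \<in> {s..s + d}" for x
    using d0(2)[of x] that d by (auto simp: dist_real_def)
  have "compact ((\<lambda>x. p x - p s) ` {s..m})"
    using p by (intro compact_continuous_image continuous_intros) auto
  then obtain M where "0 < M" "\<forall>y\<in>(\<lambda>x. p x - p s) ` {s..m}. norm y \<le> M"
    using compact_imp_bounded bounded_pos by blast
  then have M: "0 < M" "\<And>x. x \<in> {s..m} \<Longrightarrow> \<bar>p x - p s\<bar> \<le> M" by auto
  have FTC: "(\<psi>' k has_integral \<psi> k y - \<psi> k x) {x..y}" if "s \<le> x" "x \<le> y" "y \<le> m" for k x y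
  proof (rule fundamental_theorem_of_calculus[OF that(2)])
    fix z assume "z \<in> {x..y}"
    then show "(\<psi> k has_vector_derivative \<psi>' k z) (at z within {x..y})"
      using der[of z k] that
      by (auto simp: has_real_derivative_iff_has_vector_derivative intro: has_vector_derivative_at_within)
  qed
  define B where "B k = \<epsilon> * \<psi> k (s + d) + M * (\<psi> k m - \<psi> k (s + d))" for k
  have est: "\<bar>integral {s..m} (\<lambda>x. p x * \<psi>' k x) - p s * \<psi> k m\<bar> \<le> B k" for k
  proof -
    let ?f = "\<lambda>x. (p x - p s) * \<psi>' k x"
    have int: "?f integrable_on {x..y}" if "s \<le> x" "y \<le> m" for x y
      using that
      by (intro integrable_continuous_real continuous_intros continuous_on_subset[OF p]
          continuous_on_subset[OF cont]) auto
    have pint: "(\<lambda>x. p x * \<psi>' k x) integrable_on {s..m}"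
      by (intro integrable_continuous_real continuous_intros p cont)
    have I: "integral {s..m} (\<psi>' k) = \<psi> k m"
      using FTC[of s m k] sm zero by (simp add: integral_unique)
    have pI: "(\<lambda>x. p s * \<psi>' k x) integrable_on {s..m}"
      by (intro integrable_continuous_real continuous_intros cont)
    have "integral {s..m} ?f = integral {s..m} (\<lambda>x. p x * \<psi>' k x) - integral {s..m} (\<lambda>x. p s * \<psi>' k x)"
      using Henstock_Kurzweil_Integration.integral_diff[OF pint pI] by (simp add: algebra_simps)
    then have "integral {s..m} (\<lambda>x. p x * \<psi>' k x) - p s * \<psi> k m = integral {s..m} ?f"
      by (simp add: I)
    also have "\<dots> = integral {s..s + d} ?f + integral {s + d..m} ?f"
      using d int by (intro Henstock_Kurzweil_Integration.integral_combine[symmetric]) auto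
    finally have split: "\<bar>integral {s..m} (\<lambda>x. p x * \<psi>' k x) - p s * \<psi> k m\<bar>
        \<le> \<bar>integral {s..s + d} ?f\<bar> + \<bar>integral {s + d..m} ?f\<bar>" by simp
    have "norm (integral {s..s + d} ?f) \<le> integral {s..s + d} (\<lambda>x. \<epsilon> * \<psi>' k x)"
      using d near nonneg FTC[of s "s + d" k] int
      by (intro integral_norm_bound_integral)
         (auto simp: abs_mult intro!: mult_right_mono integrable_on_mult_right)
    also have "\<dots> = \<epsilon> * \<psi> k (s + d)"
      using FTC[of s "s + d" k] d zero by (simp add: integral_unique)
    finally have 1: "\<bar>integral {s..s + d} ?f\<bar> \<le> \<epsilon> * \<psi> k (s + d)" by simp
    have "norm (integral {s + d..m} ?f) \<le> integral {s + d..m} (\<lambda>x. M * \<psi>' k x)"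
      using d M nonneg FTC[of "s + d" m k] int
      by (intro integral_norm_bound_integral)
         (auto simp: abs_mult intro!: mult_right_mono integrable_on_mult_right)
    also have "\<dots> = M * (\<psi> k m - \<psi> k (s + d))"
      using FTC[of "s + d" m k] d by (simp add: integral_unique)
    finally have 2: "\<bar>integral {s + d..m} ?f\<bar> \<le> M * (\<psi> k m - \<psi> k (s + d))" by simp
    show ?thesis using split 1 2 by (simp add: B_def)
  qed
  have "(\<lambda>k. B k + \<bar>p s\<bar> * \<bar>\<psi> k m - 1\<bar>) \<longlonglongrightarrow> (\<epsilon> * 1 + M * (1 - 1)) + \<bar>p s\<bar> * \<bar>1 - 1\<bar>"
    unfolding B_def using d sm by (intro tendsto_intros one) auto
  then have "(\<lambda>k. B k + \<bar>p s\<bar> * \<bar>\<psi> k m - 1\<bar>) \<longlonglongrightarrow> \<epsilon>" by simp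
  then have "eventually (\<lambda>k. B k + \<bar>p s\<bar> * \<bar>\<psi> k m - 1\<bar> < e) sequentially"
    using \<epsilon>(2) by (rule order_tendstoD(2))
  then show "eventually (\<lambda>k. dist (integral {s..m} (\<lambda>x. p x * \<psi>' k x)) (p s) < e) sequentially"
  proof eventually_elim
    case (elim k)
    have "\<bar>p s * \<psi> k m - p s\<bar> = \<bar>p s\<bar> * \<bar>\<psi> k m - 1\<bar>"
      by (simp flip: abs_mult add: algebra_simps)
    then show ?case using est[of k] elim by (simp add: dist_real_def)
  qed
qed

text \<open>The derivative of the one-dimensional \<open>box_bump s t k\<close>.\<close>

definition interval_bump' :: "real \<Rightarrow> real \<Rightarrow> nat \<Rightarrow> real \<Rightarrow> real" where
  "interval_bump' s t k x = real (Suc k) *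
     (bump 2 (real (Suc k) * (x - s)) * bump 0 (real (Suc k) * (t - x))
      - bump 0 (real (Suc k) * (x - s)) * bump 2 (real (Suc k) * (t - x)))"

lemma interval_bump_eq:
  "box_bump s t k (x::real) = bump 0 (real (Suc k) * (x - s)) * bump 0 (real (Suc k) * (t - x))"
  by (simp add: box_bump_def)

lemma interval_bump_derivative:
  "(box_bump s t k has_real_derivative interval_bump' s t k x) (at x)"
proof -
  have b: "(bump 0 has_real_derivative bump 2 y) (at y)" for y
    using has_derivative_bump[of 0 y] by (simp add: numeral_2_eq_2)
  have 1: "((\<lambda>x. bump 0 (real (Suc k) * (x - s))) has_real_derivative
      bump 2 (real (Suc k) * (x - s)) * real (Suc k)) (at x)"
    by (rule DERIV_chain2[OF b])
       (auto intro!: derivative_eq_intros)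
  have 2: "((\<lambda>x. bump 0 (real (Suc k) * (t - x))) has_real_derivative
      bump 2 (real (Suc k) * (t - x)) * (- real (Suc k))) (at x)"
    by (rule DERIV_chain2[OF b])
       (auto intro!: derivative_eq_intros)
  have "box_bump s t k = (\<lambda>x. bump 0 (real (Suc k) * (x - s)) * bump 0 (real (Suc k) * (t - x)))"
    by (rule ext) (rule interval_bump_eq)
  with DERIV_mult[OF 1 2] show ?thesis
    by (simp add: interval_bump'_def algebra_simps)
qed

lemma continuous_on_bump: "continuous_on S (bump n)"
  using has_derivative_bump by (meson DERIV_isCont continuous_at_imp_continuous_on)

lemma interval_bump'_continuous: "continuous_on S (interval_bump' s t k)"
  unfolding interval_bump'_def[abs_def]
  by (intro continuous_intros continuous_on_compose2[OF continuous_on_bump[of UNIV]]) auto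

text \<open>The logarithm of \<open>bump 0 y * bump 0 w\<close> is \<open>- (1/y + 1/w)\<close>, whose growth when \<open>y\<close> increases and \<open>w\<close>
decreases at the same speed is \<open>1/y\<^sup>2 - 1/w\<^sup>2\<close>.\<close>

lemma interval_bump'_nonneg:
  assumes "x - s \<le> t - x" shows "0 \<le> interval_bump' s t k x"
proof -
  have "bump 0 y * bump 2 w \<le> bump 2 y * bump 0 w" if "y \<le> w" for y w
  proof (cases "y \<le> 0")
    case False
    then have "(inverse w)\<^sup>2 \<le> (inverse y)\<^sup>2" using that by (intro power_mono) (auto simp: le_imp_inverse_le)
    then show ?thesis using False that by (simp add: bump_def mult_right_mono)
  qed (simp add: bump_def)
  from this[of "real (Suc k) * (x - s)" "real (Suc k) * (t - x)"] assms show ?thesis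
    unfolding interval_bump'_def by (intro mult_nonneg_nonneg) (auto intro!: mult_left_mono simp: mult.commute)
qed

lemma interval_bump_reflect:
  "box_bump s t k (- x) = box_bump (- t) (- s) k (x::real)"
  "interval_bump' s t k (- x) = - interval_bump' (- t) (- s) k x"
proof -
  have e: "- x - s = - s - x" "t - - x = x - - t" by simp_all
  show "box_bump s t k (- x) = box_bump (- t) (- s) k x"
    by (simp only: interval_bump_eq e mult.commute)
  show "interval_bump' s t k (- x) = - interval_bump' (- t) (- s) k x"
    by (simp only: interval_bump'_def e) algebra
qed

lemma interval_bump_tendsto_1:
  fixes s t x :: real
  assumes "s < x" "x < t" shows "(\<lambda>k. box_bump s t k x) \<longlonglongrightarrow> 1"
  using box_bump_tendsto[of s t x] assms by (simp add: box_real)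

text \<open>On the left half of the interval the derivative of the bump is a nonnegative density concentrating at
\<open>s\<close>; on the right half its negative concentrates at \<open>t\<close>, which is the first case after reflection.\<close>

lemma tendsto_integral_interval_bump':
  fixes p :: "real \<Rightarrow> real"
  assumes st: "s < t" and p: "continuous_on {s..t} p"
  shows "(\<lambda>k. integral {s..t} (\<lambda>x. p x * interval_bump' s t k x)) \<longlonglongrightarrow> p s - p t"
proof -
  define m where "m = (s + t) / 2"
  have m: "s < m" "m < t" using st by (auto simp: m_def)
  have half: "(\<lambda>k. integral {s..m} (\<lambda>x. p x * interval_bump' s t k x)) \<longlonglongrightarrow> p s"
    if s: "s < t" "m = (s + t) / 2" and p: "continuous_on {s..m} p" for p s t m
  proof (rule tendsto_integral_concentrating[where \<psi> = "box_bump s t"])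
    show "box_bump s t k s = 0" for k by (simp add: interval_bump_eq bump_def)
  qed (use that in \<open>auto intro!: interval_bump_derivative interval_bump'_continuous
      interval_bump'_nonneg interval_bump_tendsto_1\<close>)
  have 1: "(\<lambda>k. integral {s..m} (\<lambda>x. p x * interval_bump' s t k x)) \<longlonglongrightarrow> p s"
    by (rule half[OF st m_def]) (use m in \<open>auto intro: continuous_on_subset[OF p]\<close>)
  have lim: "(\<lambda>k. integral {- t..- m} (\<lambda>x. p (- x) * interval_bump' (- t) (- s) k x)) \<longlonglongrightarrow> p (- (- t))"
  proof (rule half)
    show "- m = (- t + - s) / 2" by (simp add: m_def field_simps)
    show "continuous_on {- t..- m} (\<lambda>x. p (- x))"
      by (rule continuous_on_compose2[OF p]) (use m in \<open>auto intro: continuous_intros\<close>)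
  qed (use st in simp)
  have "integral {- t..- m} (\<lambda>x. p (- x) * interval_bump' (- t) (- s) k x)
      = - integral {m..t} (\<lambda>x. p x * interval_bump' s t k x)" for k
  proof -
    have "integral {- t..- m} (\<lambda>x. p (- x) * interval_bump' (- t) (- s) k x)
        = integral {- t..- m} (\<lambda>x. - (p (- x) * interval_bump' s t k (- x)))"
      by (simp add: interval_bump_reflect)
    also have "\<dots> = - integral {m..t} (\<lambda>x. p x * interval_bump' s t k x)"
      using Henstock_Kurzweil_Integration.integral_reflect_real[of t m "\<lambda>x. - (p x * interval_bump' s t k x)"] by simp
    finally show ?thesis .
  qed
  with lim have 2: "(\<lambda>k. - integral {m..t} (\<lambda>x. p x * interval_bump' s t k x)) \<longlonglongrightarrow> p t" by simp
  have "integral {s..m} (\<lambda>x. p x * interval_bump' s t k x) + integral {m..t} (\<lambda>x. p x * interval_bump' s t k x)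
      = integral {s..t} (\<lambda>x. p x * interval_bump' s t k x)" for k
    using m by (intro Henstock_Kurzweil_Integration.integral_combine integrable_continuous_real
        continuous_intros p interval_bump'_continuous) auto
  with tendsto_diff[OF 1 2] show ?thesis by simp
qed

lemma lebesgue_integral_interval:
  fixes g :: "real \<Rightarrow> real"
  assumes g: "continuous_on {s..t} g" and st: "0 < s" "t < T" and zero: "\<And>x. x \<notin> {s..t} \<Longrightarrow> g x = 0"
  shows "integral\<^sup>L (lebesgue_on {0<..<T}) g = integral {s..t} g"
proof -
  have "integral\<^sup>L (lebesgue_on {0<..<T}) g = integral\<^sup>L lebesgue (\<lambda>x. indicator {0<..<T} x *\<^sub>R g x)"
    by (rule integral_restrict_space) simp
  also have "(\<lambda>x. indicator {0<..<T} x *\<^sub>R g x) = (\<lambda>x. indicator {s..t} x *\<^sub>R g x)"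
    using st zero by (auto simp: indicator_def fun_eq_iff)
  also have "integral\<^sup>L lebesgue \<dots> = integral\<^sup>L (lebesgue_on {s..t}) g"
    by (rule integral_restrict_space[symmetric]) simp
  also have "\<dots> = integral {s..t} g"
    by (intro lebesgue_integral_eq_integral absolutely_integrable_imp_integrable
        absolutely_integrable_continuous_real g) auto
  finally show ?thesis .
qed

text \<open>With the box bumps of \<open>{s..t}\<close> as test functions, the two sides of the weak identity tend to \<open>p s - p t\<close>
and to \<open>- \<integral> q\<close>. The test functions need \<open>0 < s\<close> and \<open>t < T\<close>; the end points follow by
continuity.\<close>

lemma has_integral_of_weak_deriv:
  fixes p q :: "real \<Rightarrow> real"
  assumes p: "continuous_on {0..T} p" and q: "integrable (lebesgue_on {0<..<T}) q"
    and weak: "weak_time_deriv 1 T p q" and st: "0 \<le> s" "s \<le> t" "t \<le> T"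
  shows "(q has_integral p t - p s) {s..t}"
proof -
  have "q integrable_on {0<..<T}" by (rule integrable_on_lebesgue_on[OF q]) simp
  then have qi: "q integrable_on {0..T}"
    by (simp add: integrable_on_open_interval_real)
  have inner: "integral {s..t} q = p t - p s" if st: "0 < s" "s < t" "t < T" for s t
  proof -
    have test: "box_bump s t k \<in> test_functions {0<..<T}" for k
      by (rule box_bump_test_function) (use st in auto)
    have deriv: "deriv (box_bump s t k) = interval_bump' s t k" for k
      by (rule ext) (rule DERIV_imp_deriv[OF interval_bump_derivative])
    have "integral\<^sup>L (lebesgue_on {0<..<T}) (\<lambda>x. p x * interval_bump' s t k x)
        = - integral\<^sup>L (lebesgue_on {0<..<T}) (\<lambda>x. q x * box_bump s t k x)" for k
      using bspec[OF weak[unfolded weak_time_deriv_def] test[of k]] by (simp add: deriv)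
    moreover have "integral\<^sup>L (lebesgue_on {0<..<T}) (\<lambda>x. p x * interval_bump' s t k x)
        = integral {s..t} (\<lambda>x. p x * interval_bump' s t k x)" for k
    proof (rule lebesgue_integral_interval)
      show "continuous_on {s..t} (\<lambda>x. p x * interval_bump' s t k x)"
        using st by (intro continuous_intros interval_bump'_continuous continuous_on_subset[OF p]) auto
      show "p x * interval_bump' s t k x = 0" if "x \<notin> {s..t}" for x
        using that by (auto simp: interval_bump'_def bump_def mult_le_0_iff)
    qed (use st in auto)
    ultimately have "(\<lambda>k. - integral\<^sup>L (lebesgue_on {0<..<T}) (\<lambda>x. q x * box_bump s t k x)) \<longlonglongrightarrow> p s - p t"
      using tendsto_integral_interval_bump'[OF st(2) continuous_on_subset[OF p]] st by simp
    moreover have "(\<lambda>k. - integral\<^sup>L (lebesgue_on {0<..<T}) (\<lambda>x. q x * box_bump s t k x)) \<longlonglongrightarrow> - integral (cbox s t) q"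
      using st by (intro tendsto_minus integral_box_bump_tendsto[OF q]) auto
    ultimately have "p s - p t = - integral (cbox s t) q" by (rule LIMSEQ_unique)
    then show ?thesis by simp
  qed
  define F where "F x = p x - integral {0..x} q" for x
  have "F s = F t"
  proof (cases "0 < T")
    case True
    have cont: "continuous_on {0..T} F"
      unfolding F_def by (intro continuous_intros p indefinite_integral_continuous_1 qi)
    have const: "F x = F (T / 2)" if "x \<in> {0<..<T}" for x
    proof -
      have eq: "F x = F y" if "0 < x" "x < y" "y < T" for x y
      proof -
        have "integral {0..x} q + integral {x..y} q = integral {0..y} q"
          using that by (intro Henstock_Kurzweil_Integration.integral_combine
              integrable_on_subinterval[OF qi]) auto
        then show ?thesis using inner[OF that] by (simp add: F_def)
      qed
      consider "x < T / 2" | "x = T / 2" | "T / 2 < x" by linarith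
      then show ?thesis
      proof cases
        case 1
        show ?thesis by (rule eq) (use 1 that in auto)
      next
        case 3
        show ?thesis by (rule eq[symmetric]) (use 3 that True in auto)
      qed (simp only:)
    qed
    have "F x = F (T / 2)" if "x \<in> {0..T}" for x
    proof (rule continuous_constant_on_closure[of "{0<..<T}" F "F (T / 2)" x])
      show "continuous_on (closure {0<..<T}) F" using True cont by simp
      show "x \<in> closure {0<..<T}" using True that by simp
    qed (rule const)
    from this[of s] this[of t] st show ?thesis by simp
  next
    case False
    then have "s = t" using st by linarith
    then show ?thesis by simp
  qed
  moreover have "integral {0..s} q + integral {s..t} q = integral {0..t} q"
    using st by (intro Henstock_Kurzweil_Integration.integral_combine integrable_on_subinterval[OF qi]) auto
  ultimately have "integral {s..t} q = p t - p s" by (simp add: F_def)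
  moreover have "q integrable_on {s..t}"
    by (rule integrable_on_subinterval[OF qi]) (use st in auto)
  ultimately show ?thesis by (metis integrable_integral)
qed

section \<open>Square integrable functions and weak gradients\<close>

definition L2dot :: "'a::euclidean_space set \<Rightarrow> ('a \<Rightarrow> 'b::euclidean_space) \<Rightarrow> ('a \<Rightarrow> 'b) \<Rightarrow> real" where
  "L2dot \<Omega> f g = integral\<^sup>L (lebesgue_on \<Omega>) (\<lambda>x. f x \<bullet> g x)"

lemma L2inner_eq_L2dot: "L2inner \<Omega> = L2dot \<Omega>"
  by (simp add: L2inner_def L2dot_def fun_eq_iff)

lemma L2norm_eq_seminorm: "L2norm \<Omega> = seminorm_of (L2dot \<Omega>)"
  by (simp add: L2norm_def L2dot_def seminorm_of_def fun_eq_iff power2_norm_eq_inner)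

lemma integrable_L2_inner:
  fixes f g :: "'a::euclidean_space \<Rightarrow> 'b::euclidean_space"
  assumes "f \<in> L2 \<Omega>" "g \<in> L2 \<Omega>"
  shows "integrable (lebesgue_on \<Omega>) (\<lambda>x. f x \<bullet> g x)"
proof (rule Bochner_Integration.integrable_bound)
  show "integrable (lebesgue_on \<Omega>) (\<lambda>x. (norm (f x))\<^sup>2 + (norm (g x))\<^sup>2)"
    using assms by (auto simp: L2_def)
  show "(\<lambda>x. f x \<bullet> g x) \<in> borel_measurable (lebesgue_on \<Omega>)"
    using assms by (auto simp: L2_def)
  have "\<bar>f x \<bullet> g x\<bar> \<le> (norm (f x))\<^sup>2 + (norm (g x))\<^sup>2" for x
  proof -
    have "\<bar>f x \<bullet> g x\<bar> \<le> norm (f x) * norm (g x)" by (rule Cauchy_Schwarz_ineq2)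
    also have "\<dots> \<le> (norm (f x))\<^sup>2 + (norm (g x))\<^sup>2"
      using sum_squares_bound[of "norm (f x)" "norm (g x)"] zero_le_power2[of "norm (f x)"]
        zero_le_power2[of "norm (g x)"] by linarith
    finally show ?thesis .
  qed
  then show "AE x in lebesgue_on \<Omega>. norm (f x \<bullet> g x) \<le> norm ((norm (f x))\<^sup>2 + (norm (g x))\<^sup>2)"
    by (intro AE_I2) (force intro: order_trans)
qed

lemma subspace_L2: "subspace (L2 \<Omega> :: ('a::euclidean_space \<Rightarrow> 'b::euclidean_space) set)"
proof (rule subspaceI)
  show "(0 :: 'a \<Rightarrow> 'b) \<in> L2 \<Omega>" by (simp add: L2_def zero_fun_def)
  show "f + g \<in> L2 \<Omega>" if f: "f \<in> L2 \<Omega>" and g: "g \<in> L2 \<Omega>" for f g :: "'a \<Rightarrow> 'b"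
  proof -
    have m: "f \<in> borel_measurable (lebesgue_on \<Omega>)" "g \<in> borel_measurable (lebesgue_on \<Omega>)"
      using f g by (auto simp: L2_def)
    have "integrable (lebesgue_on \<Omega>) (\<lambda>x. f x \<bullet> f x + 2 * (f x \<bullet> g x) + g x \<bullet> g x)"
      by (intro Bochner_Integration.integrable_add integrable_mult_right integrable_L2_inner f g)
    also have "(\<lambda>x. f x \<bullet> f x + 2 * (f x \<bullet> g x) + g x \<bullet> g x) = (\<lambda>x. (norm ((f + g) x))\<^sup>2)"
      by (auto simp: power2_norm_eq_inner inner_add_left inner_add_right inner_commute)
    finally show ?thesis using m by (simp add: L2_def plus_fun_def)
  qed
  show "c *\<^sub>R f \<in> L2 \<Omega>" if "f \<in> L2 \<Omega>" for c and f :: "'a \<Rightarrow> 'b"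
    using that by (auto simp: L2_def power_mult_distrib scaleR_fun_def)
qed

lemma L2_measurable: "f \<in> L2 \<Omega> \<Longrightarrow> f \<in> borel_measurable (lebesgue_on \<Omega>)"
  by (simp add: L2_def)

lemma semi_inner_L2: "semi_inner (L2 \<Omega>) (L2dot \<Omega>)"
proof
  fix f g h :: "'a \<Rightarrow> 'b" and c
  show "L2dot \<Omega> f g = L2dot \<Omega> g f" by (simp add: L2dot_def inner_commute)
  show "0 \<le> L2dot \<Omega> f f" by (simp add: L2dot_def)
  assume f: "f \<in> L2 \<Omega>" and g: "g \<in> L2 \<Omega>"
  show "L2dot \<Omega> (c *\<^sub>R f) g = c * L2dot \<Omega> f g"
    by (simp add: L2dot_def)
  assume h: "h \<in> L2 \<Omega>"
  show "L2dot \<Omega> (f + g) h = L2dot \<Omega> f h + L2dot \<Omega> g h"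
    using f g h by (simp add: L2dot_def inner_add_left integrable_L2_inner)
qed (rule subspace_L2)

lemma L2norm_eq_0_imp_AE:
  fixes f :: "'a::euclidean_space \<Rightarrow> 'b::euclidean_space"
  assumes "f \<in> L2 \<Omega>" "L2norm \<Omega> f = 0"
  shows "AE x in lebesgue_on \<Omega>. f x = 0"
proof -
  have "integral\<^sup>L (lebesgue_on \<Omega>) (\<lambda>x. (norm (f x))\<^sup>2) = 0"
    using assms(2) by (simp add: L2norm_def)
  then have "AE x in lebesgue_on \<Omega>. (norm (f x))\<^sup>2 = 0"
    using assms(1) by (subst (asm) integral_nonneg_eq_0_iff_AE) (auto simp: L2_def)
  then show ?thesis by simp
qed

lemma L2dot_cong_AE:
  assumes "f \<in> L2 \<Omega>" "f' \<in> L2 \<Omega>" "g \<in> L2 \<Omega>" "AE x in lebesgue_on \<Omega>. f x = f' x"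
  shows "L2dot \<Omega> f g = L2dot \<Omega> f' g"
  unfolding L2dot_def
  by (rule integral_cong_AE)
     (use assms in \<open>auto simp: L2_def\<close>)

lemma L2norm_cong_AE:
  fixes f f' :: "'a::euclidean_space \<Rightarrow> 'b::euclidean_space"
  assumes "f \<in> L2 \<Omega>" "f' \<in> L2 \<Omega>" "AE x in lebesgue_on \<Omega>. f x = f' x"
  shows "L2norm \<Omega> f = L2norm \<Omega> f'"
  unfolding L2norm_def
  by (intro arg_cong[of _ _ sqrt] integral_cong_AE)
     (use assms in \<open>auto simp: L2_def\<close>)

text \<open>This is applied to \<open>F = grad \<Omega>\<close>, which is linear only up to null sets; so linearity is required
after insertion into the form.\<close>

lemma semi_inner_pullback:
  assumes "semi_inner X ip" and Y: "subspace Y" and F: "\<And>y. y \<in> Y \<Longrightarrow> F y \<in> X"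
    and add: "\<And>x y z. x \<in> Y \<Longrightarrow> y \<in> Y \<Longrightarrow> z \<in> X \<Longrightarrow> ip (F (x + y)) z = ip (F x + F y) z"
    and scale: "\<And>c x z. x \<in> Y \<Longrightarrow> z \<in> X \<Longrightarrow> ip (F (c *\<^sub>R x)) z = ip (c *\<^sub>R F x) z"
  shows "semi_inner Y (\<lambda>x y. ip (F x) (F y))"
proof -
  interpret semi_inner X ip by fact
  show ?thesis
    by standard (simp_all add: Y F add scale bilinear sym nonneg)
qed

lemma smooth_continuous: "smooth \<phi> \<Longrightarrow> continuous_on UNIV \<phi>"
  unfolding smooth_def by (metis Ck.simps(1))

lemma smooth_differentiable: "smooth \<phi> \<Longrightarrow> \<phi> differentiable (at x)"
  unfolding smooth_def by (metis Ck.simps(2))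

lemma smooth_partial_continuous:
  fixes \<phi> :: "real^'d \<Rightarrow> real"
  assumes "smooth \<phi>"
  shows "continuous_on UNIV (\<lambda>x. frechet_derivative \<phi> (at x) (axis i 1))"
proof -
  have "Ck (Suc 0) \<phi>" using assms unfolding smooth_def by blast
  then show ?thesis by (simp add: axis_in_Basis_iff)
qed

locale bounded_domain =
  fixes \<Omega> :: "(real^'d) set"
  assumes open_domain: "open \<Omega>" and bounded_domain: "bounded \<Omega>"
begin

lemma domain_lebesgue: "\<Omega> \<in> sets lebesgue"
  using open_domain by auto

lemma continuous_in_L2:
  fixes h :: "real^'d \<Rightarrow> 'b::euclidean_space"
  assumes h: "continuous_on UNIV h"
  shows "h \<in> L2 \<Omega>"
proof -
  have m: "h \<in> borel_measurable (lebesgue_on \<Omega>)"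
    by (intro measurable_restrict_space1 measurable_completion)
       (simp add: borel_measurable_continuous_onI[OF h])
  have "compact (h ` closure \<Omega>)"
    using bounded_domain by (intro compact_continuous_image continuous_on_subset[OF h]) auto
  then obtain B where "\<forall>y\<in>h ` closure \<Omega>. norm y \<le> B"
    using compact_imp_bounded bounded_pos by blast
  then have B: "norm (h x) \<le> B" if "x \<in> \<Omega>" for x
    using closure_subset[of \<Omega>] that by auto
  have "\<Omega> \<in> lmeasurable" using open_domain bounded_domain by (simp add: lmeasurable_open)
  then interpret finite_measure "lebesgue_on \<Omega>" by (rule finite_measure_lebesgue_on)
  have "integrable (lebesgue_on \<Omega>) (\<lambda>x. (norm (h x))\<^sup>2)"
    by (rule integrable_const_bound[of _ "B\<^sup>2"]) (use m B in \<open>auto intro!: AE_I2 power_mono\<close>)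
  then show ?thesis using m by (simp add: L2_def)
qed

lemma test_function_smooth: "\<phi> \<in> test_functions \<Omega> \<Longrightarrow> smooth \<phi>"
  by (simp add: test_functions_def)

text \<open>Written with \<open>L\<^sup>2\<close> products, the condition is linear in the pair \<open>(v, g)\<close>.\<close>

lemma has_weak_gradient_iff:
  "has_weak_gradient \<Omega> v g \<longleftrightarrow> v \<in> L2 \<Omega> \<and> g \<in> L2 \<Omega> \<and>
    (\<forall>\<phi>\<in>test_functions \<Omega>. \<forall>i. L2dot \<Omega> v (\<lambda>x. frechet_derivative \<phi> (at x) (axis i 1))
      = - L2dot \<Omega> g (\<lambda>x. \<phi> x *\<^sub>R axis i 1))"
  by (simp add: has_weak_gradient_def L2dot_def inner_axis mult.commute)

lemma partial_in_L2:
  "\<phi> \<in> test_functions \<Omega> \<Longrightarrow> (\<lambda>x. frechet_derivative \<phi> (at x) (axis i 1)) \<in> L2 \<Omega>"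
  by (intro continuous_in_L2 smooth_partial_continuous test_function_smooth)

lemma test_axis_in_L2: "\<phi> \<in> test_functions \<Omega> \<Longrightarrow> (\<lambda>x. \<phi> x *\<^sub>R axis i (1::real)) \<in> L2 \<Omega>"
  by (intro continuous_in_L2 continuous_intros smooth_continuous test_function_smooth)

sublocale L2s: semi_inner "L2 \<Omega> :: (real^'d \<Rightarrow> real) set" "L2dot \<Omega>"
  by (rule semi_inner_L2)

sublocale L2v: semi_inner "L2 \<Omega> :: (real^'d \<Rightarrow> real^'d) set" "L2dot \<Omega>"
  by (rule semi_inner_L2)

text \<open>The function \<open>grad \<Omega> v\<close> is a choice among all weak gradients of \<open>v\<close>; uniqueness makes it linear almost everywhere.\<close>

lemma weak_gradient_unique:
  assumes g: "has_weak_gradient \<Omega> v g" and g': "has_weak_gradient \<Omega> v g'"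
  shows "AE x in lebesgue_on \<Omega>. g x = g' x"
proof -
  have L: "g \<in> L2 \<Omega>" "g' \<in> L2 \<Omega>" using g g' by (auto simp: has_weak_gradient_iff)
  have "AE x in lebesgue_on \<Omega>. (g - g') x $ i = 0" for i
  proof (rule fundamental_lemma[OF open_domain])
    have "(\<lambda>x. axis i (1::real)) \<in> L2 \<Omega>" by (intro continuous_in_L2 continuous_intros)
    from integrable_L2_inner[OF L2v.closed(4)[OF L] this]
    show "integrable (lebesgue_on \<Omega>) (\<lambda>x. (g - g') x $ i)" by (simp add: inner_axis)
  next
    fix \<phi> assume \<phi>: "\<phi> \<in> test_functions \<Omega>"
    have "L2dot \<Omega> (g - g') (\<lambda>x. \<phi> x *\<^sub>R axis i 1) = 0"
      using g g' \<phi> L2v.bilinear(5)[OF L test_axis_in_L2[OF \<phi>]]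
      by (simp add: has_weak_gradient_iff)
    then show "integral\<^sup>L (lebesgue_on \<Omega>) (\<lambda>x. (g - g') x $ i * \<phi> x) = 0"
      by (simp add: L2dot_def inner_axis mult.commute)
  qed
  then have "AE x in lebesgue_on \<Omega>. \<forall>i\<in>UNIV. (g - g') x $ i = 0"
    by (intro AE_finite_allI) auto
  then show ?thesis
    by eventually_elim (simp add: vec_eq_iff)
qed

lemma has_weak_gradient_add:
  assumes "has_weak_gradient \<Omega> v g" "has_weak_gradient \<Omega> w h"
  shows "has_weak_gradient \<Omega> (v + w) (g + h)"
  using assms
  by (auto simp: has_weak_gradient_iff L2s.bilinear L2v.bilinear partial_in_L2 test_axis_in_L2)

lemma has_weak_gradient_scale:
  assumes "has_weak_gradient \<Omega> v g"
  shows "has_weak_gradient \<Omega> (c *\<^sub>R v) (c *\<^sub>R g)"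
  using assms
  by (auto simp: has_weak_gradient_iff L2s.bilinear L2v.bilinear partial_in_L2 test_axis_in_L2)

lemma has_weak_gradient_grad: "v \<in> H1 \<Omega> \<Longrightarrow> has_weak_gradient \<Omega> v (grad \<Omega> v)"
  unfolding grad_def H1_def by (simp add: someI_ex)

lemma H1_in_L2: "v \<in> H1 \<Omega> \<Longrightarrow> v \<in> L2 \<Omega>"
  by (auto simp: H1_def has_weak_gradient_def)

lemma grad_in_L2: "v \<in> H1 \<Omega> \<Longrightarrow> grad \<Omega> v \<in> L2 \<Omega>"
  using has_weak_gradient_grad by (auto simp: has_weak_gradient_def)

lemma subspace_H1: "subspace (H1 \<Omega>)"
proof (rule subspaceI)
  have "has_weak_gradient \<Omega> 0 0" by (simp add: has_weak_gradient_iff partial_in_L2 test_axis_in_L2)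
  then show "0 \<in> H1 \<Omega>" by (auto simp: H1_def)
qed (use has_weak_gradient_add has_weak_gradient_scale in \<open>unfold H1_def, blast+\<close>)

text \<open>Functions that agree almost everywhere have the same weak gradients, so the choice operator picks the
same one: the gradients are equal at every point.\<close>

lemma grad_cong_AE:
  assumes "v \<in> H1 \<Omega>" "w \<in> L2 \<Omega>" "AE x in lebesgue_on \<Omega>. v x = w x"
  shows "w \<in> H1 \<Omega>" and "grad \<Omega> w = grad \<Omega> v"
proof -
  have "has_weak_gradient \<Omega> w g = has_weak_gradient \<Omega> v g" for g
    using assms L2dot_cong_AE[OF H1_in_L2[OF assms(1)] assms(2) partial_in_L2 assms(3)]
    by (auto simp: has_weak_gradient_iff H1_in_L2)
  then have "has_weak_gradient \<Omega> w = has_weak_gradient \<Omega> v" by blast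
  then show "w \<in> H1 \<Omega>" "grad \<Omega> w = grad \<Omega> v"
    using assms(1) by (auto simp: H1_def grad_def)
qed

lemma grad_add: "v \<in> H1 \<Omega> \<Longrightarrow> w \<in> H1 \<Omega> \<Longrightarrow> AE x in lebesgue_on \<Omega>. grad \<Omega> (v + w) x = (grad \<Omega> v + grad \<Omega> w) x"
  using subspace_add[OF subspace_H1]
  by (intro weak_gradient_unique[OF has_weak_gradient_grad has_weak_gradient_add] has_weak_gradient_grad)

lemma grad_scale: "v \<in> H1 \<Omega> \<Longrightarrow> AE x in lebesgue_on \<Omega>. grad \<Omega> (c *\<^sub>R v) x = (c *\<^sub>R grad \<Omega> v) x"
  using subspace_scale[OF subspace_H1]
  by (intro weak_gradient_unique[OF has_weak_gradient_grad has_weak_gradient_scale] has_weak_gradient_grad)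

lemma semi_inner_grad:
  assumes ip: "semi_inner (L2 \<Omega>) ip"
    and cong: "\<And>f f' g. f \<in> L2 \<Omega> \<Longrightarrow> f' \<in> L2 \<Omega> \<Longrightarrow> g \<in> L2 \<Omega> \<Longrightarrow>
      AE x in lebesgue_on \<Omega>. f x = f' x \<Longrightarrow> ip f g = ip f' g"
  shows "semi_inner (H1 \<Omega>) (\<lambda>u v. ip (grad \<Omega> u) (grad \<Omega> v))"
proof -
  interpret H: semi_inner "L2 \<Omega>" ip by fact
  show ?thesis
  proof (rule semi_inner_pullback[OF ip subspace_H1 grad_in_L2])
    show "ip (grad \<Omega> (x + y)) z = ip (grad \<Omega> x + grad \<Omega> y) z" if "x \<in> H1 \<Omega>" "y \<in> H1 \<Omega>" "z \<in> L2 \<Omega>" for x y z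
      using that by (intro cong grad_add H.closed grad_in_L2 subspace_add[OF subspace_H1])
    show "ip (grad \<Omega> (c *\<^sub>R x)) z = ip (c *\<^sub>R grad \<Omega> x) z" if "x \<in> H1 \<Omega>" "z \<in> L2 \<Omega>" for c x z
      using that by (intro cong grad_scale H.closed grad_in_L2 subspace_scale[OF subspace_H1])
  qed
qed

definition Dirichlet where "Dirichlet u v = L2dot \<Omega> (grad \<Omega> u) (grad \<Omega> v)"

sublocale D: semi_inner "H1 \<Omega>" Dirichlet
  unfolding Dirichlet_def[abs_def] by (rule semi_inner_grad[OF semi_inner_L2 L2dot_cong_AE])

lemma L2norm_grad: "L2norm \<Omega> (grad \<Omega> v) = seminorm_of Dirichlet v"
  by (simp add: L2norm_eq_seminorm seminorm_of_def Dirichlet_def)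

end

section \<open>Smooth functions, traces and the energy form\<close>

text \<open>By translation invariance the difference quotients of \<open>F\<close> in the direction \<open>e\<close> have integral zero. By
the mean value theorem they are bounded, uniformly in the step, and for steps at most one they vanish
outside a fixed ball, so dominated convergence applies.\<close>

lemma integral_partial_compact_support:
  fixes F G :: "'a::euclidean_space \<Rightarrow> real"
  assumes K: "compact K" "\<And>x. x \<notin> K \<Longrightarrow> F x = 0"
    and F: "\<And>x. F differentiable (at x)"
    and G: "continuous_on UNIV G" "\<And>x. G x = frechet_derivative F (at x) e"
  shows "integral\<^sup>L lborel G = 0"
proof -
  define c :: "nat \<Rightarrow> real" where "c n = inverse (real (Suc n))" for n
  have c: "0 < c n" "c n \<le> 1" for n by (auto simp: c_def inverse_le_1_iff)
  define D where "D n x = (F (x + c n *\<^sub>R e) - F x) / c n" for n x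
  have contF: "continuous_on UNIV F"
    using F by (simp add: continuous_at_imp_continuous_on differentiable_imp_continuous_within)
  have Fm: "F \<in> borel_measurable borel" by (rule borel_measurable_continuous_onI[OF contF])
  have intF: "integrable lborel F"
  proof -
    have "integrable lborel (\<lambda>x. indicator K x *\<^sub>R F x)"
      by (intro borel_integrable_compact K continuous_on_subset[OF contF]) auto
    also have "(\<lambda>x. indicator K x *\<^sub>R F x) = F"
      using K(2) by (auto simp: fun_eq_iff indicator_def)
    finally show ?thesis .
  qed
  have shift: "integrable lborel (\<lambda>x. F (x + v))" "integral\<^sup>L lborel (\<lambda>x. F (x + v)) = integral\<^sup>L lborel F" for v
  proof -
    have "integrable (distr lborel borel ((+) v)) F" using intF by (simp add: lborel_distr_plus)
    then have "integrable lborel (\<lambda>x. F (v + x))" by (subst (asm) integrable_distr_eq) (auto simp: Fm)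
    then show "integrable lborel (\<lambda>x. F (x + v))" by (simp add: add.commute)
    have "integral\<^sup>L (distr lborel borel ((+) v)) F = integral\<^sup>L lborel (\<lambda>x. F (v + x))"
      by (rule integral_distr) (auto simp: Fm)
    then show "integral\<^sup>L lborel (\<lambda>x. F (x + v)) = integral\<^sup>L lborel F"
      by (simp add: lborel_distr_plus add.commute)
  qed
  have D0: "integral\<^sup>L lborel (D n) = 0" for n
    unfolding D_def using intF shift[of "c n *\<^sub>R e"] by simp
  have line: "((\<lambda>t. F (x + t *\<^sub>R e)) has_real_derivative G (x + t *\<^sub>R e)) (at t)" for x t
  proof -
    have "(F has_derivative frechet_derivative F (at (x + t *\<^sub>R e))) (at (x + t *\<^sub>R e))"
      using F by (simp add: frechet_derivative_works)
    moreover have "((\<lambda>t. x + t *\<^sub>R e) has_derivative (\<lambda>h. h *\<^sub>R e)) (at t)"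
      by (auto intro!: derivative_eq_intros)
    ultimately have "((\<lambda>t. F (x + t *\<^sub>R e)) has_derivative
        (\<lambda>h. frechet_derivative F (at (x + t *\<^sub>R e)) (h *\<^sub>R e))) (at t)"
      by (rule has_derivative_compose[rotated])
    moreover have "frechet_derivative F (at y) (h *\<^sub>R e) = G y * h" for y h
    proof -
      have "linear (frechet_derivative F (at y))" using F by (rule linear_frechet_derivative)
      then show ?thesis by (simp add: linear_scale G(2))
    qed
    ultimately show ?thesis by (simp add: has_field_derivative_def)
  qed
  have Dlim: "(\<lambda>n. D n x) \<longlonglongrightarrow> G x" for x
  proof -
    have "((\<lambda>h. (F (x + (0 + h) *\<^sub>R e) - F (x + 0 *\<^sub>R e)) / h) \<longlongrightarrow> G (x + 0 *\<^sub>R e)) (at 0)"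
      using line[of x 0] unfolding DERIV_def .
    moreover have "filterlim c (at 0) sequentially"
      unfolding filterlim_at c_def using LIMSEQ_inverse_real_of_nat by (auto intro!: always_eventually)
    ultimately have "(\<lambda>n. (F (x + (0 + c n) *\<^sub>R e) - F (x + 0 *\<^sub>R e)) / c n) \<longlonglongrightarrow> G (x + 0 *\<^sub>R e)"
      by (rule filterlim_compose)
    then show ?thesis by (simp add: D_def)
  qed
  obtain R where "\<forall>x\<in>K. norm x \<le> R"
    using compact_imp_bounded[OF K(1)] bounded_pos by blast
  then have R: "norm x \<le> R" if "x \<in> K" for x using that by auto
  have "compact (G ` cball 0 (R + 2 * norm e))"
    by (intro compact_continuous_image continuous_on_subset[OF G(1)]) auto
  then obtain B where "\<forall>y\<in>G ` cball 0 (R + 2 * norm e). norm y \<le> B"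
    using compact_imp_bounded bounded_pos by blast
  then have B: "\<bar>G x\<bar> \<le> B" if "norm x \<le> R + 2 * norm e" for x using that by auto
  let ?S = "cball (0::'a) (R + norm e)"
  have bound: "norm (D n x) \<le> indicator ?S x *\<^sub>R B" for n x
  proof (cases "x \<in> ?S")
    case True
    obtain t where t: "0 < t" "t < c n" "F (x + c n *\<^sub>R e) - F (x + 0 *\<^sub>R e) = (c n - 0) * G (x + t *\<^sub>R e)"
      using MVT2[of 0 "c n" "\<lambda>t. F (x + t *\<^sub>R e)" "\<lambda>t. G (x + t *\<^sub>R e)"] line c by blast
    have "norm (x + t *\<^sub>R e) \<le> norm x + t * norm e" using t norm_triangle_ineq[of x "t *\<^sub>R e"] by simp
    also have "\<dots> \<le> (R + norm e) + 1 * norm e"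
      using True t c[of n] by (intro add_mono mult_right_mono) auto
    finally have "\<bar>G (x + t *\<^sub>R e)\<bar> \<le> B" by (intro B) simp
    then show ?thesis using t True c[of n] by (simp add: D_def)
  next
    case False
    have "c n * norm e \<le> 1 * norm e" using c by (intro mult_right_mono) auto
    moreover have "R + norm e < norm x" using False by (simp add: not_le)
    moreover have "norm x \<le> norm (x + c n *\<^sub>R e) + c n * norm e"
      using norm_triangle_ineq4[of "x + c n *\<^sub>R e" "c n *\<^sub>R e"] c[of n] by simp
    ultimately have "R < norm (x + c n *\<^sub>R e)" "R < norm x"
      using norm_ge_zero[of e] by linarith+
    then have "F (x + c n *\<^sub>R e) = 0" "F x = 0" using R K(2) by (force simp: not_le[symmetric])+
    then show ?thesis using False by (simp add: D_def)
  qed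
  have "(\<lambda>n. integral\<^sup>L lborel (D n)) \<longlonglongrightarrow> integral\<^sup>L lborel G"
  proof (rule integral_dominated_convergence)
    show "G \<in> borel_measurable lborel" using borel_measurable_continuous_onI[OF G(1)] by simp
    show "D n \<in> borel_measurable lborel" for n
      unfolding D_def[abs_def] using shift(1)[of "c n *\<^sub>R e"] intF by (intro borel_measurable_divide borel_measurable_diff) auto
    show "integrable lborel (\<lambda>x. indicator ?S x *\<^sub>R B)" by (intro borel_integrable_compact) auto
  qed (use Dlim bound in auto)
  then show ?thesis by (simp add: D0 LIMSEQ_const_iff)
qed

lemma Ck_lincomb:
  fixes f g :: "'a::euclidean_space \<Rightarrow> real"
  shows "Ck k f \<Longrightarrow> Ck k g \<Longrightarrow> Ck k (\<lambda>x. a * f x + b * g x)"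
proof (induction k arbitrary: f g)
  case 0
  then show ?case by (auto intro!: continuous_intros)
next
  case (Suc k)
  have fd: "frechet_derivative (\<lambda>x. a * f x + b * g x) (at x) =
      (\<lambda>h. a * frechet_derivative f (at x) h + b * frechet_derivative g (at x) h)" for x
    using Suc.prems
    by (intro frechet_derivative_at[symmetric] has_derivative_add has_derivative_mult_right)
       (auto simp: frechet_derivative_works[symmetric])
  show ?case
    using Suc by (auto simp: fd intro!: derivative_intros)
qed

lemma smooth_lincomb:
  "smooth f \<Longrightarrow> smooth g \<Longrightarrow> smooth (a *\<^sub>R f + b *\<^sub>R g)"
  unfolding smooth_def using Ck_lincomb[of _ f g a b] by (simp add: plus_fun_def scaleR_fun_def)

context bounded_domain
begin

text \<open>Integration by parts: the partial derivative of \<open>\<phi> * \<psi>\<close> has integral zero.\<close>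

lemma smooth_has_weak_gradient:
  assumes \<phi>: "smooth \<phi>"
  shows "has_weak_gradient \<Omega> \<phi> (\<lambda>x. \<chi> i. frechet_derivative \<phi> (at x) (axis i 1))"
  unfolding has_weak_gradient_def
proof (intro conjI ballI allI)
  show "\<phi> \<in> L2 \<Omega>" by (intro continuous_in_L2 smooth_continuous \<phi>)
  show "(\<lambda>x. \<chi> i. frechet_derivative \<phi> (at x) (axis i 1)) \<in> L2 \<Omega>"
    by (intro continuous_in_L2 continuous_on_vec_lambda smooth_partial_continuous \<phi>)
  fix \<psi> and i :: 'd assume \<psi>: "\<psi> \<in> test_functions \<Omega>"
  then obtain K where K: "compact K" "K \<subseteq> \<Omega>" "\<And>x. x \<notin> K \<Longrightarrow> \<psi> x = 0"
    by (auto simp: test_functions_def)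
  let ?e = "axis i (1::real)"
  let ?d\<phi> = "\<lambda>x. frechet_derivative \<phi> (at x) ?e" and ?d\<psi> = "\<lambda>x. frechet_derivative \<psi> (at x) ?e"
  have s\<psi>: "smooth \<psi>" by (rule test_function_smooth[OF \<psi>])
  let ?G = "\<lambda>x. \<phi> x * ?d\<psi> x + ?d\<phi> x * \<psi> x"
  have contG: "continuous_on UNIV ?G"
    by (intro continuous_intros smooth_continuous smooth_partial_continuous \<phi> s\<psi>)
  have fd: "frechet_derivative (\<lambda>x. \<phi> x * \<psi> x) (at x) =
      (\<lambda>h. \<phi> x * frechet_derivative \<psi> (at x) h + frechet_derivative \<phi> (at x) h * \<psi> x)" for x
    using smooth_differentiable[OF \<phi>] smooth_differentiable[OF s\<psi>]
    by (intro frechet_derivative_at[symmetric] has_derivative_mult) (auto simp: frechet_derivative_works[symmetric])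
  have G0: "integral\<^sup>L lborel ?G = 0"
  proof (rule integral_partial_compact_support[OF K(1) _ _ contG, where F = "\<lambda>x. \<phi> x * \<psi> x" and e = ?e])
    show "(\<lambda>x. \<phi> x * \<psi> x) differentiable at x" for x
      using smooth_differentiable[OF \<phi>] smooth_differentiable[OF s\<psi>] by (intro differentiable_mult)
  qed (auto simp: K fd)
  have zero: "?G x = 0" if "x \<notin> K" for x
  proof -
    have "(\<psi> has_derivative (\<lambda>h. 0)) (at x)"
      by (rule has_derivative_transform_within_open[where s = "- K" and f = "\<lambda>x. 0"])
         (use that K compact_imp_closed in auto)
    then have "frechet_derivative \<psi> (at x) = (\<lambda>h. 0)" by (rule frechet_derivative_at[symmetric])
    then show ?thesis using K(3)[OF that] by simp
  qed
  have "integral\<^sup>L (lebesgue_on \<Omega>) ?G = integral\<^sup>L lebesgue (\<lambda>x. indicator \<Omega> x *\<^sub>R ?G x)"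
    by (rule integral_restrict_space) (simp add: domain_lebesgue)
  also have "(\<lambda>x. indicator \<Omega> x *\<^sub>R ?G x) = ?G"
    using zero K(2) by (auto simp: fun_eq_iff indicator_def)
  also have "integral\<^sup>L lebesgue ?G = integral\<^sup>L lborel ?G"
    by (rule integral_completion) (simp add: borel_measurable_continuous_onI[OF contG])
  finally have "integral\<^sup>L (lebesgue_on \<Omega>) ?G = 0" using G0 by simp
  moreover have "integrable (lebesgue_on \<Omega>) (\<lambda>x. \<phi> x * ?d\<psi> x)" "integrable (lebesgue_on \<Omega>) (\<lambda>x. ?d\<phi> x * \<psi> x)"
    using integrable_L2_inner[OF continuous_in_L2[OF smooth_continuous[OF \<phi>]] continuous_in_L2[OF smooth_partial_continuous[OF s\<psi>]]]
      integrable_L2_inner[OF continuous_in_L2[OF smooth_partial_continuous[OF \<phi>]] continuous_in_L2[OF smooth_continuous[OF s\<psi>]]]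
    by simp_all
  ultimately show "integral\<^sup>L (lebesgue_on \<Omega>) (\<lambda>x. \<phi> x * ?d\<psi> x) =
      - integral\<^sup>L (lebesgue_on \<Omega>) (\<lambda>x. (\<chi> i. frechet_derivative \<phi> (at x) (axis i 1)) $ i * \<psi> x)"
    by simp
qed

lemma smooth_in_H1: "smooth \<phi> \<Longrightarrow> \<phi> \<in> H1 \<Omega>"
  using smooth_has_weak_gradient by (auto simp: H1_def)

definition H1dot where "H1dot u v = L2dot \<Omega> u v + Dirichlet u v"

sublocale H: semi_inner "H1 \<Omega>" H1dot
proof
  fix x y assume x: "x \<in> H1 \<Omega>" and y: "y \<in> H1 \<Omega>"
  show "H1dot x y = H1dot y x"
    using x y by (simp add: H1dot_def L2s.sym[of x y] D.sym[of x y] H1_in_L2)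
qed (auto simp: H1dot_def H1_in_L2 D.subspace L2s.bilinear D.bilinear algebra_simps
      L2s.nonneg D.nonneg)

lemma H1norm_eq: "v \<in> H1 \<Omega> \<Longrightarrow> H1norm \<Omega> v = seminorm_of H1dot v"
  by (simp add: H1norm_def seminorm_of_def H1dot_def L2norm_eq_seminorm Dirichlet_def
      L2s.nrm_sq L2v.nrm_sq H1_in_L2 grad_in_L2)
     (simp add: L2v.nonneg grad_in_L2 L2s.nonneg H1_in_L2)

text \<open>Linear combinations of the approximating smooth functions approximate the linear combination in
\<open>H\<^sup>1\<close> by the triangle inequality and on the boundary by \<open>(p + q)\<^sup>2 \<le> 2 * p\<^sup>2 + 2 *
q\<^sup>2\<close>.\<close>

lemma has_trace_lincomb:
  assumes v: "has_trace \<Omega> v g" and w: "has_trace \<Omega> w h"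
  shows "has_trace \<Omega> (a *\<^sub>R v + b *\<^sub>R w) (\<lambda>x. a * g x + b * h x)"
proof -
  let ?M = "hausdorff_measure (CARD('d) - 1) :: (real^'d) measure"
  let ?I = "\<lambda>p q. (\<integral>\<^sup>+x. ennreal ((p x - q x)\<^sup>2) * indicator (frontier \<Omega>) x \<partial>?M)"
  have sM: "sets ?M = sets borel"
    by (simp add: hausdorff_measure_def sets_measure_of_conv) (metis sets.sigma_sets_eq space_borel)
  have vw: "v \<in> H1 \<Omega>" "w \<in> H1 \<Omega>" "g \<in> borel_measurable borel" "h \<in> borel_measurable borel"
    using v w by (auto simp: has_trace_def)
  obtain \<phi> where \<phi>: "\<And>k. smooth (\<phi> k)" "(\<lambda>k. H1norm \<Omega> (\<phi> k - v)) \<longlonglongrightarrow> 0" "(\<lambda>k. ?I (\<phi> k) g) \<longlonglongrightarrow> 0"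
    using v unfolding has_trace_def by auto
  obtain \<psi> where \<psi>: "\<And>k. smooth (\<psi> k)" "(\<lambda>k. H1norm \<Omega> (\<psi> k - w)) \<longlonglongrightarrow> 0" "(\<lambda>k. ?I (\<psi> k) h) \<longlonglongrightarrow> 0"
    using w unfolding has_trace_def by auto
  let ?\<chi> = "\<lambda>k. a *\<^sub>R \<phi> k + b *\<^sub>R \<psi> k"
  let ?u = "a *\<^sub>R v + b *\<^sub>R w"
  have "(\<lambda>k. H1norm \<Omega> (?\<chi> k - ?u)) \<longlonglongrightarrow> 0"
  proof (rule Lim_null_comparison[OF always_eventually])
    show "\<forall>k. norm (H1norm \<Omega> (?\<chi> k - ?u)) \<le> \<bar>a\<bar> * H1norm \<Omega> (\<phi> k - v) + \<bar>b\<bar> * H1norm \<Omega> (\<psi> k - w)"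
    proof
      fix k
      have mem: "\<phi> k \<in> H1 \<Omega>" "\<psi> k \<in> H1 \<Omega>" using \<phi> \<psi> smooth_in_H1 by auto
      have eq: "?\<chi> k - ?u = a *\<^sub>R (\<phi> k - v) + b *\<^sub>R (\<psi> k - w)"
        by (simp add: algebra_simps)
      have "norm (H1norm \<Omega> (?\<chi> k - ?u)) = seminorm_of H1dot (a *\<^sub>R (\<phi> k - v) + b *\<^sub>R (\<psi> k - w))"
        unfolding eq using mem vw by (simp add: H1norm_eq H.nrm_nonneg)
      also have "\<dots> \<le> seminorm_of H1dot (a *\<^sub>R (\<phi> k - v)) + seminorm_of H1dot (b *\<^sub>R (\<psi> k - w))"
        using mem vw by (intro H.nrm_triangle) auto
      also have "\<dots> = \<bar>a\<bar> * H1norm \<Omega> (\<phi> k - v) + \<bar>b\<bar> * H1norm \<Omega> (\<psi> k - w)"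
        using mem vw by (simp add: H1norm_eq H.nrm_scale)
      finally show "norm (H1norm \<Omega> (?\<chi> k - ?u)) \<le> \<bar>a\<bar> * H1norm \<Omega> (\<phi> k - v) + \<bar>b\<bar> * H1norm \<Omega> (\<psi> k - w)" .
    qed
    have "(\<lambda>k. \<bar>a\<bar> * H1norm \<Omega> (\<phi> k - v) + \<bar>b\<bar> * H1norm \<Omega> (\<psi> k - w)) \<longlonglongrightarrow> \<bar>a\<bar> * 0 + \<bar>b\<bar> * 0"
      by (intro tendsto_intros \<phi> \<psi>)
    then show "(\<lambda>k. \<bar>a\<bar> * H1norm \<Omega> (\<phi> k - v) + \<bar>b\<bar> * H1norm \<Omega> (\<psi> k - w)) \<longlonglongrightarrow> 0" by simp
  qed
  moreover have "(\<lambda>k. ?I (?\<chi> k) (\<lambda>x. a * g x + b * h x)) \<longlonglongrightarrow> 0"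
  proof (rule tendsto_sandwich[OF _ _ tendsto_const])
    let ?A = "ennreal (2 * a\<^sup>2)" and ?B = "ennreal (2 * b\<^sup>2)"
    show "\<forall>\<^sub>F k in sequentially. ?I (?\<chi> k) (\<lambda>x. a * g x + b * h x) \<le> ?A * ?I (\<phi> k) g + ?B * ?I (\<psi> k) h"
    proof (rule always_eventually, rule allI)
      fix k
      have m: "\<phi> k \<in> borel_measurable ?M" "\<psi> k \<in> borel_measurable ?M"
        "g \<in> borel_measurable ?M" "h \<in> borel_measurable ?M"
        using vw borel_measurable_continuous_onI[OF smooth_continuous] \<phi>(1) \<psi>(1)
        unfolding measurable_cong_sets[OF sM refl] by auto
      have ind: "(\<lambda>x. indicator (frontier \<Omega>) x :: ennreal) \<in> borel_measurable ?M"
        using sM by (intro borel_measurable_indicator) simp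
      have meas: "(\<lambda>x. ennreal ((\<phi> k x - g x)\<^sup>2) * indicator (frontier \<Omega>) x) \<in> borel_measurable ?M"
        "(\<lambda>x. ennreal ((\<psi> k x - h x)\<^sup>2) * indicator (frontier \<Omega>) x) \<in> borel_measurable ?M"
        using m ind by measurable
      have "?I (?\<chi> k) (\<lambda>x. a * g x + b * h x) \<le>
          (\<integral>\<^sup>+x. ?A * (ennreal ((\<phi> k x - g x)\<^sup>2) * indicator (frontier \<Omega>) x)
              + ?B * (ennreal ((\<psi> k x - h x)\<^sup>2) * indicator (frontier \<Omega>) x) \<partial>?M)"
      proof (rule nn_integral_mono)
        fix x
        have "(?\<chi> k x - (a * g x + b * h x))\<^sup>2 \<le> 2 * a\<^sup>2 * (\<phi> k x - g x)\<^sup>2 + 2 * b\<^sup>2 * (\<psi> k x - h x)\<^sup>2"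
        proof -
          have "(p + q)\<^sup>2 \<le> 2 * p\<^sup>2 + 2 * q\<^sup>2" for p q :: real
            using zero_le_power2[of "p - q"] by (simp add: power2_diff power2_sum)
          note this[of "a * (\<phi> k x - g x)" "b * (\<psi> k x - h x)"]
          moreover have "?\<chi> k x - (a * g x + b * h x) = a * (\<phi> k x - g x) + b * (\<psi> k x - h x)"
            by (simp add: algebra_simps)
          ultimately show ?thesis by (simp add: power_mult_distrib mult.assoc)
        qed
        then have "ennreal ((?\<chi> k x - (a * g x + b * h x))\<^sup>2)
            \<le> ennreal (2 * a\<^sup>2 * (\<phi> k x - g x)\<^sup>2 + 2 * b\<^sup>2 * (\<psi> k x - h x)\<^sup>2)"
          by (rule ennreal_leI)
        also have "\<dots> = ?A * ennreal ((\<phi> k x - g x)\<^sup>2) + ?B * ennreal ((\<psi> k x - h x)\<^sup>2)"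
          by (simp add: ennreal_mult ennreal_plus)
        finally show "ennreal ((?\<chi> k x - (a * g x + b * h x))\<^sup>2) * indicator (frontier \<Omega>) x
          \<le> ?A * (ennreal ((\<phi> k x - g x)\<^sup>2) * indicator (frontier \<Omega>) x)
              + ?B * (ennreal ((\<psi> k x - h x)\<^sup>2) * indicator (frontier \<Omega>) x)"
          by (simp add: indicator_def)
      qed
      also have "\<dots> = ?A * ?I (\<phi> k) g + ?B * ?I (\<psi> k) h"
        using meas by (subst nn_integral_add) (auto simp: nn_integral_cmult)
      finally show "?I (?\<chi> k) (\<lambda>x. a * g x + b * h x) \<le> ?A * ?I (\<phi> k) g + ?B * ?I (\<psi> k) h" .
    qed
    have "(\<lambda>k. ?A * ?I (\<phi> k) g + ?B * ?I (\<psi> k) h) \<longlonglongrightarrow> ?A * 0 + ?B * 0"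
      by (intro tendsto_add ennreal_tendsto_cmult \<phi> \<psi>) auto
    then show "(\<lambda>k. ?A * ?I (\<phi> k) g + ?B * ?I (\<psi> k) h) \<longlonglongrightarrow> 0" by simp
  qed simp
  moreover have "smooth (?\<chi> k)" for k
    using \<phi>(1) \<psi>(1) by (intro smooth_lincomb)
  moreover have "?u \<in> H1 \<Omega>" using vw by simp
  moreover have "(\<lambda>x. a * g x + b * h x) \<in> borel_measurable borel" using vw by simp
  ultimately show ?thesis unfolding has_trace_def by (intro conjI exI[of _ ?\<chi>]) auto
qed

lemma subspace_H1_Gamma: "subspace (H1_Gamma \<Omega> \<Gamma>)"
proof -
  have lin: "a *\<^sub>R v + b *\<^sub>R w \<in> H1_Gamma \<Omega> \<Gamma>" if v: "v \<in> H1_Gamma \<Omega> \<Gamma>" and w: "w \<in> H1_Gamma \<Omega> \<Gamma>" for a b v w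
  proof -
    obtain g where g: "has_trace \<Omega> v g" "AE x in hausdorff_measure (CARD('d) - 1). x \<in> \<Gamma> \<longrightarrow> g x = 0"
      using v by (auto simp: H1_Gamma_def)
    obtain h where h: "has_trace \<Omega> w h" "AE x in hausdorff_measure (CARD('d) - 1). x \<in> \<Gamma> \<longrightarrow> h x = 0"
      using w by (auto simp: H1_Gamma_def)
    have "AE x in hausdorff_measure (CARD('d) - 1). x \<in> \<Gamma> \<longrightarrow> a * g x + b * h x = 0"
      using g(2) h(2) by eventually_elim auto
    moreover have "has_trace \<Omega> (a *\<^sub>R v + b *\<^sub>R w) (\<lambda>x. a * g x + b * h x)"
      by (rule has_trace_lincomb[OF g(1) h(1)])
    moreover have "a *\<^sub>R v + b *\<^sub>R w \<in> H1 \<Omega>" using v w by (simp add: H1_Gamma_def)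
    ultimately show ?thesis by (auto simp: H1_Gamma_def)
  qed
  have "Ck k (\<lambda>x :: real^'d. 0 :: real)" for k by (induction k) auto
  then have "smooth (0 :: real^'d \<Rightarrow> real)" by (simp add: smooth_def zero_fun_def)
  moreover have "H1norm \<Omega> (0 - 0) = 0" by (simp add: H1norm_eq seminorm_of_def)
  ultimately have "has_trace \<Omega> 0 (\<lambda>x. 0)"
    unfolding has_trace_def by (intro conjI exI[of _ "\<lambda>k. 0"]) auto
  then have "0 \<in> H1_Gamma \<Omega> \<Gamma>" by (auto simp: H1_Gamma_def)
  then show ?thesis
    using lin[of _ _ 1 1] lin[of _ _ _ 0] by (intro subspaceI) auto
qed

lemma H1_Gamma_subset_H1: "H1_Gamma \<Omega> \<Gamma> \<subseteq> H1 \<Omega>"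
  by (auto simp: H1_Gamma_def)

end

locale energy_setting = bounded_domain \<Omega> for \<Omega> :: "(real^'d) set" +
  fixes A :: "real^'d \<Rightarrow> real^'d^'d" and \<alpha> \<beta> :: real
  assumes pos: "0 < \<alpha>" "\<alpha> \<le> \<beta>" and coeff: "admissible_coefficient \<Omega> \<alpha> \<beta> A"
begin

lemma integrable_coeff:
  assumes g: "g \<in> L2 \<Omega>" and h: "h \<in> L2 \<Omega>"
  shows "integrable (lebesgue_on \<Omega>) (\<lambda>x. (A x *v g x) \<bullet> h x)"
proof (rule Bochner_Integration.integrable_bound)
  let ?M = "lebesgue_on \<Omega>"
  have comp: "(\<lambda>x. f x $ i) \<in> borel_measurable ?M" if "f \<in> borel_measurable ?M" for f :: "real^'d \<Rightarrow> 'b::euclidean_space^'d" and i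
    by (rule measurable_compose[OF that borel_measurable_continuous_onI]) (intro continuous_intros)
  have A: "A \<in> borel_measurable ?M" using coeff by (simp add: admissible_coefficient_def)
  have "(\<lambda>x. \<Sum>i\<in>UNIV. (\<Sum>j\<in>UNIV. A x $ i $ j * g x $ j) * h x $ i) \<in> borel_measurable ?M"
    using comp[OF comp[OF A]] comp[OF L2_measurable[OF g]] comp[OF L2_measurable[OF h]]
    by (intro borel_measurable_sum borel_measurable_times)
  then show "(\<lambda>x. (A x *v g x) \<bullet> h x) \<in> borel_measurable ?M"
    by (simp add: inner_vec_def matrix_vector_mult_def)
  show "integrable ?M (\<lambda>x. \<beta> * ((norm (g x))\<^sup>2 + (norm (h x))\<^sup>2))"
    using g h by (auto simp: L2_def)
  have "AE x in ?M. \<forall>\<xi>. norm (A x *v \<xi>) \<le> \<beta> * norm \<xi>"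
    using coeff unfolding admissible_coefficient_def by (auto elim: eventually_mono)
  then show "AE x in ?M. norm ((A x *v g x) \<bullet> h x) \<le> norm (\<beta> * ((norm (g x))\<^sup>2 + (norm (h x))\<^sup>2))"
  proof eventually_elim
    case (elim x)
    have "\<bar>(A x *v g x) \<bullet> h x\<bar> \<le> norm (A x *v g x) * norm (h x)" by (rule Cauchy_Schwarz_ineq2)
    also have "\<dots> \<le> \<beta> * norm (g x) * norm (h x)" using elim by (intro mult_right_mono) auto
    also have "\<dots> = \<beta> * (norm (g x) * norm (h x))" by simp
    also have "\<dots> \<le> \<beta> * ((norm (g x))\<^sup>2 + (norm (h x))\<^sup>2)"
    proof (rule mult_left_mono)
      show "norm (g x) * norm (h x) \<le> (norm (g x))\<^sup>2 + (norm (h x))\<^sup>2"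
        using sum_squares_bound[of "norm (g x)" "norm (h x)"] zero_le_power2[of "norm (g x)"]
          zero_le_power2[of "norm (h x)"] by linarith
    qed (use pos in simp)
    finally show ?case by simp
  qed
qed

definition Adot where "Adot g h = integral\<^sup>L (lebesgue_on \<Omega>) (\<lambda>x. (A x *v g x) \<bullet> h x)"

lemma semi_inner_Adot: "semi_inner (L2 \<Omega>) Adot"
proof
  fix f g h :: "real^'d \<Rightarrow> real^'d" and c
  have sym: "AE x in lebesgue_on \<Omega>. transpose (A x) = A x"
    and ell: "AE x in lebesgue_on \<Omega>. \<forall>\<xi>. \<alpha> * (norm \<xi>)\<^sup>2 \<le> (A x *v \<xi>) \<bullet> \<xi>"
    using coeff unfolding admissible_coefficient_def by (auto elim: eventually_mono)
  assume f: "f \<in> L2 \<Omega>"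
  show "0 \<le> Adot f f"
    unfolding Adot_def
  proof (rule integral_nonneg_AE)
    show "AE x in lebesgue_on \<Omega>. 0 \<le> (A x *v f x) \<bullet> f x"
      using ell
    proof eventually_elim
      case (elim x)
      have "0 \<le> \<alpha> * (norm (f x))\<^sup>2" using pos by simp
      with elim show ?case using order_trans by blast
    qed
  qed
  assume g: "g \<in> L2 \<Omega>"
  show "Adot f g = Adot g f"
    unfolding Adot_def
  proof (rule integral_cong_AE)
    show "AE x in lebesgue_on \<Omega>. (A x *v f x) \<bullet> g x = (A x *v g x) \<bullet> f x"
      using sym
    proof eventually_elim
      case (elim x)
      then show ?case by (metis dot_lmul_matrix inner_commute transpose_matrix_vector)
    qed
  qed (use integrable_coeff f g in \<open>auto intro: borel_measurable_integrable\<close>)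
  show "Adot (c *\<^sub>R f) g = c * Adot f g"
    by (simp add: Adot_def matrix_vector_mult_scaleR)
  assume h: "h \<in> L2 \<Omega>"
  show "Adot (f + g) h = Adot f h + Adot g h"
    using f g h by (simp add: Adot_def matrix_vector_right_distrib inner_add_left integrable_coeff)
qed (rule subspace_L2)

lemma bilin_eq: "bilin \<Omega> A = (\<lambda>u v. Adot (grad \<Omega> u) (grad \<Omega> v))"
  by (simp add: bilin_def Adot_def fun_eq_iff)

sublocale B: semi_inner "H1 \<Omega>" "bilin \<Omega> A"
  unfolding bilin_eq
proof (rule semi_inner_grad[OF semi_inner_Adot])
  show "Adot f g = Adot f' g" if "f \<in> L2 \<Omega>" "f' \<in> L2 \<Omega>" "g \<in> L2 \<Omega>"
    "AE x in lebesgue_on \<Omega>. f x = f' x" for f f' g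
    unfolding Adot_def
    by (rule integral_cong_AE) (use that integrable_coeff in \<open>auto intro: borel_measurable_integrable\<close>)
qed

lemma bilin_lower:
  assumes "v \<in> H1 \<Omega>" shows "\<alpha> * Dirichlet v v \<le> bilin \<Omega> A v v"
  unfolding Dirichlet_def L2dot_def bilin_def Bochner_Integration.integral_mult_right_zero[symmetric]
proof (rule integral_mono_AE)
  show "AE x in lebesgue_on \<Omega>. \<alpha> * (grad \<Omega> v x \<bullet> grad \<Omega> v x) \<le> (A x *v grad \<Omega> v x) \<bullet> grad \<Omega> v x"
    using coeff unfolding admissible_coefficient_def power2_norm_eq_inner by (auto elim: eventually_mono)
qed (intro integrable_mult_right integrable_L2_inner integrable_coeff grad_in_L2 assms)+

lemma bilin_upper:
  assumes "v \<in> H1 \<Omega>" shows "bilin \<Omega> A v v \<le> \<beta> * Dirichlet v v"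
  unfolding Dirichlet_def L2dot_def bilin_def Bochner_Integration.integral_mult_right_zero[symmetric]
proof (rule integral_mono_AE)
  have "AE x in lebesgue_on \<Omega>. \<forall>\<xi>. norm (A x *v \<xi>) \<le> \<beta> * norm \<xi>"
    using coeff unfolding admissible_coefficient_def by (auto elim: eventually_mono)
  then show "AE x in lebesgue_on \<Omega>. (A x *v grad \<Omega> v x) \<bullet> grad \<Omega> v x \<le> \<beta> * (grad \<Omega> v x \<bullet> grad \<Omega> v x)"
  proof eventually_elim
    case (elim x)
    have "(A x *v grad \<Omega> v x) \<bullet> grad \<Omega> v x \<le> norm (A x *v grad \<Omega> v x) * norm (grad \<Omega> v x)"
      by (rule norm_cauchy_schwarz)
    also have "\<dots> \<le> \<beta> * norm (grad \<Omega> v x) * norm (grad \<Omega> v x)"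
      using elim by (intro mult_right_mono) auto
    finally show ?case by (simp add: power2_norm_eq_inner[symmetric] power2_eq_square)
  qed
qed (intro integrable_mult_right integrable_L2_inner integrable_coeff grad_in_L2 assms)+

end

section \<open>The multiscale space\<close>

lemma ae_eq_refl [simp]: "ae_eq \<Omega> f f"
  by (simp add: ae_eq_def)

lemma ae_eq_sym: "ae_eq \<Omega> f g \<Longrightarrow> ae_eq \<Omega> g f"
  by (auto simp: ae_eq_def elim: eventually_mono)

lemma ae_eq_trans [trans]:
  assumes "ae_eq \<Omega> f g" "ae_eq \<Omega> g h" shows "ae_eq \<Omega> f h"
  using assms unfolding ae_eq_def by eventually_elim simp

lemma ae_eq_lincomb:
  fixes f f' :: "'a::euclidean_space \<Rightarrow> real"
  assumes "ae_eq \<Omega> f f'" "ae_eq \<Omega> g g'"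
  shows "ae_eq \<Omega> (a *\<^sub>R f + b *\<^sub>R g) (a *\<^sub>R f' + b *\<^sub>R g')"
  using assms unfolding ae_eq_def by eventually_elim simp

lemma ae_eq_diff:
  fixes f f' :: "'a::euclidean_space \<Rightarrow> real"
  assumes "ae_eq \<Omega> f f'" "ae_eq \<Omega> g g'"
  shows "ae_eq \<Omega> (f - g) (f' - g')"
  using assms unfolding ae_eq_def by eventually_elim simp

lemma power2_le_of_le_mult:
  fixes x y c :: real
  assumes "0 \<le> x" "x \<le> c * y" shows "x\<^sup>2 \<le> c\<^sup>2 * y\<^sup>2"
  using power_mono[OF assms(2,1), of 2] by (simp add: power_mult_distrib)

lemma seminorm_le_of_sq_le:
  assumes "x * x \<le> x * y" "0 \<le> y" shows "x \<le> (y::real)"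
  using assms by (metis linorder_not_le mult_le_cancel_left order.trans)

locale multiscale = energy_setting \<Omega> A \<alpha> \<beta>
  for \<Omega> :: "(real^'d) set" and A :: "real^'d \<Rightarrow> real^'d^'d" and \<alpha> \<beta> :: real +
  fixes V VH W Vt :: "(real^'d \<Rightarrow> real) set" and H Cinv CI :: real
    and I C :: "(real^'d \<Rightarrow> real) \<Rightarrow> (real^'d \<Rightarrow> real)"
  assumes V: "subspace V" "V \<subseteq> H1 \<Omega>" and VH: "subspace VH" "VH \<subseteq> V" and H: "0 < H"
    and inverse: "inverse_inequality \<Omega> VH H Cinv"
    and interpolation: "quasi_interpolation \<Omega> V VH H CI I"
    and W: "W = fine_space \<Omega> V I"
    and corrector: "is_corrector \<Omega> A V W C"
    and Vt: "Vt = multiscale_space \<Omega> V VH C"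
begin

lemma V_L2: "v \<in> V \<Longrightarrow> v \<in> L2 \<Omega>"
  using V H1_in_L2 by auto

lemma V_H1: "v \<in> V \<Longrightarrow> v \<in> H1 \<Omega>"
  using V by auto

lemma V_closed: "v \<in> V \<Longrightarrow> w \<in> V \<Longrightarrow> a *\<^sub>R v + b *\<^sub>R w \<in> V" "v \<in> V \<Longrightarrow> w \<in> V \<Longrightarrow> v - w \<in> V" "0 \<in> V"
  using V(1) by (auto intro: subspace_add subspace_scale subspace_diff subspace_0)

lemma VH_V: "v \<in> VH \<Longrightarrow> v \<in> V"
  using VH by auto

lemma W_V: "w \<in> W \<Longrightarrow> w \<in> V"
  by (simp add: W fine_space_def)

lemma Vt_V: "w \<in> Vt \<Longrightarrow> w \<in> V"
  by (simp add: Vt multiscale_space_def)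

lemma ae_eq_iff_L2norm:
  fixes f g :: "real^'d \<Rightarrow> real"
  assumes "f \<in> L2 \<Omega>" "g \<in> L2 \<Omega>"
  shows "ae_eq \<Omega> f g \<longleftrightarrow> seminorm_of (L2dot \<Omega>) (f - g) = 0"
proof
  assume "ae_eq \<Omega> f g"
  then have "AE x in lebesgue_on \<Omega>. (f - g) x = 0 x" unfolding ae_eq_def by (auto elim: eventually_mono)
  then have "L2norm \<Omega> (f - g) = L2norm \<Omega> (0 :: real^'d \<Rightarrow> real)"
    using assms by (intro L2norm_cong_AE) auto
  then show "seminorm_of (L2dot \<Omega>) (f - g) = 0"
    by (simp add: L2norm_def zero_fun_def flip: L2norm_eq_seminorm)
next
  assume "seminorm_of (L2dot \<Omega>) (f - g) = 0"
  then have "L2norm \<Omega> (f - g) = 0" by (simp add: L2norm_eq_seminorm)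
  then have "AE x in lebesgue_on \<Omega>. (f - g) x = 0"
    by (rule L2norm_eq_0_imp_AE[OF L2s.closed(4)[OF assms]])
  then show "ae_eq \<Omega> f g" unfolding ae_eq_def by (auto elim: eventually_mono)
qed

lemma bilin_cong: "v \<in> V \<Longrightarrow> v' \<in> V \<Longrightarrow> ae_eq \<Omega> v v' \<Longrightarrow> bilin \<Omega> A v w = bilin \<Omega> A v' w"
  using grad_cong_AE(2)[of v v'] V_H1 V_L2 by (simp add: bilin_def ae_eq_def)

lemma L2seminorm_cong:
  "v \<in> L2 \<Omega> \<Longrightarrow> v' \<in> L2 \<Omega> \<Longrightarrow> ae_eq \<Omega> v v' \<Longrightarrow> seminorm_of (L2dot \<Omega>) v = seminorm_of (L2dot \<Omega>) v'"
  using L2norm_cong_AE[of v \<Omega> v'] by (simp add: L2norm_eq_seminorm ae_eq_def)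

lemma I_VH: "v \<in> L2 \<Omega> \<Longrightarrow> I v \<in> VH"
  and I_linear: "v \<in> L2 \<Omega> \<Longrightarrow> w \<in> L2 \<Omega> \<Longrightarrow> ae_eq \<Omega> (I (a *\<^sub>R v + b *\<^sub>R w)) (a *\<^sub>R I v + b *\<^sub>R I w)"
  and I_projection: "v \<in> VH \<Longrightarrow> ae_eq \<Omega> (I v) v"
  and I_bounded: "v \<in> L2 \<Omega> \<Longrightarrow> seminorm_of (L2dot \<Omega>) (I v) \<le> CI * seminorm_of (L2dot \<Omega>) v"
  using interpolation unfolding quasi_interpolation_def
  by (simp_all add: plus_fun_def scaleR_fun_def L2norm_eq_seminorm)

lemma I_V: "v \<in> L2 \<Omega> \<Longrightarrow> I v \<in> V"
  using I_VH VH_V by blast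

text \<open>The operator \<open>I\<close> acts on functions, not on classes; its linearity and \<open>L\<^sup>2\<close> bound make it respect
equality almost everywhere.\<close>

lemma I_cong:
  assumes v: "v \<in> L2 \<Omega>" and w: "w \<in> L2 \<Omega>" and eq: "ae_eq \<Omega> v w"
  shows "ae_eq \<Omega> (I v) (I w)"
proof -
  have "seminorm_of (L2dot \<Omega>) (I (v - w)) \<le> CI * seminorm_of (L2dot \<Omega>) (v - w)"
    using v w by (intro I_bounded) auto
  also have "\<dots> = 0" using eq v w by (simp add: ae_eq_iff_L2norm)
  finally have "seminorm_of (L2dot \<Omega>) (I (v - w) - 0) = 0"
    using L2s.nrm_nonneg[OF V_L2[OF I_V[of "v - w"]]] v w by simp
  then have "ae_eq \<Omega> (I (v - w)) 0"
    using V_L2[OF I_V] v w by (subst ae_eq_iff_L2norm) auto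
  moreover have "ae_eq \<Omega> (I (v - w)) (I v - I w)"
    using I_linear[OF v w, of 1 "-1"] by simp
  ultimately have "ae_eq \<Omega> (I v - I w) 0" using ae_eq_sym ae_eq_trans by blast
  then show ?thesis unfolding ae_eq_def by (auto elim: eventually_mono)
qed

lemma W_iff: "w \<in> W \<longleftrightarrow> w \<in> V \<and> ae_eq \<Omega> (I w) 0"
  by (simp add: W fine_space_def zero_fun_def)

lemma W_lincomb:
  assumes v: "v \<in> W" and w: "w \<in> W"
  shows "a *\<^sub>R v + b *\<^sub>R w \<in> W"
proof -
  have "ae_eq \<Omega> (I (a *\<^sub>R v + b *\<^sub>R w)) (a *\<^sub>R I v + b *\<^sub>R I w)"
    using v w by (intro I_linear V_L2 W_V)
  also have "ae_eq \<Omega> (a *\<^sub>R I v + b *\<^sub>R I w) (a *\<^sub>R 0 + b *\<^sub>R 0)"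
    using v w by (intro ae_eq_lincomb) (auto simp: W_iff)
  finally show ?thesis using v w V_closed by (simp add: W_iff)
qed

lemma W_diff: "v \<in> W \<Longrightarrow> w \<in> W \<Longrightarrow> v - w \<in> W"
  using W_lincomb[of v w 1 "-1"] by simp

text \<open>On the kernel of \<open>I\<close>, a function coincides with its interpolation error.\<close>

lemma W_L2_le:
  assumes w: "w \<in> W"
  shows "seminorm_of (L2dot \<Omega>) w \<le> H * \<bar>CI\<bar> * seminorm_of Dirichlet w"
proof -
  have wV: "w \<in> V" and Iw: "ae_eq \<Omega> (I w) 0" using w by (auto simp: W_iff)
  have mem: "w \<in> L2 \<Omega>" "I w \<in> L2 \<Omega>" "I w \<in> H1 \<Omega>" using wV V_L2 I_V V_H1 by auto
  have "seminorm_of (L2dot \<Omega>) (inverse H *\<^sub>R (w - I w)) + seminorm_of Dirichlet (I w) \<le> CI * seminorm_of Dirichlet w"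
    using interpolation wV unfolding quasi_interpolation_def
    by (simp add: L2norm_grad flip: L2norm_eq_seminorm) (simp add: scaleR_fun_def fun_diff_def L2norm_eq_seminorm)
  then have "seminorm_of (L2dot \<Omega>) (inverse H *\<^sub>R (w - I w)) \<le> CI * seminorm_of Dirichlet w"
    using D.nrm_nonneg[OF mem(3)] by linarith
  also have "\<dots> \<le> \<bar>CI\<bar> * seminorm_of Dirichlet w"
    using D.nrm_nonneg[OF V_H1[OF wV]] by (intro mult_right_mono) auto
  finally have "inverse H * seminorm_of (L2dot \<Omega>) (w - I w) \<le> \<bar>CI\<bar> * seminorm_of Dirichlet w"
    using H mem L2s.nrm_scale[of "w - I w" "inverse H"] by simp
  then have "seminorm_of (L2dot \<Omega>) (w - I w) \<le> H * (\<bar>CI\<bar> * seminorm_of Dirichlet w)"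
    using H by (simp add: field_simps)
  moreover have "seminorm_of (L2dot \<Omega>) (w - I w) = seminorm_of (L2dot \<Omega>) w"
  proof (rule L2seminorm_cong)
    show "ae_eq \<Omega> (w - I w) w" using ae_eq_diff[OF ae_eq_refl Iw, of w] by simp
  qed (use mem in auto)
  ultimately show ?thesis by (simp add: mult.assoc)
qed

lemma Dirichlet_le_bilin:
  assumes "v \<in> V" shows "sqrt \<alpha> * seminorm_of Dirichlet v \<le> seminorm_of (bilin \<Omega> A) v"
  using bilin_lower[OF V_H1[OF assms]] by (simp add: seminorm_of_def flip: real_sqrt_mult)

lemma bilin_le_Dirichlet:
  assumes "v \<in> V" shows "seminorm_of (bilin \<Omega> A) v \<le> sqrt \<beta> * seminorm_of Dirichlet v"
  using bilin_upper[OF V_H1[OF assms]] by (simp add: seminorm_of_def flip: real_sqrt_mult)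

lemma W_definite:
  assumes w: "w \<in> W" and zero: "bilin \<Omega> A w w = 0"
  shows "ae_eq \<Omega> w 0"
proof -
  have wV: "w \<in> V" using w W_V by auto
  have "sqrt \<alpha> * seminorm_of Dirichlet w \<le> 0"
    using Dirichlet_le_bilin[OF wV] zero by (simp add: seminorm_of_def)
  then have "seminorm_of Dirichlet w \<le> 0"
    using pos by (simp add: mult_le_0_iff)
  then have "H * \<bar>CI\<bar> * seminorm_of Dirichlet w \<le> 0"
    using H by (intro mult_nonneg_nonpos) auto
  then have "seminorm_of (L2dot \<Omega>) w = 0"
    using W_L2_le[OF w] L2s.nrm_nonneg[OF V_L2[OF wV]] by linarith
  then show ?thesis using V_L2[OF wV] by (subst ae_eq_iff_L2norm) auto
qed

lemma C_W: "v \<in> V \<Longrightarrow> C v \<in> W"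
  and C_eq: "v \<in> V \<Longrightarrow> w \<in> W \<Longrightarrow> bilin \<Omega> A (C v) w = bilin \<Omega> A v w"
  using corrector by (auto simp: is_corrector_def)

lemma C_V: "v \<in> V \<Longrightarrow> C v \<in> V"
  using C_W W_V by blast

text \<open>By \<open>W_definite\<close> the corrector is determined up to null sets by its defining equation. Hence
the choice \<open>C\<close> is linear almost everywhere and depends on its argument only up to null sets.\<close>

lemma C_unique:
  assumes v: "v \<in> V" and u: "u \<in> W" and eq: "\<And>w. w \<in> W \<Longrightarrow> bilin \<Omega> A u w = bilin \<Omega> A v w"
  shows "ae_eq \<Omega> (C v) u"
proof -
  have d: "C v - u \<in> W" using C_W[OF v] u by (rule W_diff)
  have mem: "C v \<in> H1 \<Omega>" "u \<in> H1 \<Omega>" "C v - u \<in> H1 \<Omega>"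
    using C_V[OF v] W_V[OF u] W_V[OF d] V_H1 by auto
  have "bilin \<Omega> A (C v - u) (C v - u) = 0"
    using C_eq[OF v d] eq[OF d] mem by (simp only: B.bilinear)
  then have "ae_eq \<Omega> (C v - u) 0" by (rule W_definite[OF d])
  then show ?thesis unfolding ae_eq_def by (auto elim: eventually_mono)
qed

lemma C_lincomb:
  assumes v: "v \<in> V" and w: "w \<in> V" and x: "x \<in> V" "ae_eq \<Omega> x (a *\<^sub>R v + b *\<^sub>R w)"
  shows "ae_eq \<Omega> (C x) (a *\<^sub>R C v + b *\<^sub>R C w)"
proof (rule C_unique[OF x(1)])
  show "a *\<^sub>R C v + b *\<^sub>R C w \<in> W" using v w by (intro W_lincomb C_W)
  fix z assume z: "z \<in> W"
  have mem: "v \<in> H1 \<Omega>" "w \<in> H1 \<Omega>" "C v \<in> H1 \<Omega>" "C w \<in> H1 \<Omega>" "z \<in> H1 \<Omega>"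
    using v w C_V z W_V V_H1 by auto
  have "bilin \<Omega> A (a *\<^sub>R C v + b *\<^sub>R C w) z = bilin \<Omega> A (a *\<^sub>R v + b *\<^sub>R w) z"
    using mem C_eq[OF v z] C_eq[OF w z] by (simp add: B.bilinear)
  also have "\<dots> = bilin \<Omega> A x z"
    using bilin_cong[OF x(1) V_closed(1)[OF v w] x(2)] by simp
  finally show "bilin \<Omega> A (a *\<^sub>R C v + b *\<^sub>R C w) z = bilin \<Omega> A x z" .
qed

lemma Vt_E:
  assumes "v \<in> Vt"
  obtains vH where "v \<in> V" "vH \<in> VH" "ae_eq \<Omega> v (vH - C vH)"
  using assms by (auto simp: Vt multiscale_space_def)

lemma Vt_I: "v \<in> V \<Longrightarrow> vH \<in> VH \<Longrightarrow> ae_eq \<Omega> v (vH - C vH) \<Longrightarrow> v \<in> Vt"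
  by (auto simp: Vt multiscale_space_def)

lemma Vt_lincomb:
  assumes v: "v \<in> Vt" and w: "w \<in> Vt"
  shows "a *\<^sub>R v + b *\<^sub>R w \<in> Vt"
proof -
  obtain vH where vH: "v \<in> V" "vH \<in> VH" "ae_eq \<Omega> v (vH - C vH)" using v by (rule Vt_E)
  obtain wH where wH: "w \<in> V" "wH \<in> VH" "ae_eq \<Omega> w (wH - C wH)" using w by (rule Vt_E)
  let ?x = "a *\<^sub>R vH + b *\<^sub>R wH"
  have x: "?x \<in> VH" using VH(1) vH wH by (auto intro: subspace_add subspace_scale)
  show ?thesis
  proof (rule Vt_I[OF _ x])
    show "a *\<^sub>R v + b *\<^sub>R w \<in> V" using vH wH by (intro V_closed)
    have "ae_eq \<Omega> (a *\<^sub>R v + b *\<^sub>R w) (a *\<^sub>R (vH - C vH) + b *\<^sub>R (wH - C wH))"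
      using vH wH by (intro ae_eq_lincomb)
    also have "a *\<^sub>R (vH - C vH) + b *\<^sub>R (wH - C wH) = ?x - (a *\<^sub>R C vH + b *\<^sub>R C wH)"
      by (simp add: algebra_simps)
    also have "ae_eq \<Omega> \<dots> (?x - C ?x)"
      using vH wH x by (intro ae_eq_diff ae_eq_refl ae_eq_sym[OF C_lincomb] VH_V) auto
    finally show "ae_eq \<Omega> (a *\<^sub>R v + b *\<^sub>R w) (?x - C ?x)" .
  qed
qed

lemma Vt_orthogonal:
  assumes v: "v \<in> Vt" and w: "w \<in> W"
  shows "bilin \<Omega> A v w = 0"
proof -
  obtain vH where vH: "v \<in> V" "vH \<in> VH" "ae_eq \<Omega> v (vH - C vH)" using v by (rule Vt_E)
  have mem: "vH \<in> V" "C vH \<in> V" "w \<in> V" using vH VH_V C_V w W_V by auto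
  have "bilin \<Omega> A v w = bilin \<Omega> A (vH - C vH) w"
    using vH mem by (intro bilin_cong V_closed)
  also have "\<dots> = 0" using mem C_eq[OF mem(1) w] V_H1 by (simp add: B.bilinear)
  finally show ?thesis .
qed

abbreviation "P \<equiv> ms_proj C I"

lemma P_V: "v \<in> L2 \<Omega> \<Longrightarrow> P v \<in> V"
  unfolding ms_proj_def by (intro V_closed I_V C_V)

lemma P_Vt: "v \<in> L2 \<Omega> \<Longrightarrow> P v \<in> Vt"
  by (rule Vt_I[OF P_V I_VH]) (auto simp: ms_proj_def)

lemma subspace_Vt: "subspace Vt"
proof (rule subspaceI)
  have "0 *\<^sub>R P 0 + 0 *\<^sub>R P 0 \<in> Vt" by (intro Vt_lincomb P_Vt) simp_all
  then show "0 \<in> Vt" by simp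
qed (use Vt_lincomb[of _ _ 1 1] Vt_lincomb[of _ _ _ 0] in auto)

lemma P_linear:
  assumes v: "v \<in> L2 \<Omega>" and w: "w \<in> L2 \<Omega>"
  shows "ae_eq \<Omega> (P (a *\<^sub>R v + b *\<^sub>R w)) (a *\<^sub>R P v + b *\<^sub>R P w)"
proof -
  have x: "I (a *\<^sub>R v + b *\<^sub>R w) \<in> V" using v w by (intro I_V) simp
  have "ae_eq \<Omega> (P (a *\<^sub>R v + b *\<^sub>R w)) ((a *\<^sub>R I v + b *\<^sub>R I w) - (a *\<^sub>R C (I v) + b *\<^sub>R C (I w)))"
    unfolding ms_proj_def using v w x by (intro ae_eq_diff I_linear C_lincomb I_V) auto
  also have "(a *\<^sub>R I v + b *\<^sub>R I w) - (a *\<^sub>R C (I v) + b *\<^sub>R C (I w)) = a *\<^sub>R P v + b *\<^sub>R P w"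
    by (simp add: ms_proj_def algebra_simps)
  finally show ?thesis .
qed

text \<open>Since \<open>I\<close> is a projection that annihilates correctors, \<open>I (P v)\<close> equals \<open>I v\<close> almost everywhere.\<close>

lemma diff_P_W:
  assumes v: "v \<in> V"
  shows "v - P v \<in> W"
proof -
  have vL: "v \<in> L2 \<Omega>" using v V_L2 by auto
  have IvV: "I v \<in> V" and IvH: "I v \<in> VH" using I_V[OF vL] I_VH[OF vL] by auto
  have L: "I v \<in> L2 \<Omega>" "C (I v) \<in> L2 \<Omega>" "P v \<in> L2 \<Omega>" using IvV C_V P_V[OF vL] V_L2 by auto
  have C0: "ae_eq \<Omega> (I (C (I v))) 0" using C_W[OF IvV] by (simp add: W_iff)
  have "ae_eq \<Omega> (I (P v)) (I (I v) - I (C (I v)))"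
    using I_linear[OF L(1,2), of 1 "-1"] by (simp add: ms_proj_def)
  also have "ae_eq \<Omega> (I (I v) - I (C (I v))) (I v - 0)"
    by (rule ae_eq_diff[OF I_projection[OF IvH] C0])
  finally have IP: "ae_eq \<Omega> (I (P v)) (I v)" by simp
  have "ae_eq \<Omega> (I (v - P v)) (I v - I (P v))"
    using I_linear[OF vL L(3), of 1 "-1"] by simp
  also have "ae_eq \<Omega> (I v - I (P v)) (I v - I v)"
    by (rule ae_eq_diff[OF ae_eq_refl IP])
  finally show ?thesis using v P_V[OF vL] V_closed by (simp add: W_iff)
qed

lemma bilin_P:
  assumes v: "v \<in> V" and w: "w \<in> Vt"
  shows "bilin \<Omega> A (P v) w = bilin \<Omega> A v w"
proof -
  have mem: "v \<in> H1 \<Omega>" "P v \<in> H1 \<Omega>" "w \<in> H1 \<Omega>" "v - P v \<in> H1 \<Omega>"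
    using v P_V V_L2 w Vt_V V_H1 W_V[OF diff_P_W[OF v]] by auto
  have "bilin \<Omega> A (v - P v) w = 0"
    using Vt_orthogonal[OF w diff_P_W[OF v]] B.sym[OF mem(4,3)] by simp
  then show ?thesis using mem by (simp add: B.bilinear)
qed

lemma VH_inverse:
  assumes v: "v \<in> VH"
  shows "seminorm_of Dirichlet v \<le> (Cinv * inverse H) * seminorm_of (L2dot \<Omega>) v"
  using inverse v unfolding inverse_inequality_def L2norm_grad by (simp add: L2norm_eq_seminorm)

text \<open>Let \<open>d = vH - C vH\<close>. As \<open>d\<close> is orthogonal to \<open>C vH\<close>, its energy is \<open>a vH d\<close>, so it is at most the energy
of \<open>vH\<close>. The inverse inequality bounds that by the \<open>L\<^sup>2\<close> norm of \<open>vH\<close>, and \<open>vH = I d\<close> is bounded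
by \<open>d\<close>.\<close>

lemma Vt_inverse:
  assumes d: "d \<in> Vt"
  shows "bilin \<Omega> A d d \<le> \<beta> * Cinv\<^sup>2 * CI\<^sup>2 * (inverse H)\<^sup>2 * L2dot \<Omega> d d"
proof -
  obtain vH where vH: "d \<in> V" "vH \<in> VH" "ae_eq \<Omega> d (vH - C vH)" using d by (rule Vt_E)
  have mem: "vH \<in> V" "C vH \<in> V" using vH VH_V C_V by auto
  have L: "d \<in> L2 \<Omega>" "vH \<in> L2 \<Omega>" "C vH \<in> L2 \<Omega>" "vH - C vH \<in> L2 \<Omega>" "I d \<in> L2 \<Omega>"
    using vH mem V_L2 I_V by auto
  have Hm: "d \<in> H1 \<Omega>" "vH \<in> H1 \<Omega>" "C vH \<in> H1 \<Omega>" "vH - C vH \<in> H1 \<Omega>" using vH mem V_H1 by auto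
  have "ae_eq \<Omega> (I d) (I (vH - C vH))" using L vH by (intro I_cong)
  also have "ae_eq \<Omega> \<dots> (I vH - I (C vH))" using I_linear[OF L(2,3), of 1 "-1"] by simp
  also have "ae_eq \<Omega> \<dots> (vH - 0)"
    using I_projection[OF vH(2)] C_W[OF mem(1)] by (intro ae_eq_diff) (auto simp: W_iff)
  finally have Id: "ae_eq \<Omega> (I d) vH" by simp
  have "bilin \<Omega> A d d = bilin \<Omega> A (vH - C vH) d"
    using vH mem by (intro bilin_cong V_closed)
  also have "\<dots> = bilin \<Omega> A vH d"
    using Vt_orthogonal[OF d C_W[OF mem(1)]] B.sym[OF Hm(1,3)] Hm by (simp add: B.bilinear)
  also have "\<dots> \<le> seminorm_of (bilin \<Omega> A) vH * seminorm_of (bilin \<Omega> A) d"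
    using B.Cauchy_Schwarz[OF Hm(2,1)] by simp
  finally have "seminorm_of (bilin \<Omega> A) d * seminorm_of (bilin \<Omega> A) d
      \<le> seminorm_of (bilin \<Omega> A) d * seminorm_of (bilin \<Omega> A) vH"
    using B.nrm_sq[OF Hm(1)] by (simp add: power2_eq_square mult.commute)
  then have "seminorm_of (bilin \<Omega> A) d \<le> seminorm_of (bilin \<Omega> A) vH"
    by (rule seminorm_le_of_sq_le) (rule B.nrm_nonneg[OF Hm(2)])
  then have "(seminorm_of (bilin \<Omega> A) d)\<^sup>2 \<le> (seminorm_of (bilin \<Omega> A) vH)\<^sup>2"
    using B.nrm_nonneg[OF Hm(1)] by (intro power_mono)
  then have "bilin \<Omega> A d d \<le> bilin \<Omega> A vH vH" using B.nrm_sq Hm by simp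
  also have "\<dots> \<le> \<beta> * Dirichlet vH vH" by (rule bilin_upper[OF Hm(2)])
  also have "\<dots> \<le> \<beta> * ((Cinv * inverse H)\<^sup>2 * (CI\<^sup>2 * L2dot \<Omega> d d))"
  proof (rule mult_left_mono)
    have "Dirichlet vH vH \<le> (Cinv * inverse H)\<^sup>2 * (seminorm_of (L2dot \<Omega>) vH)\<^sup>2"
      using power2_le_of_le_mult[OF D.nrm_nonneg[OF Hm(2)] VH_inverse[OF vH(2)]] D.nrm_sq[OF Hm(2)] by simp
    also have "seminorm_of (L2dot \<Omega>) vH = seminorm_of (L2dot \<Omega>) (I d)"
      using L2seminorm_cong[OF L(5,2) Id] by simp
    also have "(Cinv * inverse H)\<^sup>2 * (seminorm_of (L2dot \<Omega>) (I d))\<^sup>2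
        \<le> (Cinv * inverse H)\<^sup>2 * (CI\<^sup>2 * L2dot \<Omega> d d)"
      using power2_le_of_le_mult[OF L2s.nrm_nonneg[OF L(5)] I_bounded[OF L(1)]] L2s.nrm_sq[OF L(1)]
      by (intro mult_left_mono) auto
    finally show "Dirichlet vH vH \<le> (Cinv * inverse H)\<^sup>2 * (CI\<^sup>2 * L2dot \<Omega> d d)" .
  qed (use pos in simp)
  finally show ?thesis by (simp add: power_mult_distrib mult_ac)
qed

text \<open>The corrector of a finite element function is bounded in \<open>L\<^sup>2\<close> because it lies in \<open>W\<close>, where the
gradient controls the \<open>L\<^sup>2\<close> norm, because \<open>C\<close> does not increase the energy, and because of the
inverse inequality. The bound lets \<open>P\<close> commute with derivatives in time.\<close>

lemma P_bounded: "\<exists>K. \<forall>v\<in>L2 \<Omega>. seminorm_of (L2dot \<Omega>) (P v) \<le> K * seminorm_of (L2dot \<Omega>) v"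
proof -
  let ?N = "seminorm_of (L2dot \<Omega>)" and ?D = "seminorm_of Dirichlet" and ?B = "seminorm_of (bilin \<Omega> A)"
  define K1 where "K1 = H * \<bar>CI\<bar> * (sqrt \<beta> * (\<bar>Cinv\<bar> * inverse H) / sqrt \<alpha>)"
  have K1: "0 \<le> K1" using H pos by (simp add: K1_def)
  have CH: "?N (C v) \<le> K1 * ?N v" if v: "v \<in> VH" for v
  proof -
    have mem: "v \<in> V" "C v \<in> V" "C v \<in> W" using v VH_V C_V C_W by auto
    have Hm: "v \<in> H1 \<Omega>" "C v \<in> H1 \<Omega>" using mem V_H1 by auto
    have "bilin \<Omega> A (C v) (C v) = bilin \<Omega> A v (C v)" by (rule C_eq[OF mem(1,3)])
    also have "\<dots> \<le> ?B v * ?B (C v)" using B.Cauchy_Schwarz[OF Hm] by simp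
    finally have "?B (C v) * ?B (C v) \<le> ?B (C v) * ?B v"
      using B.nrm_sq[OF Hm(2)] by (simp add: power2_eq_square mult.commute)
    then have "?B (C v) \<le> ?B v"
      by (rule seminorm_le_of_sq_le) (rule B.nrm_nonneg[OF Hm(1)])
    also have "\<dots> \<le> sqrt \<beta> * ?D v" by (rule bilin_le_Dirichlet[OF mem(1)])
    also have "\<dots> \<le> sqrt \<beta> * ((\<bar>Cinv\<bar> * inverse H) * ?N v)"
    proof (rule mult_left_mono)
      have "?D v \<le> (Cinv * inverse H) * ?N v" by (rule VH_inverse[OF v])
      also have "\<dots> \<le> (\<bar>Cinv\<bar> * inverse H) * ?N v"
        using H L2s.nrm_nonneg[OF V_L2[OF mem(1)]] by (intro mult_right_mono) auto
      finally show "?D v \<le> (\<bar>Cinv\<bar> * inverse H) * ?N v" .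
    qed (use pos in simp)
    finally have "sqrt \<alpha> * ?D (C v) \<le> sqrt \<beta> * ((\<bar>Cinv\<bar> * inverse H) * ?N v)"
      using Dirichlet_le_bilin[OF mem(2)] by linarith
    then have "?D (C v) \<le> sqrt \<beta> * ((\<bar>Cinv\<bar> * inverse H) * ?N v) / sqrt \<alpha>"
      using pos by (simp only: pos_le_divide_eq real_sqrt_gt_zero mult.commute)
    then have "?D (C v) \<le> (sqrt \<beta> * (\<bar>Cinv\<bar> * inverse H) / sqrt \<alpha>) * ?N v"
      by (simp add: mult.assoc)
    then have "H * \<bar>CI\<bar> * ?D (C v) \<le> H * \<bar>CI\<bar> * ((sqrt \<beta> * (\<bar>Cinv\<bar> * inverse H) / sqrt \<alpha>) * ?N v)"
      using H by (intro mult_left_mono) auto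
    then show ?thesis using W_L2_le[OF mem(3)] by (simp add: K1_def mult.assoc)
  qed
  have "?N (P v) \<le> ((1 + K1) * CI) * ?N v" if v: "v \<in> L2 \<Omega>" for v
  proof -
    have "?N (P v) \<le> ?N (I v) + ?N (C (I v))"
      unfolding ms_proj_def using I_V[OF v] C_V V_L2 by (intro L2s.nrm_triangle_diff) auto
    also have "\<dots> \<le> (1 + K1) * ?N (I v)" using CH[OF I_VH[OF v]] by (simp add: algebra_simps)
    also have "\<dots> \<le> (1 + K1) * (CI * ?N v)" using K1 I_bounded[OF v] by (intro mult_left_mono) auto
    finally show ?thesis by (simp add: mult.assoc)
  qed
  then show ?thesis by blast
qed

end

section \<open>Time regularity\<close>

lemma AE_lebesgue_on_negligible:
  assumes "S \<in> sets lebesgue" "AE x in lebesgue_on S. Q x"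
  shows "negligible {x \<in> S. \<not> Q x}"
proof -
  have "AE x in lebesgue. x \<in> S \<longrightarrow> Q x"
    using assms by (simp add: AE_restrict_space_iff)
  then have "{x \<in> space lebesgue. \<not> (x \<in> S \<longrightarrow> Q x)} \<in> null_sets lebesgue"
    by (simp only: completion.AE_iff_null_sets)
  then show ?thesis by (simp add: negligible_iff_null_sets)
qed

text \<open>Completeness of the Lebesgue measure.\<close>

lemma borel_measurable_lebesgue_on_AE_eq:
  fixes f g :: "'a::euclidean_space \<Rightarrow> 'b::euclidean_space"
  assumes S: "S \<in> sets lebesgue" and f: "f \<in> borel_measurable (lebesgue_on S)"
    and eq: "AE x in lebesgue_on S. f x = g x"
  shows "g \<in> borel_measurable (lebesgue_on S)"
proof -
  have "f measurable_on S" using f S by (simp add: measurable_on_iff_borel_measurable)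
  then have "g measurable_on S"
    by (rule measurable_on_spike[OF _ AE_lebesgue_on_negligible[OF S eq]]) auto
  then show ?thesis using S by (simp add: measurable_on_iff_borel_measurable)
qed

lemma integrable_lebesgue_on_AE_eq:
  fixes f g :: "'a::euclidean_space \<Rightarrow> 'b::euclidean_space"
  assumes S: "S \<in> sets lebesgue" and f: "integrable (lebesgue_on S) f"
    and eq: "AE x in lebesgue_on S. f x = g x"
  shows "integrable (lebesgue_on S) g"
  using integrable_cong_AE_imp[OF f borel_measurable_lebesgue_on_AE_eq[OF S _ eq]] eq f by auto

lemma borel_measurable_lebesgue_on_AE_limit:
  fixes f :: "nat \<Rightarrow> 'a::euclidean_space \<Rightarrow> real"
  assumes S: "S \<in> sets lebesgue" and f: "\<And>k. f k \<in> borel_measurable (lebesgue_on S)"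
    and lim: "AE x in lebesgue_on S. (\<lambda>k. f k x) \<longlonglongrightarrow> g x"
  shows "g \<in> borel_measurable (lebesgue_on S)"
proof (rule borel_measurable_lebesgue_on_AE_eq[OF S])
  show "(\<lambda>x. lim (\<lambda>k. f k x)) \<in> borel_measurable (lebesgue_on S)"
    by (rule borel_measurable_lim_metric[OF f])
  show "AE x in lebesgue_on S. lim (\<lambda>k. f k x) = g x"
    using lim by (auto elim!: eventually_mono intro: limI)
qed

lemma continuous_integrable_open_interval:
  fixes q :: "real \<Rightarrow> real"
  assumes "continuous_on {0..T} q"
  shows "integrable (lebesgue_on {0<..<T}) q"
    and "integral\<^sup>L (lebesgue_on {0<..<T}) q = integral {0..T} q"
proof -
  have "q absolutely_integrable_on {0..T}"
    by (rule absolutely_integrable_continuous_real[OF assms])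
  then have "q absolutely_integrable_on {0<..<T}"
    by (rule set_integrable_subset) auto
  then show int: "integrable (lebesgue_on {0<..<T}) q"
    by (rule absolutely_integrable_imp_integrable) simp
  show "integral\<^sup>L (lebesgue_on {0<..<T}) q = integral {0..T} q"
    using lebesgue_integral_eq_integral[OF int] by (simp add: integral_open_interval_real)
qed

text \<open>One integration by parts moves a derivative from the test function to \<open>p\<close>; the boundary terms vanish
because the derivative of the test function is zero at both ends.\<close>

lemma weak_time_deriv_reduce:
  fixes p p' q :: "real \<Rightarrow> real"
  assumes der: "\<And>t. t \<in> {0..T} \<Longrightarrow> (p has_real_derivative p' t) (at t within {0..T})"
    and cont: "continuous_on {0..T} p'" and weak: "weak_time_deriv 2 T p q" and T: "0 \<le> T"
  shows "weak_time_deriv 1 T p' q"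
  unfolding weak_time_deriv_def
proof
  fix \<phi> assume \<phi>: "\<phi> \<in> test_functions {0<..<T}"
  then obtain K where K: "compact K" "K \<subseteq> {0<..<T}" "\<And>x. x \<notin> K \<Longrightarrow> \<phi> x = 0"
    by (auto simp: test_functions_def)
  have fd: "(h has_real_derivative frechet_derivative h (at x) 1) (at x)"
    if "h differentiable (at x)" for h :: "real \<Rightarrow> real" and x
  proof -
    have lin: "linear (frechet_derivative h (at x))" by (rule linear_frechet_derivative[OF that])
    have "frechet_derivative h (at x) y = frechet_derivative h (at x) 1 * y" for y
      using linear_scale[OF lin, of y 1] by simp
    then have eq: "frechet_derivative h (at x) = (*) (frechet_derivative h (at x) 1)" by (intro ext)
    have "(h has_derivative frechet_derivative h (at x)) (at x)"
      using that by (simp only: frechet_derivative_works)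
    then show ?thesis
      unfolding has_field_derivative_def by (rule has_derivative_eq_rhs) (rule eq)
  qed
  have "Ck (Suc (Suc 0)) \<phi>" using \<phi> by (auto simp: test_functions_def smooth_def)
  then have C: "\<And>x. \<phi> differentiable (at x)" "\<And>x. (\<lambda>x. frechet_derivative \<phi> (at x) 1) differentiable (at x)"
    "continuous_on UNIV (\<lambda>x. frechet_derivative (\<lambda>x. frechet_derivative \<phi> (at x) 1) (at x) 1)"
    by auto
  define \<phi>1 where "\<phi>1 x = frechet_derivative \<phi> (at x) 1" for x
  define \<phi>2 where "\<phi>2 x = frechet_derivative \<phi>1 (at x) 1" for x
  have d1: "(\<phi> has_real_derivative \<phi>1 x) (at x)" for x unfolding \<phi>1_def by (rule fd[OF C(1)])
  have d2: "(\<phi>1 has_real_derivative \<phi>2 x) (at x)" for x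
    unfolding \<phi>2_def by (rule fd) (use C(2) in \<open>simp add: \<phi>1_def[abs_def]\<close>)
  have c2: "continuous_on {0..T} \<phi>2"
    using C(3) unfolding \<phi>2_def[abs_def] \<phi>1_def[abs_def] by (rule continuous_on_subset) simp
  have c1: "continuous_on {0..T} \<phi>1" using d2 by (meson DERIV_isCont continuous_at_imp_continuous_on)
  have cp: "continuous_on {0..T} p"
    using der by (rule DERIV_continuous_on)
  have "deriv \<phi> = \<phi>1" "deriv \<phi>1 = \<phi>2" using d1 d2 by (auto intro!: ext DERIV_imp_deriv)
  then have dd: "(deriv ^^ 1) \<phi> = \<phi>1" "(deriv ^^ 2) \<phi> = \<phi>2" by (simp_all add: numeral_2_eq_2)
  have zero: "\<phi>1 x = 0" if "x \<notin> K" for x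
  proof -
    have "(\<phi> has_real_derivative 0) (at x)"
      by (rule has_field_derivative_transform_within_open[where S = "- K" and f = "\<lambda>x. 0"])
         (use that K compact_imp_closed in auto)
    then show ?thesis using d1[of x] by (rule DERIV_unique[symmetric])
  qed
  have "((\<lambda>x. p' x * \<phi>1 x + p x * \<phi>2 x) has_integral p T * \<phi>1 T - p 0 * \<phi>1 0) {0..T}"
  proof (rule fundamental_theorem_of_calculus[OF T])
    fix x assume x: "x \<in> {0..T}"
    have "((\<lambda>x. p x * \<phi>1 x) has_real_derivative p' x * \<phi>1 x + \<phi>2 x * p x) (at x within {0..T})"
      by (rule DERIV_mult[OF der[OF x] has_field_derivative_at_within[OF d2]])
    then show "((\<lambda>x. p x * \<phi>1 x) has_vector_derivative p' x * \<phi>1 x + p x * \<phi>2 x) (at x within {0..T})"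
      by (simp add: has_real_derivative_iff_has_vector_derivative mult.commute)
  qed
  moreover have "\<phi>1 0 = 0" "\<phi>1 T = 0" using K(2) by (auto intro!: zero)
  ultimately have "integral {0..T} (\<lambda>x. p' x * \<phi>1 x + p x * \<phi>2 x) = 0"
    by (simp add: integral_unique)
  moreover have "integral {0..T} (\<lambda>x. p' x * \<phi>1 x + p x * \<phi>2 x)
      = integral {0..T} (\<lambda>x. p' x * \<phi>1 x) + integral {0..T} (\<lambda>x. p x * \<phi>2 x)"
    by (intro Henstock_Kurzweil_Integration.integral_add integrable_continuous_real
        continuous_on_mult cont cp c1 c2)
  ultimately have "integral {0..T} (\<lambda>x. p' x * \<phi>1 x) = - integral {0..T} (\<lambda>x. p x * \<phi>2 x)" by simp
  also have "\<dots> = - integral\<^sup>L (lebesgue_on {0<..<T}) (\<lambda>x. p x * \<phi>2 x)"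
    by (subst continuous_integrable_open_interval(2)) (intro continuous_on_mult cp c2, simp)
  also have "\<dots> = - integral\<^sup>L (lebesgue_on {0<..<T}) (\<lambda>x. q x * \<phi> x)"
    using bspec[OF weak[unfolded weak_time_deriv_def] \<phi>] by (simp add: dd)
  finally show "integral\<^sup>L (lebesgue_on {0<..<T}) (\<lambda>t. p' t * (deriv ^^ 1) \<phi> t)
      = (-1) ^ 1 * integral\<^sup>L (lebesgue_on {0<..<T}) (\<lambda>t. q t * \<phi> t)"
    unfolding dd by (subst continuous_integrable_open_interval(2)) (intro continuous_on_mult cont c1, simp)
qed

context semi_inner
begin

lemma seminorm_deriv_diff:
  assumes X: "\<And>t. t \<in> S \<Longrightarrow> f t \<in> X" "\<And>t. t \<in> S \<Longrightarrow> f' t \<in> X" "\<And>t. t \<in> S \<Longrightarrow> g t \<in> X" "\<And>t. t \<in> S \<Longrightarrow> g' t \<in> X"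
    and f: "seminorm_deriv nrm S f f'" and g: "seminorm_deriv nrm S g g'"
  shows "seminorm_deriv nrm S (\<lambda>t. f t - g t) (\<lambda>t. f' t - g' t)"
  unfolding seminorm_deriv_def
proof
  fix t assume t: "t \<in> S"
  let ?q = "\<lambda>f f' s. (1 / (s - t)) *\<^sub>R (f s - f t) - f' t"
  have "((\<lambda>s. nrm (?q f f' s) + nrm (?q g g' s)) \<longlongrightarrow> 0 + 0) (at t within S)"
    using f g t by (intro tendsto_add) (auto simp: seminorm_deriv_def)
  then have lim: "((\<lambda>s. nrm (?q f f' s) + nrm (?q g g' s)) \<longlongrightarrow> 0) (at t within S)" by simp
  show "((\<lambda>s. nrm (?q (\<lambda>t. f t - g t) (\<lambda>t. f' t - g' t) s)) \<longlongrightarrow> 0) (at t within S)"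
  proof (rule null_comparison_within[OF lim])
    fix s assume s: "s \<in> S"
    have mem: "?q f f' s \<in> X" "?q g g' s \<in> X" using X s t by auto
    have eq: "?q (\<lambda>t. f t - g t) (\<lambda>t. f' t - g' t) s = ?q f f' s - ?q g g' s"
      by (simp add: algebra_simps)
    show "\<bar>nrm (?q (\<lambda>t. f t - g t) (\<lambda>t. f' t - g' t) s)\<bar> \<le> nrm (?q f f' s) + nrm (?q g g' s)"
      unfolding eq using nrm_triangle_diff[OF mem] nrm_nonneg[OF closed(4)[OF mem]] by simp
  qed
qed

lemma seminorm_cont_diff:
  assumes X: "\<And>t. t \<in> S \<Longrightarrow> f t \<in> X" "\<And>t. t \<in> S \<Longrightarrow> g t \<in> X"
    and f: "seminorm_cont nrm S f" and g: "seminorm_cont nrm S g"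
  shows "seminorm_cont nrm S (\<lambda>t. f t - g t)"
  unfolding seminorm_cont_def
proof
  fix t assume t: "t \<in> S"
  have "((\<lambda>s. nrm (f s - f t) + nrm (g s - g t)) \<longlongrightarrow> 0 + 0) (at t within S)"
    using f g t by (intro tendsto_add) (auto simp: seminorm_cont_def)
  then have lim: "((\<lambda>s. nrm (f s - f t) + nrm (g s - g t)) \<longlongrightarrow> 0) (at t within S)" by simp
  show "((\<lambda>s. nrm ((f s - g s) - (f t - g t))) \<longlongrightarrow> 0) (at t within S)"
  proof (rule null_comparison_within[OF lim])
    fix s assume s: "s \<in> S"
    have mem: "f s - f t \<in> X" "g s - g t \<in> X" using X s t by auto
    have eq: "(f s - g s) - (f t - g t) = (f s - f t) - (g s - g t)" by simp
    show "\<bar>nrm ((f s - g s) - (f t - g t))\<bar> \<le> nrm (f s - f t) + nrm (g s - g t)"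
      unfolding eq using nrm_triangle_diff[OF mem] nrm_nonneg[OF closed(4)[OF mem]] by simp
  qed
qed

text \<open>The mean value inequality, obtained by pairing the increment with itself.\<close>

lemma seminorm_increment_le:
  assumes X: "\<And>t. t \<in> S \<Longrightarrow> \<theta> t \<in> X" "\<And>t. t \<in> S \<Longrightarrow> \<theta>' t \<in> X"
    and der: "seminorm_deriv nrm S \<theta> \<theta>'" and st: "s \<le> t" "{s..t} \<subseteq> S"
    and bound: "\<And>r. r \<in> {s..t} \<Longrightarrow> nrm (\<theta>' r) \<le> e" and e: "0 \<le> e"
  shows "nrm (\<theta> t - \<theta> s) \<le> e * (t - s)"
proof -
  have mem: "\<theta> t \<in> X" "\<theta> s \<in> X" using X st by auto
  then have D: "\<theta> t - \<theta> s \<in> X" by simp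
  have "((\<lambda>r. ip (\<theta>' r) (\<theta> t - \<theta> s)) has_integral ip (\<theta> t) (\<theta> t - \<theta> s) - ip (\<theta> s) (\<theta> t - \<theta> s)) {s..t}"
  proof (rule fundamental_theorem_of_calculus[OF st(1)])
    fix r assume r: "r \<in> {s..t}"
    have "((\<lambda>r. ip (\<theta> r) (\<theta> t - \<theta> s)) has_real_derivative ip (\<theta>' r) (\<theta> t - \<theta> s)) (at r within S)"
      by (rule has_derivative_ip[OF X der _ D]) (use r st in auto)
    then show "((\<lambda>r. ip (\<theta> r) (\<theta> t - \<theta> s)) has_vector_derivative ip (\<theta>' r) (\<theta> t - \<theta> s)) (at r within {s..t})"
      using st(2) by (auto simp: has_real_derivative_iff_has_vector_derivative
          intro: has_vector_derivative_within_subset)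
  qed
  then have int: "((\<lambda>r. ip (\<theta>' r) (\<theta> t - \<theta> s)) has_integral ip (\<theta> t - \<theta> s) (\<theta> t - \<theta> s)) {s..t}"
    using bilinear(5)[OF mem D] by simp
  show ?thesis
  proof (rule nrm_increment_le[OF st(1) e D int])
    fix r assume r: "r \<in> {s..t}"
    then have "\<theta>' r \<in> X" using X st by auto
    then have "ip (\<theta>' r) (\<theta> t - \<theta> s) \<le> nrm (\<theta>' r) * nrm (\<theta> t - \<theta> s)"
      using Cauchy_Schwarz[OF _ D, of "\<theta>' r"] by simp
    also have "\<dots> \<le> e * nrm (\<theta> t - \<theta> s)"
      using bound[OF r] nrm_nonneg[OF D] by (intro mult_right_mono)
    finally show "ip (\<theta>' r) (\<theta> t - \<theta> s) \<le> e * nrm (\<theta> t - \<theta> s)" .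
  qed
qed

end

context bounded_domain
begin

lemma continuous_in_L2norm_iff: "continuous_in (L2norm \<Omega>) S g \<longleftrightarrow> seminorm_cont (seminorm_of (L2dot \<Omega>)) S g"
  by (simp add: continuous_in_def seminorm_cont_def L2norm_eq_seminorm)

text \<open>Pairing the approximating simple functions with \<open>w\<close> gives measurable scalar functions that converge almost everywhere.\<close>

lemma integrable_bochner_L2inner:
  fixes g :: "real \<Rightarrow> real^'d \<Rightarrow> real"
  assumes g: "bochner_Lp 1 T (L2 \<Omega>) (L2norm \<Omega>) g" and w: "w \<in> L2 \<Omega>"
  shows "integrable (lebesgue_on {0<..<T}) (\<lambda>t. L2dot \<Omega> (g t) w)"
proof -
  let ?M = "lebesgue_on {0<..<T}" and ?N = "seminorm_of (L2dot \<Omega>)"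
  have g': "bochner_measurable T (L2 \<Omega>) ?N g" "AE t in ?M. g t \<in> L2 \<Omega>" "integrable ?M (\<lambda>t. ?N (g t))"
    using g by (simp_all add: bochner_Lp_def L2norm_eq_seminorm)
  obtain s :: "nat \<Rightarrow> real \<Rightarrow> real^'d \<Rightarrow> real" where
    s: "\<And>k. finite (s k ` {0<..<T})" "\<And>k. s k ` {0<..<T} \<subseteq> L2 \<Omega>"
      "\<And>k y. {t \<in> {0<..<T}. s k t = y} \<in> sets lebesgue"
    and lim: "AE t in ?M. (\<lambda>k. ?N (s k t - g t)) \<longlonglongrightarrow> 0"
    using g'(1) unfolding bochner_measurable_def by blast
  have meas: "(\<lambda>t. L2dot \<Omega> (s k t) w) \<in> borel_measurable ?M" for k
  proof -
    have "s k -` {y} \<inter> {0<..<T} \<in> sets ?M" for y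
    proof -
      have eq: "s k -` {y} \<inter> {0<..<T} = {t \<in> {0<..<T}. s k t = y}" by blast
      have "{t \<in> {0<..<T}. s k t = y} \<subseteq> {0<..<T}" by blast
      then show ?thesis
        unfolding eq using s(3)[of k y] by (intro sets_restrict_space_iff[THEN iffD2]) simp_all
    qed
    then have "simple_function ?M (s k)"
      unfolding simple_function_def space_lebesgue_on using s(1) by blast
    then show ?thesis
      by (rule borel_measurable_simple_function[OF simple_function_compose1[where g = "\<lambda>h. L2dot \<Omega> h w"]])
  qed
  have bound: "\<bar>L2dot \<Omega> h w\<bar> \<le> ?N h * ?N w" if "h \<in> L2 \<Omega>" for h
    by (rule L2s.Cauchy_Schwarz[OF that w])
  have "AE t in ?M. t \<in> {0<..<T}" by (rule AE_I2) simp
  then have "AE t in ?M. (\<lambda>k. L2dot \<Omega> (s k t) w) \<longlonglongrightarrow> L2dot \<Omega> (g t) w"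
    using lim g'(2)
  proof eventually_elim
    case (elim t)
    have st: "s k t \<in> L2 \<Omega>" for k using s(2)[of k] elim(1) by auto
    have "(\<lambda>k. ?N (s k t - g t) * ?N w) \<longlonglongrightarrow> 0 * ?N w" by (intro tendsto_intros elim)
    then have "(\<lambda>k. ?N (s k t - g t) * ?N w) \<longlonglongrightarrow> 0" by simp
    then have "(\<lambda>k. L2dot \<Omega> (s k t) w - L2dot \<Omega> (g t) w) \<longlonglongrightarrow> 0"
      by (rule Lim_null_comparison[rotated])
         (use bound st elim(3) w in \<open>auto intro!: always_eventually simp flip: L2s.bilinear(5)\<close>)
    then show ?case by (simp add: LIM_zero_iff)
  qed
  then have meas_g: "(\<lambda>t. L2dot \<Omega> (g t) w) \<in> borel_measurable ?M"
    by (rule borel_measurable_lebesgue_on_AE_limit[OF _ meas, rotated]) simp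
  have int: "integrable ?M (\<lambda>t. ?N (g t) * ?N w)" using g'(3) by simp
  have "AE t in ?M. norm (L2dot \<Omega> (g t) w) \<le> norm (?N (g t) * ?N w)"
    using g'(2)
  proof eventually_elim
    case (elim t)
    then show ?case using bound[OF elim] by (auto intro: order_trans)
  qed
  then show ?thesis by (rule Bochner_Integration.integrable_bound[OF int meas_g])
qed

lemma L2_time_deriv_integral:
  assumes X: "\<And>t. t \<in> {0..T} \<Longrightarrow> g t \<in> L2 \<Omega>" "\<And>t. t \<in> {0..T} \<Longrightarrow> g' t \<in> L2 \<Omega>"
    and cont: "continuous_in (L2norm \<Omega>) {0..T} g" "continuous_in (L2norm \<Omega>) {0..T} g'"
    and der: "L2_time_deriv 1 T \<Omega> g g'"
    and st: "0 \<le> s" "s \<le> t" "t \<le> T" and w: "w \<in> L2 \<Omega>"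
  shows "((\<lambda>r. L2dot \<Omega> (g' r) w) has_integral L2dot \<Omega> (g t - g s) w) {s..t}"
proof -
  have "((\<lambda>r. L2dot \<Omega> (g' r) w) has_integral L2dot \<Omega> (g t) w - L2dot \<Omega> (g s) w) {s..t}"
  proof (rule has_integral_of_weak_deriv[OF _ _ _ st])
    show "continuous_on {0..T} (\<lambda>r. L2dot \<Omega> (g r) w)"
      by (rule L2s.continuous_on_ip[OF X(1)]) (use cont w in \<open>auto simp: continuous_in_L2norm_iff\<close>)
    show "integrable (lebesgue_on {0<..<T}) (\<lambda>r. L2dot \<Omega> (g' r) w)"
      by (intro continuous_integrable_open_interval L2s.continuous_on_ip[OF X(2)])
         (use cont w in \<open>auto simp: continuous_in_L2norm_iff\<close>)
    show "weak_time_deriv 1 T (\<lambda>r. L2dot \<Omega> (g r) w) (\<lambda>r. L2dot \<Omega> (g' r) w)"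
      using der w by (simp add: L2_time_deriv_def L2inner_eq_L2dot)
  qed
  then show ?thesis using X st w by (simp add: L2s.bilinear)
qed

lemma L2_time_deriv_seminorm_deriv:
  assumes X: "\<And>t. t \<in> {0..T} \<Longrightarrow> g t \<in> L2 \<Omega>" "\<And>t. t \<in> {0..T} \<Longrightarrow> g' t \<in> L2 \<Omega>"
    and cont: "continuous_in (L2norm \<Omega>) {0..T} g" "continuous_in (L2norm \<Omega>) {0..T} g'"
    and der: "L2_time_deriv 1 T \<Omega> g g'"
  shows "seminorm_deriv (seminorm_of (L2dot \<Omega>)) {0..T} g g'"
  by (rule L2s.seminorm_deriv_of_integral[OF X])
     (use cont L2_time_deriv_integral[OF assms] in \<open>simp_all add: continuous_in_L2norm_iff\<close>)

end

context multiscale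
begin

text \<open>The map \<open>P\<close> is linear up to null sets only, but these are invisible to the seminorm.\<close>

lemma P_seminorm_deriv:
  assumes X: "\<And>t. t \<in> S \<Longrightarrow> g t \<in> L2 \<Omega>" "\<And>t. t \<in> S \<Longrightarrow> g' t \<in> L2 \<Omega>"
    and g: "seminorm_deriv (seminorm_of (L2dot \<Omega>)) S g g'"
  shows "seminorm_deriv (seminorm_of (L2dot \<Omega>)) S (\<lambda>t. P (g t)) (\<lambda>t. P (g' t))"
  unfolding seminorm_deriv_def
proof
  let ?N = "seminorm_of (L2dot \<Omega>)"
  obtain K where K: "\<And>v. v \<in> L2 \<Omega> \<Longrightarrow> ?N (P v) \<le> K * ?N v" using P_bounded by blast
  fix t assume t: "t \<in> S"
  let ?q = "\<lambda>s. (1 / (s - t)) *\<^sub>R (g s - g t) - g' t"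
  have "((\<lambda>s. K * ?N (?q s)) \<longlongrightarrow> K * 0) (at t within S)"
    using g t by (intro tendsto_mult tendsto_const) (auto simp: seminorm_deriv_def)
  then have lim: "((\<lambda>s. K * ?N (?q s)) \<longlongrightarrow> 0) (at t within S)" by simp
  show "((\<lambda>s. ?N ((1 / (s - t)) *\<^sub>R (P (g s) - P (g t)) - P (g' t))) \<longlongrightarrow> 0) (at t within S)"
  proof (rule null_comparison_within[OF lim])
    fix s assume s: "s \<in> S"
    have L: "g s \<in> L2 \<Omega>" "g t \<in> L2 \<Omega>" "g' t \<in> L2 \<Omega>" using X s t by auto
    then have L': "P (g s) \<in> L2 \<Omega>" "P (g t) \<in> L2 \<Omega>" "P (g' t) \<in> L2 \<Omega>" "P (?q s) \<in> L2 \<Omega>"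
      by (auto intro!: V_L2[OF P_V])
    have "ae_eq \<Omega> (P (?q s)) ((1 / (s - t)) *\<^sub>R P (g s - g t) - P (g' t))"
      using P_linear[of "g s - g t" "g' t" "1 / (s - t)" "-1"] L by simp
    also have "ae_eq \<Omega> ((1 / (s - t)) *\<^sub>R P (g s - g t) - P (g' t)) ((1 / (s - t)) *\<^sub>R (P (g s) - P (g t)) - P (g' t))"
    proof -
      have "ae_eq \<Omega> (P (g s - g t)) (P (g s) - P (g t))"
        using P_linear[OF L(1,2), of 1 "-1"] by simp
      from ae_eq_lincomb[OF this ae_eq_refl, of "1 / (s - t)" "-1" "P (g' t)"] show ?thesis by simp
    qed
    finally have "?N (P (?q s)) = ?N ((1 / (s - t)) *\<^sub>R (P (g s) - P (g t)) - P (g' t))"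
      using L' by (intro L2seminorm_cong) auto
    moreover have "?N (P (?q s)) \<le> K * ?N (?q s)" using L by (intro K) auto
    ultimately show "\<bar>?N ((1 / (s - t)) *\<^sub>R (P (g s) - P (g t)) - P (g' t))\<bar> \<le> K * ?N (?q s)"
      using L2s.nrm_nonneg[OF L'(4)] by simp
  qed
qed

lemma P_seminorm_cont:
  assumes X: "\<And>t. t \<in> S \<Longrightarrow> g t \<in> L2 \<Omega>" and g: "seminorm_cont (seminorm_of (L2dot \<Omega>)) S g"
  shows "seminorm_cont (seminorm_of (L2dot \<Omega>)) S (\<lambda>t. P (g t))"
  unfolding seminorm_cont_def
proof
  let ?N = "seminorm_of (L2dot \<Omega>)"
  obtain K where K: "\<And>v. v \<in> L2 \<Omega> \<Longrightarrow> ?N (P v) \<le> K * ?N v" using P_bounded by blast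
  fix t assume t: "t \<in> S"
  have "((\<lambda>s. K * ?N (g s - g t)) \<longlongrightarrow> K * 0) (at t within S)"
    using g t by (intro tendsto_mult tendsto_const) (auto simp: seminorm_cont_def)
  then have lim: "((\<lambda>s. K * ?N (g s - g t)) \<longlongrightarrow> 0) (at t within S)" by simp
  show "((\<lambda>s. ?N (P (g s) - P (g t))) \<longlongrightarrow> 0) (at t within S)"
  proof (rule null_comparison_within[OF lim])
    fix s assume s: "s \<in> S"
    have L: "g s \<in> L2 \<Omega>" "g t \<in> L2 \<Omega>" using X s t by auto
    then have L': "P (g s) \<in> L2 \<Omega>" "P (g t) \<in> L2 \<Omega>" "P (g s - g t) \<in> L2 \<Omega>"
      by (auto intro!: V_L2[OF P_V])
    have "ae_eq \<Omega> (P (g s - g t)) (P (g s) - P (g t))"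
      using P_linear[OF L(1,2), of 1 "-1"] by simp
    then have "?N (P (g s - g t)) = ?N (P (g s) - P (g t))"
      using L' by (intro L2seminorm_cong) auto
    moreover have "?N (P (g s - g t)) \<le> K * ?N (g s - g t)" using L by (intro K) auto
    ultimately show "\<bar>?N (P (g s) - P (g t))\<bar> \<le> K * ?N (g s - g t)"
      using L2s.nrm_nonneg[OF L'(3)] by simp
  qed
qed

end

section \<open>Stability and error estimates\<close>

context multiscale
begin

sublocale Vm: semi_inner Vt "L2dot \<Omega>"
  by (rule semi_inner_subset[OF semi_inner_L2 subspace_Vt]) (use Vt_V V_L2 in auto)

sublocale Va: semi_inner Vt "bilin \<Omega> A"
  by (rule semi_inner_subset[OF B.semi_inner_axioms subspace_Vt]) (use Vt_V V_H1 in auto)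

lemma Vt_L2: "v \<in> Vt \<Longrightarrow> v \<in> L2 \<Omega>"
  using Vt_V V_L2 by blast

lemma Vt_H1: "v \<in> Vt \<Longrightarrow> v \<in> H1 \<Omega>"
  using Vt_V V_H1 by blast

definition M\<^sub>1 where "M\<^sub>1 \<delta> = max (sqrt (2 / \<delta>)) (2 / sqrt \<alpha>)"
definition M\<^sub>2 where "M\<^sub>2 \<delta> = max (sqrt (2 / \<delta>)) (sqrt \<beta>)"

text \<open>The energy estimates lose factors at both ends: the seminorms of the solution are recovered from the
root of the energy with the factors collected in \<open>M\<^sub>1\<close>, and the initial energy and the data enter
with those in \<open>M\<^sub>2\<close>.\<close>

lemma stability_const_eq: "stability_const \<alpha> \<beta> \<delta> = 2 * M\<^sub>1 \<delta> * M\<^sub>2 \<delta>"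
  by (simp add: stability_const_def M\<^sub>1_def M\<^sub>2_def)

lemma constants:
  assumes "0 < \<delta>" "\<delta> \<le> 1"
  shows "1 \<le> M\<^sub>1 \<delta>" "1 / sqrt \<delta> \<le> M\<^sub>1 \<delta>" "2 / sqrt \<alpha> \<le> M\<^sub>1 \<delta>"
    "1 \<le> M\<^sub>2 \<delta>" "1 / sqrt \<delta> \<le> M\<^sub>2 \<delta>" "sqrt \<beta> \<le> M\<^sub>2 \<delta>"
proof -
  have 1: "1 / sqrt \<delta> \<le> sqrt (2 / \<delta>)"
    using assms by (simp add: real_sqrt_divide divide_right_mono)
  have 2: "1 \<le> sqrt (2 / \<delta>)" using assms by simp
  show "1 \<le> M\<^sub>1 \<delta>" "1 / sqrt \<delta> \<le> M\<^sub>1 \<delta>" "2 / sqrt \<alpha> \<le> M\<^sub>1 \<delta>"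
    "1 \<le> M\<^sub>2 \<delta>" "1 / sqrt \<delta> \<le> M\<^sub>2 \<delta>" "sqrt \<beta> \<le> M\<^sub>2 \<delta>"
    using 1 2 by (simp_all add: M\<^sub>1_def M\<^sub>2_def le_max_iff_disj)
qed

lemma CFL_imp_le_1:
  assumes "1 - 1/2 * \<beta> * Cinv\<^sup>2 * CI\<^sup>2 * (inverse H)\<^sup>2 * \<tau>\<^sup>2 \<ge> \<delta>"
  shows "\<delta> \<le> 1"
proof -
  have "0 \<le> 1/2 * \<beta> * Cinv\<^sup>2 * CI\<^sup>2 * (inverse H)\<^sup>2 * \<tau>\<^sup>2" using pos by simp
  then show ?thesis using assms by linarith
qed

text \<open>The estimate of \<open>leapfrog_energy\<close> on the multiscale space, where the condition on \<open>\<tau>\<close>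
follows from \<open>Vt_inverse\<close>, with the energy replaced by gradients.\<close>

lemma leapfrog_bound:
  assumes \<delta>: "0 < \<delta>" and \<tau>: "0 < \<tau>"
    and cfl: "1 - 1/2 * \<beta> * Cinv\<^sup>2 * CI\<^sup>2 * (inverse H)\<^sup>2 * \<tau>\<^sup>2 \<ge> \<delta>"
    and w: "\<And>k. k \<le> Suc n \<Longrightarrow> w k \<in> Vt"
    and eq: "\<And>k v. 1 \<le> k \<Longrightarrow> k \<le> n \<Longrightarrow> v \<in> Vt \<Longrightarrow>
      L2dot \<Omega> ((1 / \<tau>\<^sup>2) *\<^sub>R (w (Suc k) - 2 *\<^sub>R w k + w (k - 1))) v + bilin \<Omega> A (w k) v = L2dot \<Omega> (g k) v"
    and g: "\<And>k. 1 \<le> k \<Longrightarrow> k \<le> n \<Longrightarrow> g k \<in> L2 \<Omega>"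
  shows "L2norm \<Omega> ((1 / \<tau>) *\<^sub>R (w (Suc n) - w n)) + L2norm \<Omega> (grad \<Omega> (w (Suc n)))
    \<le> stability_const \<alpha> \<beta> \<delta> * (\<tau> * (\<Sum>k=1..n. L2norm \<Omega> (g k)) + L2norm \<Omega> ((1 / \<tau>) *\<^sub>R (w 1 - w 0))
        + L2norm \<Omega> (grad \<Omega> (w 0)) + L2norm \<Omega> (grad \<Omega> (w 1)))"
proof -
  let ?N = "seminorm_of (L2dot \<Omega>)" and ?D = "seminorm_of Dirichlet"
  have \<delta>1: "\<delta> \<le> 1" by (rule CFL_imp_le_1[OF cfl])
  define d where "d k = (1 / \<tau>) *\<^sub>R (w (Suc k) - w k)" for k
  define S where "S = ?N (d 0) + sqrt ((bilin \<Omega> A (w 0) (w 0) + bilin \<Omega> A (w 1) (w 1)) / 2)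
      + \<tau> / sqrt \<delta> * (\<Sum>k=1..n. ?N (g k))"
  have cfl': "\<tau>\<^sup>2 / 2 * bilin \<Omega> A v v \<le> (1 - \<delta>) * L2dot \<Omega> v v" if v: "v \<in> Vt" for v
  proof -
    have "\<tau>\<^sup>2 / 2 * bilin \<Omega> A v v \<le> \<tau>\<^sup>2 / 2 * (\<beta> * Cinv\<^sup>2 * CI\<^sup>2 * (inverse H)\<^sup>2 * L2dot \<Omega> v v)"
      by (intro mult_left_mono Vt_inverse v) simp
    also have "\<dots> = (1/2 * \<beta> * Cinv\<^sup>2 * CI\<^sup>2 * (inverse H)\<^sup>2 * \<tau>\<^sup>2) * L2dot \<Omega> v v" by simp
    also have "\<dots> \<le> (1 - \<delta>) * L2dot \<Omega> v v"
      using cfl Vm.nonneg[OF v] by (intro mult_right_mono) auto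
    finally show ?thesis .
  qed
  have l: "\<bar>L2dot \<Omega> (g k) v\<bar> \<le> L2norm \<Omega> (g k) * ?N v" if "1 \<le> k" "k \<le> n" "v \<in> Vt" for k v
    using L2s.Cauchy_Schwarz[OF g[OF that(1,2)] Vt_L2[OF that(3)]] by (simp add: L2norm_eq_seminorm)
  have Gnn: "0 \<le> L2norm \<Omega> h" for h :: "real^'d \<Rightarrow> real" by (simp add: L2norm_def)
  have energy: "sqrt \<delta> * ?N (d n) \<le> S" "seminorm_of (bilin \<Omega> A) (w (Suc n)) \<le> sqrt 2 * S"
    using leapfrog_energy[where m = "L2dot \<Omega>" and a = "bilin \<Omega> A" and w = w and n = n
        and l = "\<lambda>k v. L2dot \<Omega> (g k) v" and G = "\<lambda>k. L2norm \<Omega> (g k)",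
        OF Vm.semi_inner_axioms Va.semi_inner_axioms \<tau> \<delta> cfl' w eq l Gnn]
    unfolding d_def S_def L2norm_eq_seminorm One_nat_def by blast+
  have w01: "w 0 \<in> Vt" "w 1 \<in> Vt" "w (Suc n) \<in> Vt" using w by auto
  have Dnn: "0 \<le> ?D (w 0)" "0 \<le> ?D (w 1)" "0 \<le> ?D (w (Suc n))"
    using D.nrm_nonneg[OF Vt_H1] w01 by auto
  have "sqrt ((bilin \<Omega> A (w 0) (w 0) + bilin \<Omega> A (w 1) (w 1)) / 2) \<le> sqrt \<beta> * (?D (w 0) + ?D (w 1))"
  proof (rule real_le_lsqrt)
    have "(bilin \<Omega> A (w 0) (w 0) + bilin \<Omega> A (w 1) (w 1)) / 2 \<le> bilin \<Omega> A (w 0) (w 0) + bilin \<Omega> A (w 1) (w 1)"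
      using Va.nonneg[OF w01(1)] Va.nonneg[OF w01(2)] by simp
    also have "\<dots> \<le> \<beta> * Dirichlet (w 0) (w 0) + \<beta> * Dirichlet (w 1) (w 1)"
      using bilin_upper[OF Vt_H1] w01 by (intro add_mono) auto
    also have "\<dots> = \<beta> * ((?D (w 0))\<^sup>2 + (?D (w 1))\<^sup>2)"
      using D.nrm_sq[OF Vt_H1] w01 by (simp add: algebra_simps)
    also have "\<dots> \<le> \<beta> * (?D (w 0) + ?D (w 1))\<^sup>2"
      using pos Dnn by (intro mult_left_mono) (auto simp: power2_sum)
    also have "\<dots> = (sqrt \<beta> * (?D (w 0) + ?D (w 1)))\<^sup>2"
      using pos by (simp add: power_mult_distrib)
    finally show "(bilin \<Omega> A (w 0) (w 0) + bilin \<Omega> A (w 1) (w 1)) / 2 \<le> (sqrt \<beta> * (?D (w 0) + ?D (w 1)))\<^sup>2" .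
  qed (use pos Dnn in auto)
  also have "\<dots> \<le> M\<^sub>2 \<delta> * (?D (w 0) + ?D (w 1))"
    using constants[OF \<delta> \<delta>1] Dnn by (intro mult_right_mono) auto
  finally have 1: "sqrt ((bilin \<Omega> A (w 0) (w 0) + bilin \<Omega> A (w 1) (w 1)) / 2) \<le> M\<^sub>2 \<delta> * (?D (w 0) + ?D (w 1))" .
  have d0: "0 \<le> ?N (d 0)" using w01 by (intro L2s.nrm_nonneg) (auto simp: d_def intro: Vt_L2)
  have 2: "?N (d 0) \<le> M\<^sub>2 \<delta> * ?N (d 0)"
    using mult_right_mono[OF constants(4)[OF \<delta> \<delta>1] d0] by simp
  have sumnn: "0 \<le> \<tau> * (\<Sum>k=1..n. ?N (g k))"
    using \<tau> Gnn by (intro mult_nonneg_nonneg sum_nonneg) (auto simp: L2norm_eq_seminorm)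
  have 3: "\<tau> / sqrt \<delta> * (\<Sum>k=1..n. ?N (g k)) \<le> M\<^sub>2 \<delta> * (\<tau> * (\<Sum>k=1..n. ?N (g k)))"
    using mult_right_mono[OF constants(5)[OF \<delta> \<delta>1] sumnn] by simp
  let ?Q = "\<tau> * (\<Sum>k=1..n. ?N (g k)) + ?N (d 0) + ?D (w 0) + ?D (w 1)"
  have S_le: "S \<le> M\<^sub>2 \<delta> * ?Q"
    using 1 2 3 unfolding S_def by (simp add: distrib_left)
  have S_nn: "0 \<le> S"
  proof -
    have "0 \<le> sqrt \<delta> * ?N (d n)"
      using w \<delta> by (intro mult_nonneg_nonneg L2s.nrm_nonneg) (auto simp: d_def intro!: Vt_L2)
    then show ?thesis using energy(1) by linarith
  qed
  have "?N (d n) \<le> 1 / sqrt \<delta> * S" using energy(1) \<delta> by (simp add: field_simps)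
  also have "\<dots> \<le> M\<^sub>1 \<delta> * S" using constants(2)[OF \<delta> \<delta>1] S_nn by (rule mult_right_mono)
  finally have A1: "?N (d n) \<le> M\<^sub>1 \<delta> * S" .
  have "sqrt \<alpha> * ?D (w (Suc n)) \<le> sqrt 2 * S"
    using Dirichlet_le_bilin[OF Vt_V[OF w01(3)]] energy(2) by linarith
  also have "\<dots> \<le> 2 * S" using S_nn sqrt2_less_2 by (intro mult_right_mono) auto
  finally have "?D (w (Suc n)) \<le> 2 / sqrt \<alpha> * S"
    using pos by (simp add: field_simps)
  also have "\<dots> \<le> M\<^sub>1 \<delta> * S" using constants(3)[OF \<delta> \<delta>1] S_nn by (rule mult_right_mono)
  finally have A2: "?D (w (Suc n)) \<le> M\<^sub>1 \<delta> * S" .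
  have "?N (d n) + ?D (w (Suc n)) \<le> 2 * M\<^sub>1 \<delta> * S" using A1 A2 by simp
  also have "\<dots> \<le> 2 * M\<^sub>1 \<delta> * (M\<^sub>2 \<delta> * ?Q)"
    using S_le constants(1)[OF \<delta> \<delta>1] by (intro mult_left_mono) auto
  finally show ?thesis
    unfolding L2norm_grad unfolding L2norm_eq_seminorm stability_const_eq
    by (simp add: mult.assoc d_def)
qed

lemma leapfrog_stable:
  assumes \<delta>: "0 < \<delta>" and \<tau>: "0 < \<tau>"
    and cfl: "1 - 1/2 * \<beta> * Cinv\<^sup>2 * CI\<^sup>2 * (inverse H)\<^sup>2 * \<tau>\<^sup>2 \<ge> \<delta>"
  shows "leapfrog_stable \<Omega> A Vt \<tau> N (stability_const \<alpha> \<beta> \<delta>)"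
  unfolding leapfrog_stable_def
proof (intro allI impI, elim conjE)
  fix g :: "nat \<Rightarrow> real^'d \<Rightarrow> real" and w :: "nat \<Rightarrow> real^'d \<Rightarrow> real" and n
  assume g: "\<forall>k. g k \<in> L2 \<Omega>" and w: "leapfrog_solution \<Omega> A Vt \<tau> N g w" and n: "1 \<le> n" "n + 1 \<le> N"
  have fun_eq: "(1 / \<tau>\<^sup>2) *\<^sub>R (w (Suc k) - 2 *\<^sub>R w k + w (k - 1)) =
      (\<lambda>x. (w (k + 1) x - 2 * w k x + w (k - 1) x) / \<tau>\<^sup>2)" for k
    by (simp add: fun_eq_iff)
  have "L2norm \<Omega> ((1 / \<tau>) *\<^sub>R (w (Suc n) - w n)) + L2norm \<Omega> (grad \<Omega> (w (Suc n)))
    \<le> stability_const \<alpha> \<beta> \<delta> * (\<tau> * (\<Sum>k=1..n. L2norm \<Omega> (g k)) + L2norm \<Omega> ((1 / \<tau>) *\<^sub>R (w 1 - w 0))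
        + L2norm \<Omega> (grad \<Omega> (w 0)) + L2norm \<Omega> (grad \<Omega> (w 1)))"
  proof (rule leapfrog_bound[OF \<delta> \<tau> cfl])
    show "w k \<in> Vt" if "k \<le> Suc n" for k using w n that by (auto simp: leapfrog_solution_def)
    show "L2dot \<Omega> ((1 / \<tau>\<^sup>2) *\<^sub>R (w (Suc k) - 2 *\<^sub>R w k + w (k - 1))) v + bilin \<Omega> A (w k) v = L2dot \<Omega> (g k) v"
      if "1 \<le> k" "k \<le> n" "v \<in> Vt" for k v
      unfolding fun_eq using w n that by (auto simp: leapfrog_solution_def L2inner_eq_L2dot)
  qed (use g in auto)
  moreover have "(1 / \<tau>) *\<^sub>R (w (Suc k) - w k) = (\<lambda>x. (w (Suc k) x - w k x) / \<tau>)" for k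
    by (simp add: fun_eq_iff)
  ultimately show "L2norm \<Omega> (\<lambda>x. (w (n + 1) x - w n x) / \<tau>) + L2norm \<Omega> (grad \<Omega> (w (n + 1)))
        \<le> stability_const \<alpha> \<beta> \<delta> * (\<tau> * (\<Sum>k=1..n. L2norm \<Omega> (g k)) + L2norm \<Omega> (\<lambda>x. (w 1 x - w 0 x) / \<tau>)
               + L2norm \<Omega> (grad \<Omega> (w 0)) + L2norm \<Omega> (grad \<Omega> (w 1)))"
    by simp
qed

text \<open>At the grid points \<open>z\<close> satisfies the semi-discrete equation, hence it solves the scheme with the
right-hand side \<open>f - z'' + D2\<close>, where \<open>D2\<close> is its second difference quotient. Subtraction leaves \<open>z'' -
D2\<close> as the right-hand side for \<open>E\<close>. The term with \<open>grad \<Omega> (E 0)\<close> vanishes since both initial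
values are \<open>z0\<close> almost everywhere.\<close>

lemma discrete_error:
  assumes \<delta>: "0 < \<delta>" and \<tau>: "0 < \<tau>"
    and cfl: "1 - 1/2 * \<beta> * Cinv\<^sup>2 * CI\<^sup>2 * (inverse H)\<^sup>2 * \<tau>\<^sup>2 \<ge> \<delta>"
    and z: "semidiscrete_solution \<Omega> A Vt T f z0 z1 z z' z''"
    and ut: "leapfrog_solution \<Omega> A Vt \<tau> N (\<lambda>n. f (real n * \<tau>)) ut" "ae_eq \<Omega> (ut 0) z0"
    and n: "real (Suc n) * \<tau> \<le> T" "Suc n \<le> N" and f: "\<And>s. s \<in> {0..T} \<Longrightarrow> f s \<in> L2 \<Omega>"
  defines "E \<equiv> \<lambda>n. ut n - z (real n * \<tau>)"
  shows "L2norm \<Omega> ((1 / \<tau>) *\<^sub>R (E (Suc n) - E n)) + L2norm \<Omega> (grad \<Omega> (E (Suc n)))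
    \<le> stability_const \<alpha> \<beta> \<delta> * (L2norm \<Omega> ((1 / \<tau>) *\<^sub>R (E 1 - E 0)) + L2norm \<Omega> (grad \<Omega> (E 1))
      + (\<Sum>k=1..n. \<tau> * L2norm \<Omega> ((1 / \<tau>\<^sup>2) *\<^sub>R (z (real (k + 1) * \<tau>) - 2 *\<^sub>R z (real k * \<tau>) + z (real (k - 1) * \<tau>))
          - z'' (real k * \<tau>))))"
proof -
  define \<zeta> where "\<zeta> k = z (real k * \<tau>)" for k
  define D2 where "D2 k = (1 / \<tau>\<^sup>2) *\<^sub>R (\<zeta> (Suc k) - 2 *\<^sub>R \<zeta> k + \<zeta> (k - 1))" for k
  have tk: "real k * \<tau> \<in> {0..T}" if "k \<le> Suc n" for k
  proof -
    have "real k * \<tau> \<le> real (Suc n) * \<tau>" using that \<tau> by (intro mult_right_mono) auto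
    then have "real k * \<tau> \<le> T" using n(1) by (rule order_trans)
    then show ?thesis using \<tau> by simp
  qed
  have zVt: "\<zeta> k \<in> Vt" "z'' (real k * \<tau>) \<in> Vt" if "k \<le> Suc n" for k
    using z tk[OF that] by (auto simp: semidiscrete_solution_def \<zeta>_def)
  have uVt: "ut k \<in> Vt" if "k \<le> Suc n" for k
    using ut(1) n that by (auto simp: leapfrog_solution_def)
  have E: "E k \<in> Vt" if "k \<le> Suc n" for k
    using zVt uVt that by (simp add: E_def \<zeta>_def)
  have gL: "z'' (real k * \<tau>) - D2 k \<in> Vt" if "1 \<le> k" "k \<le> n" for k
    using that by (auto simp: D2_def intro!: Vm.closed zVt)
  have "L2norm \<Omega> ((1 / \<tau>) *\<^sub>R (E (Suc n) - E n)) + L2norm \<Omega> (grad \<Omega> (E (Suc n)))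
    \<le> stability_const \<alpha> \<beta> \<delta> * (\<tau> * (\<Sum>k=1..n. L2norm \<Omega> (z'' (real k * \<tau>) - D2 k))
        + L2norm \<Omega> ((1 / \<tau>) *\<^sub>R (E 1 - E 0)) + L2norm \<Omega> (grad \<Omega> (E 0)) + L2norm \<Omega> (grad \<Omega> (E 1)))"
  proof (rule leapfrog_bound[OF \<delta> \<tau> cfl E])
    fix k v assume k: "1 \<le> k" "k \<le> n" and v: "v \<in> Vt"
    have mem: "ut k \<in> Vt" "ut (Suc k) \<in> Vt" "ut (k - 1) \<in> Vt" "\<zeta> k \<in> Vt" "\<zeta> (Suc k) \<in> Vt" "\<zeta> (k - 1) \<in> Vt"
      "z'' (real k * \<tau>) \<in> Vt" "D2 k \<in> Vt"
      using uVt zVt k by (auto simp: D2_def)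
    have fun_eq: "(\<lambda>x. (ut (k + 1) x - 2 * ut k x + ut (k - 1) x) / \<tau>\<^sup>2) =
        (1 / \<tau>\<^sup>2) *\<^sub>R (ut (Suc k) - 2 *\<^sub>R ut k + ut (k - 1))"
      by (simp add: fun_eq_iff)
    have 1: "L2dot \<Omega> ((1 / \<tau>\<^sup>2) *\<^sub>R (ut (Suc k) - 2 *\<^sub>R ut k + ut (k - 1))) v + bilin \<Omega> A (ut k) v
        = L2dot \<Omega> (f (real k * \<tau>)) v"
    proof -
      have "L2inner \<Omega> (\<lambda>x. (ut (k + 1) x - 2 * ut k x + ut (k - 1) x) / \<tau>\<^sup>2) v + bilin \<Omega> A (ut k) v
          = L2inner \<Omega> (f (real k * \<tau>)) v"
        using ut(1) k n v unfolding leapfrog_solution_def by auto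
      then show ?thesis unfolding fun_eq L2inner_eq_L2dot .
    qed
    have 2: "L2dot \<Omega> (z'' (real k * \<tau>)) v + bilin \<Omega> A (\<zeta> k) v = L2dot \<Omega> (f (real k * \<tau>)) v"
      using z tk[of k] k v unfolding semidiscrete_solution_def L2inner_eq_L2dot \<zeta>_def by auto
    have "(1 / \<tau>\<^sup>2) *\<^sub>R (E (Suc k) - 2 *\<^sub>R E k + E (k - 1))
        = (1 / \<tau>\<^sup>2) *\<^sub>R (ut (Suc k) - 2 *\<^sub>R ut k + ut (k - 1)) - D2 k"
      unfolding D2_def E_def \<zeta>_def scaleR_diff_right[symmetric] by (simp add: algebra_simps)
    then have "L2dot \<Omega> ((1 / \<tau>\<^sup>2) *\<^sub>R (E (Suc k) - 2 *\<^sub>R E k + E (k - 1))) v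
        = L2dot \<Omega> ((1 / \<tau>\<^sup>2) *\<^sub>R (ut (Suc k) - 2 *\<^sub>R ut k + ut (k - 1))) v - L2dot \<Omega> (D2 k) v"
      using mem v by (simp only: Vm.bilinear(5) Vm.closed)
    moreover have "bilin \<Omega> A (E k) v = bilin \<Omega> A (ut k) v - bilin \<Omega> A (\<zeta> k) v"
      unfolding E_def \<zeta>_def[symmetric] using mem v by (simp add: Va.bilinear)
    moreover have "L2dot \<Omega> (z'' (real k * \<tau>) - D2 k) v = L2dot \<Omega> (z'' (real k * \<tau>)) v - L2dot \<Omega> (D2 k) v"
      using mem v by (simp add: Vm.bilinear)
    ultimately show "L2dot \<Omega> ((1 / \<tau>\<^sup>2) *\<^sub>R (E (Suc k) - 2 *\<^sub>R E k + E (k - 1))) v + bilin \<Omega> A (E k) v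
        = L2dot \<Omega> (z'' (real k * \<tau>) - D2 k) v"
      using 1 2 by linarith
  qed (assumption | rule Vt_L2[OF gL])+
  moreover have "L2norm \<Omega> (grad \<Omega> (E 0)) = 0"
  proof -
    have mem: "E 0 \<in> Vt" using E by simp
    have "ae_eq \<Omega> (z 0) z0" using z by (simp add: semidiscrete_solution_def)
    then have "ae_eq \<Omega> (ut 0 - z 0) (z0 - z0)" by (rule ae_eq_diff[OF ut(2)])
    then have "ae_eq \<Omega> (E 0) 0" by (simp add: E_def)
    then have "ae_eq \<Omega> 0 (E 0)" by (rule ae_eq_sym)
    then have "grad \<Omega> (E 0) = grad \<Omega> 0"
      using grad_cong_AE(2)[of 0 "E 0"] Vt_L2[OF mem] by (simp add: ae_eq_def)
    then have "L2norm \<Omega> (grad \<Omega> (E 0)) = L2norm \<Omega> (grad \<Omega> 0)" by simp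
    also have "\<dots> = 0" unfolding L2norm_grad by (simp add: seminorm_of_def)
    finally show ?thesis .
  qed
  moreover have "L2norm \<Omega> (z'' (real k * \<tau>) - D2 k) = L2norm \<Omega> (D2 k - z'' (real k * \<tau>))" if "k \<in> {1..n}" for k
    unfolding L2norm_eq_seminorm
    using that zVt by (intro Vm.nrm_minus_commute) (auto simp: D2_def)
  then have "\<tau> * (\<Sum>k=1..n. L2norm \<Omega> (z'' (real k * \<tau>) - D2 k)) = (\<Sum>k=1..n. \<tau> * L2norm \<Omega> (D2 k - z'' (real k * \<tau>)))"
    by (simp add: sum_distrib_left)
  ultimately show ?thesis
    by (simp add: D2_def \<zeta>_def add_ac)
qed

text \<open>For multiscale \<open>v\<close>, subtracting the equations of \<open>u\<close> and \<open>z\<close> and using \<open>a (P u) v = a u v\<close> gives \<open>(z'' -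
u'', v) = - a \<theta> v\<close>. Since \<open>\<theta> = (z - u) + \<rho>\<close>, the weak second derivative of
\<open>(\<theta>, v)\<close> is \<open>(\<rho>'', v) - a \<theta> v\<close>, which is the equation treated in
\<open>evolution_energy\<close>.\<close>

lemma semidiscrete_energy:
  assumes Veq: "V = H1_Gamma \<Omega> \<Gamma>" and T: "0 < T"
    and u: "weak_wave_solution \<Omega> \<Gamma> A T f u0 v0 u u' u''"
    and z: "semidiscrete_solution \<Omega> A Vt T f z0 z1 z z' z''"
    and u_tt: "bochner_Lp 1 T (L2 \<Omega>) (L2norm \<Omega>) u_tt"
      "AE s in lebesgue_on {0<..<T}. \<forall>v\<in>V. u'' s v = L2inner \<Omega> (u_tt s) v"
    and z'': "continuous_in (L2norm \<Omega>) {0..T} z''"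
    and \<rho>'': "bochner_Lp 1 T (L2 \<Omega>) (L2norm \<Omega>) \<rho>''" "L2_time_deriv 2 T \<Omega> (\<lambda>s. u s - P (u s)) \<rho>''"
  defines "\<theta> \<equiv> \<lambda>s. z s - P (u s)" and "\<theta>' \<equiv> \<lambda>s. z' s - P (u' s)"
  shows "(\<lambda>s. L2norm \<Omega> (\<rho>'' s)) integrable_on {0..T}"
    and "seminorm_deriv (seminorm_of (L2dot \<Omega>)) {0..T} \<theta> \<theta>'"
    and "\<And>t. t \<in> {0..T} \<Longrightarrow> \<theta> t \<in> Vt" and "\<And>t. t \<in> {0..T} \<Longrightarrow> \<theta>' t \<in> Vt"
    and "\<And>t. t \<in> {0..T} \<Longrightarrow> sqrt (L2dot \<Omega> (\<theta>' t) (\<theta>' t) + bilin \<Omega> A (\<theta> t) (\<theta> t))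
      \<le> sqrt (L2dot \<Omega> (\<theta>' 0) (\<theta>' 0) + bilin \<Omega> A (\<theta> 0) (\<theta> 0)) + integral {0..t} (\<lambda>s. L2norm \<Omega> (\<rho>'' s))"
proof -
  let ?N = "seminorm_of (L2dot \<Omega>)" and ?I = "{0..T}" and ?G = "\<lambda>s. L2norm \<Omega> (\<rho>'' s)"
  have uV: "u t \<in> V" and u'L: "u' t \<in> L2 \<Omega>" if "t \<in> ?I" for t
    using u that by (auto simp: weak_wave_solution_def Veq)
  have uL: "u t \<in> L2 \<Omega>" if "t \<in> ?I" for t using uV[OF that] V_L2 by blast
  have zVt: "z t \<in> Vt" "z' t \<in> Vt" "z'' t \<in> Vt" if "t \<in> ?I" for t
    using z that by (auto simp: semidiscrete_solution_def)
  have zL: "z t \<in> L2 \<Omega>" "z' t \<in> L2 \<Omega>" "z'' t \<in> L2 \<Omega>" if "t \<in> ?I" for t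
    using zVt[OF that] Vt_L2 by auto
  have PL: "P v \<in> L2 \<Omega>" if "v \<in> L2 \<Omega>" for v by (rule V_L2[OF P_V[OF that]])
  have u_cont: "continuous_in (L2norm \<Omega>) ?I u" "continuous_in (L2norm \<Omega>) ?I u'"
    and u_der: "L2_time_deriv 1 T \<Omega> u u'"
    using u by (auto simp: weak_wave_solution_def)
  have z_cont: "continuous_in (L2norm \<Omega>) ?I z" "continuous_in (L2norm \<Omega>) ?I z'"
    and z_der: "L2_time_deriv 1 T \<Omega> z z'" "L2_time_deriv 1 T \<Omega> z' z''"
    using z by (auto simp: semidiscrete_solution_def)
  have du: "seminorm_deriv ?N ?I u u'"
    by (rule L2_time_deriv_seminorm_deriv[OF uL u'L u_cont u_der])
  have dz: "seminorm_deriv ?N ?I z z'"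
    by (rule L2_time_deriv_seminorm_deriv[OF zL(1,2) z_cont z_der(1)])
  have dPu: "seminorm_deriv ?N ?I (\<lambda>t. P (u t)) (\<lambda>t. P (u' t))"
    by (rule P_seminorm_deriv[OF uL u'L du])
  have cu': "seminorm_cont ?N ?I u'" and cz': "seminorm_cont ?N ?I z'"
    using u_cont z_cont by (auto simp: continuous_in_L2norm_iff)
  have cPu': "seminorm_cont ?N ?I (\<lambda>t. P (u' t))"
    by (rule P_seminorm_cont[OF u'L cu'])
  show d\<theta>: "seminorm_deriv ?N ?I \<theta> \<theta>'"
    unfolding \<theta>_def \<theta>'_def
    by (rule L2s.seminorm_deriv_diff[OF _ _ _ _ dz dPu]) (rule zL | rule PL | rule uL | rule u'L | assumption)+
  have c\<theta>': "seminorm_cont ?N ?I \<theta>'"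
    unfolding \<theta>'_def by (rule L2s.seminorm_cont_diff[OF _ _ cz' cPu']) (rule zL | rule PL | rule uL | rule u'L | assumption)+
  define \<rho>' where "\<rho>' t = u' t - P (u' t)" for t
  have d\<rho>: "seminorm_deriv ?N ?I (\<lambda>t. u t - P (u t)) \<rho>'"
    unfolding \<rho>'_def by (rule L2s.seminorm_deriv_diff[OF _ _ _ _ du dPu]) (rule zL | rule PL | rule uL | rule u'L | assumption)+
  have c\<rho>': "seminorm_cont ?N ?I \<rho>'"
    unfolding \<rho>'_def by (rule L2s.seminorm_cont_diff[OF _ _ cu' cPu']) (rule zL | rule PL | rule uL | rule u'L | assumption)+
  have \<rho>L: "u t - P (u t) \<in> L2 \<Omega>" "\<rho>' t \<in> L2 \<Omega>" if "t \<in> ?I" for t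
    using uL[OF that] u'L[OF that] PL by (auto simp: \<rho>'_def)
  show \<theta>Vt: "\<theta> t \<in> Vt" and \<theta>'Vt: "\<theta>' t \<in> Vt" if "t \<in> ?I" for t
    using zVt[OF that] P_Vt uL[OF that] u'L[OF that] by (auto simp: \<theta>_def \<theta>'_def)
  show G: "?G integrable_on ?I"
  proof -
    have "integrable (lebesgue_on {0<..<T}) ?G" using \<rho>''(1) by (simp add: bochner_Lp_def)
    then have "?G integrable_on {0<..<T}" by (rule integrable_on_lebesgue_on) simp
    then show ?thesis by (simp add: integrable_on_open_interval_real)
  qed
  \<comment> \<open>\<open>\<rho>'' r\<close> is square integrable for almost all \<open>r\<close> only; the value zero at the other times keeps the bound by \<open>?G r\<close>\<close>
  define l where "l r v = (if \<rho>'' r \<in> L2 \<Omega> then L2dot \<Omega> (\<rho>'' r) v else 0)" for r v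
  define Q where "Q r \<longleftrightarrow> (\<forall>v\<in>V. u'' r v + bilin \<Omega> A (u r) v = L2inner \<Omega> (f r) v) \<and> \<rho>'' r \<in> L2 \<Omega>" for r
  have "AE r in lebesgue_on {0<..<T}. \<forall>v\<in>V. u'' r v + bilin \<Omega> A (u r) v = L2inner \<Omega> (f r) v"
    using u by (simp add: weak_wave_solution_def Veq)
  moreover have "AE r in lebesgue_on {0<..<T}. \<rho>'' r \<in> L2 \<Omega>"
    using \<rho>''(1) by (simp add: bochner_Lp_def)
  ultimately have "AE r in lebesgue_on {0<..<T}. Q r"
    by eventually_elim (auto simp: Q_def)
  then have negl: "negligible ({r \<in> {0<..<T}. \<not> Q r} \<union> {0, T})"
    by (intro negligible_Un AE_lebesgue_on_negligible) auto
  have weak: "((\<lambda>r. l r v - bilin \<Omega> A (\<theta> r) v) has_integral L2dot \<Omega> (\<theta>' t - \<theta>' s) v) {s..t}"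
    if st: "0 \<le> s" "s \<le> t" "t \<le> T" and v: "v \<in> Vt" for s t v
  proof -
    have vL: "v \<in> L2 \<Omega>" and vV: "v \<in> V" using v Vt_L2 Vt_V by auto
    have Iz: "((\<lambda>r. L2dot \<Omega> (z'' r) v) has_integral L2dot \<Omega> (z' t - z' s) v) {s..t}"
      by (rule L2_time_deriv_integral[OF zL(2,3) z_cont(2) z'' z_der(2) st vL])
    have Iu: "((\<lambda>r. u'' r v) has_integral L2dot \<Omega> (u' t) v - L2dot \<Omega> (u' s) v) {s..t}"
    proof (rule has_integral_of_weak_deriv[OF _ _ _ st])
      show "continuous_on ?I (\<lambda>r. L2dot \<Omega> (u' r) v)" by (rule L2s.continuous_on_ip[OF u'L cu' vL])
      show "weak_time_deriv 1 T (\<lambda>r. L2dot \<Omega> (u' r) v) (\<lambda>r. u'' r v)"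
        using u vV by (auto simp: weak_wave_solution_def Veq L2inner_eq_L2dot)
      show "integrable (lebesgue_on {0<..<T}) (\<lambda>r. u'' r v)"
      proof (rule integrable_lebesgue_on_AE_eq[OF _ integrable_bochner_L2inner[OF u_tt(1) vL]])
        show "AE r in lebesgue_on {0<..<T}. L2dot \<Omega> (u_tt r) v = u'' r v"
          using u_tt(2) by eventually_elim (use vV in \<open>auto simp: L2inner_eq_L2dot\<close>)
      qed simp
    qed
    have I\<rho>: "((\<lambda>r. L2dot \<Omega> (\<rho>'' r) v) has_integral L2dot \<Omega> (\<rho>' t) v - L2dot \<Omega> (\<rho>' s) v) {s..t}"
    proof (rule has_integral_of_weak_deriv[OF _ _ _ st])
      show c: "continuous_on ?I (\<lambda>r. L2dot \<Omega> (\<rho>' r) v)" by (rule L2s.continuous_on_ip[OF \<rho>L(2) c\<rho>' vL])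
      show "integrable (lebesgue_on {0<..<T}) (\<lambda>r. L2dot \<Omega> (\<rho>'' r) v)"
        by (rule integrable_bochner_L2inner[OF \<rho>''(1) vL])
      show "weak_time_deriv 1 T (\<lambda>r. L2dot \<Omega> (\<rho>' r) v) (\<lambda>r. L2dot \<Omega> (\<rho>'' r) v)"
      proof (rule weak_time_deriv_reduce[OF _ c])
        show "((\<lambda>r. L2dot \<Omega> (u r - P (u r)) v) has_real_derivative L2dot \<Omega> (\<rho>' t) v) (at t within ?I)"
          if "t \<in> ?I" for t by (rule L2s.has_derivative_ip[OF \<rho>L d\<rho> that vL])
        show "weak_time_deriv 2 T (\<lambda>r. L2dot \<Omega> (u r - P (u r)) v) (\<lambda>r. L2dot \<Omega> (\<rho>'' r) v)"
          using \<rho>''(2) vL by (simp add: L2_time_deriv_def L2inner_eq_L2dot)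
      qed (use T in simp)
    qed
    have stI: "s \<in> ?I" "t \<in> ?I" using st by auto
    have "((\<lambda>r. L2dot \<Omega> (z'' r) v - u'' r v + L2dot \<Omega> (\<rho>'' r) v) has_integral
        L2dot \<Omega> (z' t - z' s) v - (L2dot \<Omega> (u' t) v - L2dot \<Omega> (u' s) v) + (L2dot \<Omega> (\<rho>' t) v - L2dot \<Omega> (\<rho>' s) v)) {s..t}"
      by (intro has_integral_add has_integral_diff Iz Iu I\<rho>)
    also have "L2dot \<Omega> (z' t - z' s) v - (L2dot \<Omega> (u' t) v - L2dot \<Omega> (u' s) v) + (L2dot \<Omega> (\<rho>' t) v - L2dot \<Omega> (\<rho>' s) v)
        = L2dot \<Omega> (\<theta>' t - \<theta>' s) v"
      using zL(2)[OF stI(1)] zL(2)[OF stI(2)] u'L[OF stI(1)] u'L[OF stI(2)] PL vL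
      by (simp add: \<rho>'_def \<theta>'_def L2s.bilinear)
    finally have I: "((\<lambda>r. L2dot \<Omega> (z'' r) v - u'' r v + L2dot \<Omega> (\<rho>'' r) v) has_integral
        L2dot \<Omega> (\<theta>' t - \<theta>' s) v) {s..t}" .
    show ?thesis
    proof (rule has_integral_spike[OF negl _ I])
      fix r assume r: "r \<in> {s..t} - ({r \<in> {0<..<T}. \<not> Q r} \<union> {0, T})"
      then have rT: "r \<in> ?I" and Qr: "Q r" using st by (auto simp: less_le)
      have 1: "u'' r v + bilin \<Omega> A (u r) v = L2dot \<Omega> (f r) v" and \<rho>r: "\<rho>'' r \<in> L2 \<Omega>"
        using Qr vV by (auto simp: Q_def L2inner_eq_L2dot)
      have 2: "L2dot \<Omega> (z'' r) v + bilin \<Omega> A (z r) v = L2dot \<Omega> (f r) v"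
        using z rT v by (simp add: semidiscrete_solution_def L2inner_eq_L2dot)
      have "bilin \<Omega> A (\<theta> r) v = bilin \<Omega> A (z r) v - bilin \<Omega> A (P (u r)) v"
        unfolding \<theta>_def using zVt(1)[OF rT] P_Vt[OF uL[OF rT]] v by (rule Va.bilinear(5))
      also have "bilin \<Omega> A (P (u r)) v = bilin \<Omega> A (u r) v"
        by (rule bilin_P[OF uV[OF rT] v])
      finally show "l r v - bilin \<Omega> A (\<theta> r) v = L2dot \<Omega> (z'' r) v - u'' r v + L2dot \<Omega> (\<rho>'' r) v"
        using 1 2 \<rho>r by (simp add: l_def)
    qed
  qed
  have Gnn: "0 \<le> ?G r" for r by (simp add: L2norm_def)
  have l_le: "l r v \<le> ?G r * ?N v" if "r \<in> ?I" "v \<in> Vt" for r v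
  proof (cases "\<rho>'' r \<in> L2 \<Omega>")
    case True
    then show ?thesis
      using L2s.Cauchy_Schwarz[OF True Vt_L2[OF that(2)]] by (simp add: l_def L2norm_eq_seminorm)
  next
    case False
    then show ?thesis using Gnn[of r] Vm.nrm_nonneg[OF that(2)] by (simp add: l_def)
  qed
  show "sqrt (L2dot \<Omega> (\<theta>' t) (\<theta>' t) + bilin \<Omega> A (\<theta> t) (\<theta> t))
      \<le> sqrt (L2dot \<Omega> (\<theta>' 0) (\<theta>' 0) + bilin \<Omega> A (\<theta> 0) (\<theta> 0)) + integral {0..t} ?G" if t: "t \<in> ?I" for t
  proof (rule evolution_energy[where l = l and K = "\<beta> * Cinv\<^sup>2 * CI\<^sup>2 * (inverse H)\<^sup>2",
        OF Vm.semi_inner_axioms Va.semi_inner_axioms Vt_inverse _ \<theta>Vt \<theta>'Vt d\<theta> c\<theta>' weak l_le G Gnn t])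
    show "0 \<le> \<beta> * Cinv\<^sup>2 * CI\<^sup>2 * (inverse H)\<^sup>2" using pos by simp
  qed
qed

text \<open>The energy bound holds at all times up to \<open>t\<close>. It bounds the gradient at time \<open>t\<close> directly and the
difference quotient through the supremum of \<open>\<theta>'\<close>.\<close>

lemma semidiscrete_error:
  assumes Veq: "V = H1_Gamma \<Omega> \<Gamma>" and T: "0 < T" and \<delta>: "0 < \<delta>" "\<delta> \<le> 1"
    and u: "weak_wave_solution \<Omega> \<Gamma> A T f u0 v0 u u' u''"
    and z: "semidiscrete_solution \<Omega> A Vt T f z0 z1 z z' z''"
    and u_tt: "bochner_Lp 1 T (L2 \<Omega>) (L2norm \<Omega>) u_tt"
      "AE s in lebesgue_on {0<..<T}. \<forall>v\<in>V. u'' s v = L2inner \<Omega> (u_tt s) v"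
    and z'': "continuous_in (L2norm \<Omega>) {0..T} z''"
    and \<rho>'': "bochner_Lp 1 T (L2 \<Omega>) (L2norm \<Omega>) \<rho>''" "L2_time_deriv 2 T \<Omega> (\<lambda>s. u s - P (u s)) \<rho>''"
    and st: "0 \<le> s" "s < t" "t \<le> T"
  defines "\<theta> \<equiv> \<lambda>s. z s - P (u s)"
  shows "L2norm \<Omega> ((1 / (t - s)) *\<^sub>R (\<theta> t - \<theta> s)) + L2norm \<Omega> (grad \<Omega> (\<theta> t))
    \<le> stability_const \<alpha> \<beta> \<delta> * (L2norm \<Omega> (z' 0 - P (u' 0)) + L2norm \<Omega> (grad \<Omega> (\<theta> 0))
      + integral\<^sup>L (lebesgue_on {0..t}) (\<lambda>s. L2norm \<Omega> (\<rho>'' s)))"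
proof -
  let ?N = "seminorm_of (L2dot \<Omega>)" and ?D = "seminorm_of Dirichlet" and ?G = "\<lambda>s. L2norm \<Omega> (\<rho>'' s)"
  define \<theta>' where "\<theta>' \<equiv> \<lambda>s. z' s - P (u' s)"
  have energy: "?G integrable_on {0..T}" "seminorm_deriv ?N {0..T} \<theta> \<theta>'"
    "\<And>t. t \<in> {0..T} \<Longrightarrow> \<theta> t \<in> Vt" "\<And>t. t \<in> {0..T} \<Longrightarrow> \<theta>' t \<in> Vt"
    "\<And>t. t \<in> {0..T} \<Longrightarrow> sqrt (L2dot \<Omega> (\<theta>' t) (\<theta>' t) + bilin \<Omega> A (\<theta> t) (\<theta> t))
      \<le> sqrt (L2dot \<Omega> (\<theta>' 0) (\<theta>' 0) + bilin \<Omega> A (\<theta> 0) (\<theta> 0)) + integral {0..t} ?G"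
    unfolding \<theta>_def \<theta>'_def
    using semidiscrete_energy[OF Veq T u z u_tt z'' \<rho>''] by blast+
  define R where "R = integral {0..t} ?G"
  have Gnn: "0 \<le> ?G r" for r by (simp add: L2norm_def)
  have Gint: "?G integrable_on {0..r}" if "r \<le> T" for r
    by (rule integrable_on_subinterval[OF energy(1)]) (use that in auto)
  have R_eq: "integral\<^sup>L (lebesgue_on {0..t}) ?G = R"
  proof -
    have "?G absolutely_integrable_on {0..t}"
      by (rule nonnegative_absolutely_integrable_1[OF Gint[OF st(3)]]) (rule Gnn)
    then have "integrable (lebesgue_on {0..t}) ?G"
      by (rule absolutely_integrable_imp_integrable) simp
    then show ?thesis unfolding R_def by (rule lebesgue_integral_eq_integral) simp
  qed
  have T0: "0 \<in> {0..T}" "t \<in> {0..T}" using T st by auto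
  define S where "S = ?N (\<theta>' 0) + sqrt \<beta> * ?D (\<theta> 0) + R"
  have e0: "sqrt (L2dot \<Omega> (\<theta>' 0) (\<theta>' 0) + bilin \<Omega> A (\<theta> 0) (\<theta> 0)) \<le> ?N (\<theta>' 0) + sqrt \<beta> * ?D (\<theta> 0)"
  proof -
    have "sqrt (L2dot \<Omega> (\<theta>' 0) (\<theta>' 0) + bilin \<Omega> A (\<theta> 0) (\<theta> 0))
        \<le> ?N (\<theta>' 0) + seminorm_of (bilin \<Omega> A) (\<theta> 0)"
      unfolding seminorm_of_def
      by (rule sqrt_add_le_add_sqrt[OF Vm.nonneg[OF energy(4)[OF T0(1)]] Va.nonneg[OF energy(3)[OF T0(1)]]])
    then show ?thesis using bilin_le_Dirichlet[OF Vt_V[OF energy(3)[OF T0(1)]]] by linarith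
  qed
  have e: "sqrt (L2dot \<Omega> (\<theta>' r) (\<theta>' r) + bilin \<Omega> A (\<theta> r) (\<theta> r)) \<le> S" if r: "r \<in> {0..t}" for r
  proof -
    have "integral {0..r} ?G \<le> R"
      unfolding R_def
      by (rule integral_subset_le) (use r st Gint Gnn in auto)
    moreover have "r \<in> {0..T}" using r st by auto
    ultimately show ?thesis using energy(5)[of r] e0 unfolding S_def by linarith
  qed
  have \<theta>'_le: "?N (\<theta>' r) \<le> S" if r: "r \<in> {s..t}" for r
  proof -
    have r': "r \<in> {0..t}" "r \<in> {0..T}" using r st by auto
    have "?N (\<theta>' r) \<le> sqrt (L2dot \<Omega> (\<theta>' r) (\<theta>' r) + bilin \<Omega> A (\<theta> r) (\<theta> r))"
      using Va.nonneg[OF energy(3)[OF r'(2)]] by (simp add: seminorm_of_def)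
    then show ?thesis using e[OF r'(1)] by linarith
  qed
  have S_nn: "0 \<le> S"
    using \<theta>'_le[of t] Vm.nrm_nonneg[OF energy(4)[OF T0(2)]] st by simp
  have mem: "\<theta> t \<in> Vt" "\<theta> s \<in> Vt" "\<theta> 0 \<in> Vt" "\<theta>' 0 \<in> Vt" using energy(3,4) st T0 by auto
  have "?N (\<theta> t - \<theta> s) \<le> S * (t - s)"
    by (rule Vm.seminorm_increment_le[OF energy(3,4,2)]) (use st \<theta>'_le S_nn in auto)
  then have "?N ((1 / (t - s)) *\<^sub>R (\<theta> t - \<theta> s)) \<le> 1 * S"
    using st mem by (subst Vm.nrm_scale) (auto simp: field_simps)
  also have "\<dots> \<le> M\<^sub>1 \<delta> * S" using constants(1)[OF \<delta>] S_nn by (rule mult_right_mono)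
  finally have A1: "?N ((1 / (t - s)) *\<^sub>R (\<theta> t - \<theta> s)) \<le> M\<^sub>1 \<delta> * S" .
  have "seminorm_of (bilin \<Omega> A) (\<theta> t) \<le> sqrt (L2dot \<Omega> (\<theta>' t) (\<theta>' t) + bilin \<Omega> A (\<theta> t) (\<theta> t))"
    using Vm.nonneg[OF energy(4)[OF T0(2)]] by (simp add: seminorm_of_def)
  then have "sqrt \<alpha> * ?D (\<theta> t) \<le> 2 * S"
    using e[of t] Dirichlet_le_bilin[OF Vt_V[OF mem(1)]] st S_nn by auto
  then have "?D (\<theta> t) \<le> 2 / sqrt \<alpha> * S" using pos by (simp add: field_simps)
  also have "\<dots> \<le> M\<^sub>1 \<delta> * S" using constants(3)[OF \<delta>] S_nn by (rule mult_right_mono)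
  finally have A2: "?D (\<theta> t) \<le> M\<^sub>1 \<delta> * S" .
  have R_nn: "0 \<le> R"
    unfolding R_def by (rule integral_nonneg[OF Gint[OF st(3)]]) (rule Gnn)
  have nn: "0 \<le> ?N (\<theta>' 0)" "0 \<le> ?D (\<theta> 0)"
    using Vm.nrm_nonneg[OF mem(4)] D.nrm_nonneg[OF Vt_H1[OF mem(3)]] by auto
  have "S \<le> M\<^sub>2 \<delta> * ?N (\<theta>' 0) + M\<^sub>2 \<delta> * ?D (\<theta> 0) + M\<^sub>2 \<delta> * R"
    unfolding S_def
    using mult_right_mono[OF constants(4)[OF \<delta>] nn(1)] mult_right_mono[OF constants(6)[OF \<delta>] nn(2)]
      mult_right_mono[OF constants(4)[OF \<delta>] R_nn] by simp
  then have S_le: "S \<le> M\<^sub>2 \<delta> * (?N (\<theta>' 0) + ?D (\<theta> 0) + R)" by (simp add: distrib_left)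
  have "?N ((1 / (t - s)) *\<^sub>R (\<theta> t - \<theta> s)) + ?D (\<theta> t) \<le> 2 * M\<^sub>1 \<delta> * S" using A1 A2 by simp
  also have "\<dots> \<le> 2 * M\<^sub>1 \<delta> * (M\<^sub>2 \<delta> * (?N (\<theta>' 0) + ?D (\<theta> 0) + R))"
    using S_le constants(1)[OF \<delta>] by (intro mult_left_mono) auto
  finally show ?thesis
    unfolding L2norm_grad R_eq unfolding L2norm_eq_seminorm stability_const_eq
    by (simp add: mult.assoc \<theta>'_def)
qed

end

section \<open>Meshes and the error estimate\<close>

lemma bounded_domain_convex_polytopal:
  "convex_polytopal_domain \<Omega> \<Longrightarrow> bounded_domain \<Omega>"
  unfolding convex_polytopal_domain_def bounded_domain_def
  by (blast intro: bounded_subset[OF polytope_imp_bounded closure_subset])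

lemma fe_mesh_size_pos:
  assumes "fe_mesh R P \<Omega> \<F> H \<kappa>" "\<Omega> \<noteq> {}"
  shows "0 < H"
proof -
  note mesh = assms(1)[unfolded fe_mesh_def]
  have fin: "finite \<F>" by (rule conjunct1[OF mesh])
  have cover: "(\<Union>F\<in>\<F>. F ` R) = closure \<Omega>"
    by (rule conjunct1[OF conjunct2[OF mesh]])
  have size: "H = Max ((\<lambda>F. diameter (F ` R)) ` \<F>)"
    by (rule conjunct1[OF conjunct2[OF conjunct2[OF conjunct2[OF conjunct2[OF mesh]]]]])
  note elements = conjunct1[OF conjunct2[OF conjunct2[OF conjunct2[OF conjunct2[OF conjunct2[OF conjunct2[OF mesh]]]]]]]
  have "\<F> \<noteq> {}"
  proof
    assume "\<F> = {}"
    with cover have "closure \<Omega> = {}" by simp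
    then show False using assms(2) by simp
  qed
  then obtain F where F: "F \<in> \<F>" by auto
  have "0 < diameter (F ` R)" by (rule conjunct1[OF bspec[OF elements F]])
  also have "\<dots> \<le> H" unfolding size using fin F by (intro Max_ge) auto
  finally show ?thesis .
qed

lemma P1_lincomb:
  assumes "p \<in> P1" "q \<in> P1" shows "(\<lambda>x. a * p x + b * q x) \<in> P1"
proof -
  obtain v c where p: "p = (\<lambda>x. v \<bullet> x + c)" using assms(1) by (auto simp: P1_def)
  obtain w d where q: "q = (\<lambda>x. w \<bullet> x + d)" using assms(2) by (auto simp: P1_def)
  have "(\<lambda>x. a * p x + b * q x) = (\<lambda>x. (a *\<^sub>R v + b *\<^sub>R w) \<bullet> x + (a * c + b * d))"
    by (simp add: p q fun_eq_iff inner_add_left algebra_simps)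
  then show ?thesis by (auto simp: P1_def)
qed

lemma Q1_lincomb:
  assumes "p \<in> Q1" "q \<in> Q1" shows "(\<lambda>x. a * p x + b * q x) \<in> Q1"
proof -
  obtain c where p: "p = (\<lambda>x. \<Sum>S\<in>UNIV. c S * (\<Prod>i\<in>S. x $ i))" using assms(1) by (auto simp: Q1_def)
  obtain d where q: "q = (\<lambda>x. \<Sum>S\<in>UNIV. d S * (\<Prod>i\<in>S. x $ i))" using assms(2) by (auto simp: Q1_def)
  have "(\<lambda>x. a * p x + b * q x) = (\<lambda>x. \<Sum>S\<in>UNIV. (a * c S + b * d S) * (\<Prod>i\<in>S. x $ i))"
    by (simp add: p q fun_eq_iff sum_distrib_left sum.distrib algebra_simps)
  then show ?thesis unfolding Q1_def by (intro CollectI exI[of _ "\<lambda>S. a * c S + b * d S"])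
qed

lemma subspace_fe_space:
  assumes V: "subspace (H1_Gamma \<Omega> \<Gamma>)"
    and P: "P \<noteq> {}" "\<And>p q a b. p \<in> P \<Longrightarrow> q \<in> P \<Longrightarrow> (\<lambda>x. a * p x + b * q x) \<in> P"
  shows "subspace (fe_space R P \<Omega> \<Gamma> \<F>)"
proof -
  have lin: "a *\<^sub>R v + b *\<^sub>R w \<in> fe_space R P \<Omega> \<Gamma> \<F>"
    if v: "v \<in> fe_space R P \<Omega> \<Gamma> \<F>" and w: "w \<in> fe_space R P \<Omega> \<Gamma> \<F>" for a b v w
    unfolding fe_space_def
  proof (intro CollectI conjI ballI)
    show "a *\<^sub>R v + b *\<^sub>R w \<in> H1_Gamma \<Omega> \<Gamma>"
      using v w by (intro subspace_add[OF V] subspace_scale[OF V]) (auto simp: fe_space_def)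
    have "continuous_on (closure \<Omega>) (\<lambda>x. a * v x + b * w x)"
      using v w by (intro continuous_intros) (auto simp: fe_space_def)
    then show "continuous_on (closure \<Omega>) (a *\<^sub>R v + b *\<^sub>R w)"
      by (simp add: plus_fun_def scaleR_fun_def)
    fix F assume F: "F \<in> \<F>"
    obtain p where p: "p \<in> P" "\<forall>x\<in>R. v (F x) = p x"
      using v F unfolding fe_space_def by blast
    obtain q where q: "q \<in> P" "\<forall>x\<in>R. w (F x) = q x"
      using w F unfolding fe_space_def by blast
    from p q show "\<exists>r\<in>P. \<forall>x\<in>R. (a *\<^sub>R v + b *\<^sub>R w) (F x) = r x"
      by (intro bexI[OF _ P(2)[of p q a b]]) auto
  qed
  have "0 \<in> fe_space R P \<Omega> \<Gamma> \<F>"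
    unfolding fe_space_def
  proof (intro CollectI conjI ballI)
    show "0 \<in> H1_Gamma \<Omega> \<Gamma>" by (rule subspace_0[OF V])
    show "continuous_on (closure \<Omega>) (0 :: real^'a \<Rightarrow> real)" by (simp add: zero_fun_def)
    obtain p where "p \<in> P" using P(1) by blast
    then have "(\<lambda>x. 0 * p x + 0 * p x) \<in> P" by (intro P(2))
    then show "\<exists>q\<in>P. \<forall>x\<in>R. (0 :: real^'a \<Rightarrow> real) (F x) = q x" for F
      by (intro bexI[of _ "\<lambda>x. 0 * p x + 0 * p x"]) auto
  qed
  then show ?thesis using lin[of _ _ 1 1] lin[of _ _ _ 0] by (intro subspaceI) auto
qed

theorem theorem2p5:
  fixes \<Omega> \<Gamma> R :: "(real^'d) set" and A :: "real^'d \<Rightarrow> real^'d^'d" and \<alpha> \<beta> \<delta> :: real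
    and P V VH W Vt :: "(real^'d \<Rightarrow> real) set"
    and \<F> :: "(real^'d \<Rightarrow> real^'d) set" and H \<kappa> Cinv CI :: real
    and I C :: "(real^'d \<Rightarrow> real) \<Rightarrow> (real^'d \<Rightarrow> real)"
    and T \<tau> :: real and N :: nat
    and f u u' u_tt z z' z'' \<rho> \<rho>'' :: "real \<Rightarrow> real^'d \<Rightarrow> real"
    and u'' :: "real \<Rightarrow> (real^'d \<Rightarrow> real) \<Rightarrow> real"
    and u0 v0 :: "real^'d \<Rightarrow> real"
    and ut E :: "nat \<Rightarrow> real^'d \<Rightarrow> real" and t :: "nat \<Rightarrow> real"
  assumes dim: "CARD('d) \<in> {2, 3}"
    and domain: "convex_polytopal_domain \<Omega>"
    and Gamma: "\<Gamma> \<subseteq> frontier \<Omega>" "hausdorff_outer (CARD('d) - 1) \<Gamma> \<noteq> 0"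
    and V: "V = H1_Gamma \<Omega> \<Gamma>"
    and coeff: "0 < \<alpha>" "\<alpha> \<le> \<beta>" "admissible_coefficient \<Omega> \<alpha> \<beta> A"
    and ref: "(R, P) = (reference_simplex, P1) \<or> (R, P) = (reference_cube, Q1)"
    and mesh: "fe_mesh R P \<Omega> \<F> H \<kappa>"
    and VH: "VH = fe_space R P \<Omega> \<Gamma> \<F>"
    and inv: "inverse_inequality \<Omega> VH H Cinv"
    and interp: "quasi_interpolation \<Omega> V VH H CI I"
    and W: "W = fine_space \<Omega> V I"
    and corr: "is_corrector \<Omega> A V W C"
    and Vt: "Vt = multiscale_space \<Omega> V VH C"
    and data: "0 < T" "u0 \<in> V" "v0 \<in> L2 \<Omega>"
      "bochner_Lp 2 T (L2 \<Omega>) (L2norm \<Omega>) f" "\<forall>s\<in>{0..T}. f s \<in> L2 \<Omega>"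
    and step: "0 < \<tau>" "N = nat \<lceil>T / \<tau>\<rceil>" "t = (\<lambda>n. real n * \<tau>)"
    and CFL: "0 < \<delta>" "1 - 1/2 * \<beta> * Cinv\<^sup>2 * CI\<^sup>2 * (inverse H)\<^sup>2 * \<tau>\<^sup>2 \<ge> \<delta>"
    and u: "weak_wave_solution \<Omega> \<Gamma> A T f u0 v0 u u' u''"
    and z: "semidiscrete_solution \<Omega> A Vt T f (ms_proj C I u0) (ms_proj C I v0) z z' z''"
    and ut: "leapfrog_solution \<Omega> A Vt \<tau> N (\<lambda>n. f (t n)) ut" "ae_eq \<Omega> (ut 0) (ms_proj C I u0)"
    \<comment> \<open>the second time derivative of \<open>u\<close> lies in \<open>L\<^sup>1(0,T;L\<^sup>2)\<close>, where it is \<open>u_tt\<close>\<close>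
    and u_tt: "bochner_Lp 1 T (L2 \<Omega>) (L2norm \<Omega>) u_tt"
      "AE s in lebesgue_on {0<..<T}. \<forall>v\<in>V. u'' s v = L2inner \<Omega> (u_tt s) v"
    and z'': "continuous_in (L2norm \<Omega>) {0..T} z''"
    and E: "E = (\<lambda>n. ut n - z (t n))"
    and \<rho>: "\<rho> = (\<lambda>s. u s - ms_proj C I (u s))"
    \<comment> \<open>the second time derivative of \<open>\<rho>\<close>; it equals \<open>u_tt - ms_proj C I u_tt\<close> almost everywhere\<close>
    and \<rho>'': "bochner_Lp 1 T (L2 \<Omega>) (L2norm \<Omega>) \<rho>''" "L2_time_deriv 2 T \<Omega> \<rho> \<rho>''"
  shows "leapfrog_stable \<Omega> A Vt \<tau> N (stability_const \<alpha> \<beta> \<delta>) \<and>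
    (\<forall>n\<ge>1. t (n + 1) \<le> T \<longrightarrow>
      L2norm \<Omega> (\<lambda>x. ((ut (n + 1) x - u (t (n + 1)) x) - (ut n x - u (t n) x)) / \<tau>)
      + L2norm \<Omega> (grad \<Omega> (ut (n + 1) - u (t (n + 1))))
      \<le> stability_const \<alpha> \<beta> \<delta> *
         (L2norm \<Omega> (\<lambda>x. (E 1 x - E 0 x) / \<tau>)
          + L2norm \<Omega> (grad \<Omega> (E 1))
          + L2norm \<Omega> (z' 0 - ms_proj C I (u' 0))
          + L2norm \<Omega> (grad \<Omega> (z 0 - ms_proj C I (u 0)))
          + L2norm \<Omega> (\<lambda>x. (\<rho> (t (n + 1)) x - \<rho> (t n) x) / \<tau>)
          + L2norm \<Omega> (grad \<Omega> (\<rho> (t (n + 1))))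
          + integral\<^sup>L (lebesgue_on {0..t (n + 1)}) (\<lambda>s. L2norm \<Omega> (\<rho>'' s))
          + (\<Sum>k=1..n. \<tau> * L2norm \<Omega>
               (\<lambda>x. (z (t (k + 1)) x - 2 * z (t k) x + z (t (k - 1)) x) / \<tau>\<^sup>2 - z'' (t k) x))))"
proof (intro conjI allI impI)
  have \<Omega>: "bounded_domain \<Omega>" and ne: "\<Omega> \<noteq> {}"
    using bounded_domain_convex_polytopal[OF domain] domain by (auto simp: convex_polytopal_domain_def)
  note V_eq = V
  interpret bounded_domain \<Omega> by (rule \<Omega>)
  have "P = P1 \<or> P = Q1" using ref by auto
  moreover have "(P1 :: (real^'d \<Rightarrow> real) set) \<noteq> {}" "(Q1 :: (real^'d \<Rightarrow> real) set) \<noteq> {}"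
    by (auto simp: P1_def Q1_def)
  ultimately have P: "P \<noteq> {}" "\<And>p q a b. p \<in> P \<Longrightarrow> q \<in> P \<Longrightarrow> (\<lambda>x. a * p x + b * q x) \<in> P"
    using P1_lincomb Q1_lincomb by blast+
  interpret multiscale \<Omega> A \<alpha> \<beta> V VH W Vt H Cinv CI I C
  proof unfold_locales
    show "subspace V" unfolding V by (rule subspace_H1_Gamma)
    show "V \<subseteq> H1 \<Omega>" unfolding V by (rule H1_Gamma_subset_H1)
    show "subspace VH" unfolding VH by (rule subspace_fe_space[OF subspace_H1_Gamma P])
    show "VH \<subseteq> V" unfolding VH V by (auto simp: fe_space_def)
    show "0 < H" by (rule fe_mesh_size_pos[OF mesh ne])
  qed (fact coeff inv interp W corr Vt)+
  show "leapfrog_stable \<Omega> A Vt \<tau> N (stability_const \<alpha> \<beta> \<delta>)"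
    by (rule leapfrog_stable[OF CFL(1) step(1) CFL(2)])
  fix n :: nat assume n: "1 \<le> n" and tn: "t (n + 1) \<le> T"
  let ?N = "seminorm_of (L2dot \<Omega>)" and ?D = "seminorm_of Dirichlet" and ?C = "stability_const \<alpha> \<beta> \<delta>"
  have \<delta>1: "\<delta> \<le> 1" by (rule CFL_imp_le_1[OF CFL(2)])
  have tn': "real (Suc n) * \<tau> \<le> T" using tn by (simp add: step(3))
  have "Suc n \<le> N"
  proof -
    have "real (Suc n) \<le> T / \<tau>" using tn' step(1) by (simp add: field_simps)
    then have "real (Suc n) \<le> of_int \<lceil>T / \<tau>\<rceil>" using le_of_int_ceiling[of "T / \<tau>"] by linarith
    then have "int (Suc n) \<le> \<lceil>T / \<tau>\<rceil>" by (metis of_int_le_iff of_int_of_nat_eq)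
    then show ?thesis unfolding step(2) by simp
  qed
  define \<theta> where "\<theta> \<equiv> \<lambda>s. z s - ms_proj C I (u s)"
  have tstep: "t (n + 1) - t n = \<tau>" by (simp add: step(3) algebra_simps)
  have tI: "t n \<in> {0..T}" "t (n + 1) \<in> {0..T}"
    using tn tstep step(1) by (auto simp: step(3))
  have E_bound: "L2norm \<Omega> ((1 / \<tau>) *\<^sub>R (E (Suc n) - E n)) + L2norm \<Omega> (grad \<Omega> (E (Suc n)))
    \<le> ?C * (L2norm \<Omega> ((1 / \<tau>) *\<^sub>R (E 1 - E 0)) + L2norm \<Omega> (grad \<Omega> (E 1))
      + (\<Sum>k=1..n. \<tau> * L2norm \<Omega> ((1 / \<tau>\<^sup>2) *\<^sub>R (z (t (k + 1)) - 2 *\<^sub>R z (t k) + z (t (k - 1))) - z'' (t k))))"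
    using discrete_error[OF CFL(1) step(1) CFL(2) z ut[unfolded step(3)] tn' \<open>Suc n \<le> N\<close>] data(5)
    unfolding E step(3) by blast
  have \<theta>_bound: "L2norm \<Omega> ((1 / \<tau>) *\<^sub>R (\<theta> (t (n + 1)) - \<theta> (t n))) + L2norm \<Omega> (grad \<Omega> (\<theta> (t (n + 1))))
    \<le> ?C * (L2norm \<Omega> (z' 0 - ms_proj C I (u' 0)) + L2norm \<Omega> (grad \<Omega> (\<theta> 0))
      + integral\<^sup>L (lebesgue_on {0..t (n + 1)}) (\<lambda>s. L2norm \<Omega> (\<rho>'' s)))"
    using semidiscrete_error[OF V_eq data(1) CFL(1) \<delta>1 u z u_tt z'' \<rho>''(1) \<rho>''(2)[unfolded \<rho>], of "t n" "t (n + 1)"]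
      tI tn tstep step(1) unfolding \<theta>_def by simp
  \<comment> \<open>the projection error enters with the factor one, which is absorbed in the constant\<close>
  have C1: "1 \<le> ?C"
  proof -
    have "1 * 1 \<le> M\<^sub>1 \<delta> * M\<^sub>2 \<delta>" using constants(1,4)[OF CFL(1) \<delta>1] by (intro mult_mono) auto
    then show ?thesis unfolding stability_const_eq by simp
  qed
  have uV: "u (t n) \<in> V" "u (t (n + 1)) \<in> V"
    using u tI by (auto simp: weak_wave_solution_def V_eq)
  have \<rho>V: "\<rho> (t n) \<in> V" "\<rho> (t (n + 1)) \<in> V"
    unfolding \<rho> using uV by (auto intro!: V_closed P_V V_L2)
  have zVt: "z (t n) \<in> Vt" "z (t (n + 1)) \<in> Vt"
    using z tI by (auto simp: semidiscrete_solution_def)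
  have \<theta>V: "\<theta> (t n) \<in> V" "\<theta> (t (n + 1)) \<in> V"
    unfolding \<theta>_def using uV zVt by (auto intro: V_closed(2) P_V V_L2 Vt_V)
  have EV: "E n \<in> V" "E (n + 1) \<in> V"
    unfolding E using ut(1) zVt \<open>Suc n \<le> N\<close> by (auto intro!: V_closed Vt_V simp: leapfrog_solution_def)
  have memL: "E n \<in> L2 \<Omega>" "E (n + 1) \<in> L2 \<Omega>" "\<theta> (t n) \<in> L2 \<Omega>" "\<theta> (t (n + 1)) \<in> L2 \<Omega>"
    "\<rho> (t n) \<in> L2 \<Omega>" "\<rho> (t (n + 1)) \<in> L2 \<Omega>"
    using EV \<theta>V \<rho>V V_L2 by auto
  have memH: "E (n + 1) \<in> H1 \<Omega>" "\<theta> (t (n + 1)) \<in> H1 \<Omega>" "\<rho> (t (n + 1)) \<in> H1 \<Omega>"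
    using EV \<theta>V \<rho>V V_H1 by auto
  define dE d\<theta> d\<rho> where "dE = (1 / \<tau>) *\<^sub>R (E (n + 1) - E n)"
    and "d\<theta> = (1 / \<tau>) *\<^sub>R (\<theta> (t (n + 1)) - \<theta> (t n))" and "d\<rho> = (1 / \<tau>) *\<^sub>R (\<rho> (t (n + 1)) - \<rho> (t n))"
  have dL: "dE \<in> L2 \<Omega>" "d\<theta> \<in> L2 \<Omega>" "d\<rho> \<in> L2 \<Omega>" using memL by (auto simp: dE_def d\<theta>_def d\<rho>_def)
  have split: "ut k - u (t k) = E k + \<theta> (t k) - \<rho> (t k)" for k
    by (simp add: E \<theta>_def \<rho>)
  have "(\<lambda>x. ((ut (n + 1) x - u (t (n + 1)) x) - (ut n x - u (t n) x)) / \<tau>)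
      = (1 / \<tau>) *\<^sub>R ((ut (n + 1) - u (t (n + 1))) - (ut n - u (t n)))"
    by (simp add: fun_eq_iff)
  also have "\<dots> = dE + d\<theta> - d\<rho>"
    unfolding split dE_def d\<theta>_def d\<rho>_def by (simp add: scaleR_diff_right scaleR_add_right)
  finally have time_diff: "(\<lambda>x. ((ut (n + 1) x - u (t (n + 1)) x) - (ut n x - u (t n) x)) / \<tau>) = dE + d\<theta> - d\<rho>" .
  have "?N (dE + d\<theta> - d\<rho>) \<le> ?N dE + ?N d\<theta> + ?N d\<rho>"
    using L2s.nrm_triangle_diff[of "dE + d\<theta>" d\<rho>] L2s.nrm_triangle[of dE d\<theta>] dL by simp
  moreover have "?D (E (n + 1) + \<theta> (t (n + 1)) - \<rho> (t (n + 1))) \<le> ?D (E (n + 1)) + ?D (\<theta> (t (n + 1))) + ?D (\<rho> (t (n + 1)))"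
    using D.nrm_triangle_diff[of "E (n + 1) + \<theta> (t (n + 1))" "\<rho> (t (n + 1))"]
      D.nrm_triangle[of "E (n + 1)" "\<theta> (t (n + 1))"] memH by simp
  moreover have "?N d\<rho> + ?D (\<rho> (t (n + 1))) \<le> ?C * (?N d\<rho> + ?D (\<rho> (t (n + 1))))"
    using mult_right_mono[OF C1, of "?N d\<rho> + ?D (\<rho> (t (n + 1)))"] L2s.nrm_nonneg[OF dL(3)] D.nrm_nonneg[OF memH(3)] by simp
  ultimately have total: "?N (dE + d\<theta> - d\<rho>) + ?D (ut (n + 1) - u (t (n + 1)))
      \<le> ?C * (L2norm \<Omega> ((1 / \<tau>) *\<^sub>R (E 1 - E 0)) + L2norm \<Omega> (grad \<Omega> (E 1))
      + (\<Sum>k=1..n. \<tau> * L2norm \<Omega> ((1 / \<tau>\<^sup>2) *\<^sub>R (z (t (k + 1)) - 2 *\<^sub>R z (t k) + z (t (k - 1))) - z'' (t k))))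
      + ?C * (L2norm \<Omega> (z' 0 - ms_proj C I (u' 0)) + L2norm \<Omega> (grad \<Omega> (\<theta> 0))
      + integral\<^sup>L (lebesgue_on {0..t (n + 1)}) (\<lambda>s. L2norm \<Omega> (\<rho>'' s)))
      + ?C * (?N d\<rho> + ?D (\<rho> (t (n + 1))))"
    using E_bound \<theta>_bound unfolding split L2norm_grad unfolding L2norm_eq_seminorm Suc_eq_plus1 dE_def[symmetric] d\<theta>_def[symmetric]
    by linarith
  have forms: "(\<lambda>x. (E 1 x - E 0 x) / \<tau>) = (1 / \<tau>) *\<^sub>R (E 1 - E 0)"
    "(\<lambda>x. (\<rho> (t (n + 1)) x - \<rho> (t n) x) / \<tau>) = d\<rho>"
    "\<And>k. (\<lambda>x. (z (t (k + 1)) x - 2 * z (t k) x + z (t (k - 1)) x) / \<tau>\<^sup>2 - z'' (t k) x)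
      = (1 / \<tau>\<^sup>2) *\<^sub>R (z (t (k + 1)) - 2 *\<^sub>R z (t k) + z (t (k - 1))) - z'' (t k)"
    by (simp_all add: fun_eq_iff d\<rho>_def)
  have \<theta>0: "z 0 - ms_proj C I (u 0) = \<theta> 0" by (simp add: \<theta>_def)
  show "L2norm \<Omega> (\<lambda>x. ((ut (n + 1) x - u (t (n + 1)) x) - (ut n x - u (t n) x)) / \<tau>)
      + L2norm \<Omega> (grad \<Omega> (ut (n + 1) - u (t (n + 1))))
      \<le> ?C *
         (L2norm \<Omega> (\<lambda>x. (E 1 x - E 0 x) / \<tau>)
          + L2norm \<Omega> (grad \<Omega> (E 1))
          + L2norm \<Omega> (z' 0 - ms_proj C I (u' 0))
          + L2norm \<Omega> (grad \<Omega> (z 0 - ms_proj C I (u 0)))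
          + L2norm \<Omega> (\<lambda>x. (\<rho> (t (n + 1)) x - \<rho> (t n) x) / \<tau>)
          + L2norm \<Omega> (grad \<Omega> (\<rho> (t (n + 1))))
          + integral\<^sup>L (lebesgue_on {0..t (n + 1)}) (\<lambda>s. L2norm \<Omega> (\<rho>'' s))
          + (\<Sum>k=1..n. \<tau> * L2norm \<Omega>
               (\<lambda>x. (z (t (k + 1)) x - 2 * z (t k) x + z (t (k - 1)) x) / \<tau>\<^sup>2 - z'' (t k) x)))"
    unfolding time_diff forms \<theta>0
    using total unfolding L2norm_grad[of "ut (n + 1) - u (t (n + 1))"] L2norm_grad[of "\<rho> (t (n + 1))"]
      L2norm_eq_seminorm[of \<Omega>, where ?'b = real] distrib_left
    by linarith
qed

end
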